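(* Let $\phi:(\mathbb X,\sigma_0)\to(\mathbb Y,\tau_0)$ be a covering of developable complexes of groups over a morphism of scwols $f:X\to Y$. Let $G:=\pi_1(\mathbb Y,\tau_0)$ and $U:=\phi_\ast(\pi_1(\mathbb X,\sigma_0))\le G$. Furthermore, let $K:=\ker(\pi_1(\mathbb Y,\tau_0)\curvearrowright\tilde Y_{\tau_0})$ be the subgroup of elements acting trivially on the universal complex $\tilde Y_{\tau_0}$, and let $C:=C_G(U)\cap K$, where $C_G(U)$ is the centralizer of $U$ in $G$. Then there is an isomorphism of groups $$\mathrm{Deck}(\phi)\cong N_G(U)/(C\cdot U),$$ where $N_G(U)$ is the normalizer of $U$ in $G$.
   Context: Scwols. A scwol $X$ consists of sets $VX$ (vertices), $EX$ (edges), maps $i,t:EX\to VX$ and a composition $E^2X:=\{(a,b)\in EX\times EX: i(a)=t(b)\}\to EX$, $(a,b)\mapsto ab$, with $i(ab)=i(b)$, $t(ab)=t(a)$; $(ab)c=a(bc)$ whenever $i(a)=t(b)$, $i(b)=t(c)$; and $i(a)\neq t(a)$ for all $a\in EX$. $E^3X$ is the set of triples of edges $(a,b,c)$ with $i(a)=t(b)$, $i(b)=t(c)$. A morphism of scwols $f:X\to Y$ maps vertices to vertices and edges to edges, commutes with $i,t$, satisfies $f(ab)=f(a)f(b)$ for $(a,b)\in E^2X$, and for each $\sigma\in VX$ restricts to a bijection $\{a\in EX:i(a)=\sigma\}\to\{a'\in EY:i(a')=f(\sigma)\}$; it is an isomorphism if it is bijective on vertices and edges. Complexes of groups. A complex of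 groups $\mathbb X$ over $X$ is a tuple $((G_\sigma)_{\sigma\in VX},(\psi_a)_{a\in EX},(g_{a,b})_{(a,b)\in E^2X})$ with groups $G_\sigma$, injective homomorphisms $\psi_a:G_{i(a)}\to G_{t(a)}$ and elements $g_{a,b}\in G_{t(a)}$ such that $c_{g_{a,b}}\circ\psi_{ab}=\psi_a\circ\psi_b$ on $E^2X$ and $\psi_a(g_{b,c})g_{a,bc}=g_{a,b}g_{ab,c}$ on $E^3X$, where $c_h(g)=hgh^{-1}$. The same letters are used for all complexes of groups. Underlying scwols are always assumed connected (any two vertices are joined by a finite path as defined below). Morphisms. A morphism $\phi:\mathbb X\to\mathbb Y$ over $f:X\to Y$ consists of $f$, homomorphisms $\phi_\sigma:G_\sigma\to G_{f(\sigma)}$ ($\sigma\in VX$) and elements $\phi(a)\in G_{f(t(a))}$ ($a\in EX$) with $c_{\phi(a)}\circ\psi_{f(a)}\circ\phi_{i(a)}=\phi_{t(a)}\circ\psi_a$ for $a\in EX$ and $\phi_{t(a)}(g_{a,b})\phi(ab)=\phi(a)\psi_{f(a)}(\phi(b))g_{f(a),f(b)}$ for $(a,b)\in E^2X$. Writing $\phi:(\mathbb X,\sigma_0)\to(\mathbb Y,\tau_0)$ means $\sigma_0\in VX$ and $f(\sigma_0)=\tau_0$. The composition of $\phi:\mathbb U\to\mathbb X$ over $f$ and $\eta:\mathbb X\to\mathbb Y$ over $g$ is the morphism $\eta\circ\phi$ over $g\circ f$ with $(\eta\circ\phi)_\sigma=\eta_{f(\sigma)}\circ\phi_\sigma$ and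 $(\eta\circ\phi)(a)=\eta_{f(t(a))}(\phi(a))\,\eta(f(a))$. $\phi$ is an isomorphism if $f$ and all $\phi_\sigma$ are isomorphisms; $\mathrm{Aut}(\mathbb X)$ is the set of isomorphisms $\mathbb X\to\mathbb X$. Coverings. A morphism $\phi:\mathbb X\to\mathbb Y$ over a surjective $f:X\to Y$ is a covering if for all $\sigma\in VX$: $\phi_\sigma$ is injective, and for all $a'\in EY$ with $t(a')=f(\sigma)$ the map $\coprod_{a\in f^{-1}(a'),\,t(a)=\sigma}G_\sigma/\psi_a(G_{i(a)})\to G_{f(\sigma)}/\psi_{a'}(G_{i(a')})$, $g\,\psi_a(G_{i(a)})\mapsto\phi_\sigma(g)\phi(a)\,\psi_{a'}(G_{i(a')})$, is a bijection. Paths. Oriented edges are the $a\in EX$ and formal inverses $a^{-1}$, with $i(a^{-1})=t(a)$, $t(a^{-1})=i(a)$, $(a^{-1})^{-1}=a$. A path in $X$ is a finite sequence of oriented edges $(e_1,\dots,e_k)$ with $t(e_j)=i(e_{j+1})$. An $\mathbb X$-path is a tuple $p=(g_0,e_1,g_1,\dots,e_k,g_k)$ with $(e_1,\dots,e_k)$ a path, $g_0\in G_{i(e_1)}$, $g_j\in G_{t(e_j)}$; $i(p)=i(e_1)$, $t(p)=t(e_k)$ (for length $0$: $p=(g)$ with $g\in G_\sigma$, at a vertex $\sigma$). Concatenation $p\star q$ (when $t(p)=i(q)$) multiplies the last group element of $p$ with the first of $q$; $p^{-1}=(g_k^{-1},e_k^{-1},\dots,e_1^{-1},g_0^{-1})$.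 $\mathcal P_{\sigma}(\mathbb X)$ denotes the set of $\mathbb X$-paths starting at $\sigma$. Homotopy $\sim$ of $\mathbb X$-paths is the equivalence relation generated by the following replacements of subpaths: $(kg,a,h)\to(k,a,\psi_a(g)h)$; $(g,a^{-1},hk)\to(g\psi_a(h),a^{-1},k)$; $(g,a,\psi_a(h),a^{-1},k)\to(ghk)$; $(g,b^{-1},h,b,k)\to(g\psi_b(h)k)$; $(g,b,1,a,k)\to(g,ab,g_{a,b}^{-1}k)$ and $(g,a^{-1},1,b^{-1},k)\to(gg_{a,b},(ab)^{-1},k)$ for $(a,b)\in E^2X$. $[p]$ is the homotopy class. $\pi_1(\mathbb X,\sigma_0)$ is the group of homotopy classes of $\mathbb X$-paths from $\sigma_0$ to $\sigma_0$ with $[p][q]=[p\star q]$. $\mathbb X$ is developable if it arises (up to isomorphism) from an action of a group on a scwol; equivalently (and this may be taken as the definition), for every $\sigma\in VX$ the homomorphism $G_\sigma\to\pi_1(\mathbb X,\sigma)$, $g\mapsto[(g)]$, is injective. Universal complex. For $p,q\in\mathcal P_{\sigma_0}(\mathbb X)$ put $p\equiv q$ iff $[q]=[p\star(g)]$ for some $g\in G_{t(p)}$; $[\![p]\!]$ is the $\equiv$-class. The scwol $\tilde X_{\sigma_0}$ has vertices $[\![p]\!]$, $p\in\mathcal P_{\sigma_0}(\mathbb X)$, edges the triples $([\![p]\!],a,[\![p\star(1,a,1)]\!])$ with $a\in EX$, $i(a)=t(p)$; $i,t$ are the first and third projections, and the composite of $([\![p\star(1,b,1)]\!],a,\cdot)$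 with $([\![p]\!],b,\cdot)$ is $([\![p]\!],ab,[\![p\star(1,ab,1)]\!])$. $\pi_1(\mathbb X,\sigma_0)$ acts on it by $[q]\cdot[\![p]\!]=[\![q\star p]\!]$ and $[q]\cdot([\![p]\!],a,\cdot)=([\![q\star p]\!],a,\cdot)$. Induced homomorphism. $\mathfrak p_\phi$ is the map from $\mathbb X$-paths to $\mathbb Y$-paths compatible with $\star$ and given by $(g)\mapsto(\phi_\sigma(g))$ for $g\in G_\sigma$, $(1,a,1)\mapsto(1,f(a),\phi(a)^{-1})$, $(1,a^{-1},1)\mapsto(\phi(a),f(a)^{-1},1)$; $\phi_\ast=\phi_{\ast,\sigma_0}:\pi_1(\mathbb X,\sigma_0)\to\pi_1(\mathbb Y,f(\sigma_0))$ is $[p]\mapsto[\mathfrak p_\phi(p)]$. Homotopy of morphisms. Morphisms $\phi,\eta:\mathbb X\to\mathbb Y$ over the same $f$ are homotopic, $\phi\sim\eta$, if there are $k_\sigma\in G_{f(\sigma)}$ ($\sigma\in VX$) with $\eta_\sigma=c_{k_\sigma}\circ\phi_\sigma$ and $\eta(a)=k_{t(a)}\phi(a)\psi_{f(a)}(k_{i(a)}^{-1})$ for all $\sigma\in VX$, $a\in EX$. $[\phi]$ is the homotopy class. Deck transformations. $\mathrm{Deck}(\phi)=\{[\eta]:\eta\in\mathrm{Aut}(\mathbb X),\ \phi\sim\phi\circ\eta\}$, a group under $[\eta^1][\eta^2]=[\eta^1\circ\eta^2]$. *)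

theory Defs
  imports "HOL-Algebra.Group_Action" "HOL-Algebra.Left_Coset"
begin

section \<open>Scwols\<close>

record ('v, 'e) scwol =
  verts :: "'v set"
  edges :: "'e set"
  ini :: "'e \<Rightarrow> 'v"
  ter :: "'e \<Rightarrow> 'v"
  cmp :: "'e \<Rightarrow> 'e \<Rightarrow> 'e"

definition E2 :: "('v, 'e, 'm) scwol_scheme \<Rightarrow> ('e \<times> 'e) set" where
  "E2 X = {(a, b). a \<in> edges X \<and> b \<in> edges X \<and> ini X a = ter X b}"

definition E3 :: "('v, 'e, 'm) scwol_scheme \<Rightarrow> ('e \<times> 'e \<times> 'e) set" where
  "E3 X = {(a, b, c). a \<in> edges X \<and> b \<in> edges X \<and> c \<in> edges X \<and>
                      ini X a = ter X b \<and> ini X b = ter X c}"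

locale scwol =
  fixes X :: "('v, 'e, 'm) scwol_scheme"
  assumes ini_closed: "a \<in> edges X \<Longrightarrow> ini X a \<in> verts X"
    and ter_closed: "a \<in> edges X \<Longrightarrow> ter X a \<in> verts X"
    and cmp_closed: "(a, b) \<in> E2 X \<Longrightarrow> cmp X a b \<in> edges X"
    and ini_cmp: "(a, b) \<in> E2 X \<Longrightarrow> ini X (cmp X a b) = ini X b"
    and ter_cmp: "(a, b) \<in> E2 X \<Longrightarrow> ter X (cmp X a b) = ter X a"
    and cmp_assoc: "(a, b, c) \<in> E3 X \<Longrightarrow> cmp X (cmp X a b) c = cmp X a (cmp X b c)"
    and no_loops: "a \<in> edges X \<Longrightarrow> ini X a \<noteq> ter X a"

datatype 'e oriented = Fwd 'e | Bwd 'e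

fun oini :: "('v, 'e, 'm) scwol_scheme \<Rightarrow> 'e oriented \<Rightarrow> 'v" where
  "oini X (Fwd a) = ini X a"
| "oini X (Bwd a) = ter X a"

fun oter :: "('v, 'e, 'm) scwol_scheme \<Rightarrow> 'e oriented \<Rightarrow> 'v" where
  "oter X (Fwd a) = ter X a"
| "oter X (Bwd a) = ini X a"

definition oedges :: "('v, 'e, 'm) scwol_scheme \<Rightarrow> 'e oriented set" where
  "oedges X = Fwd ` edges X \<union> Bwd ` edges X"

text \<open>\<open>path_from X \<sigma> es \<tau>\<close>: the sequence \<open>es\<close> is a path from \<open>\<sigma>\<close> to \<open>\<tau>\<close>.\<close>

fun path_from :: "('v, 'e, 'm) scwol_scheme \<Rightarrow> 'v \<Rightarrow> 'e oriented list \<Rightarrow> 'v \<Rightarrow> bool" where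
  "path_from X \<sigma> [] \<tau> \<longleftrightarrow> \<sigma> \<in> verts X \<and> \<tau> = \<sigma>"
| "path_from X \<sigma> (e # es) \<tau> \<longleftrightarrow> e \<in> oedges X \<and> oini X e = \<sigma> \<and> path_from X (oter X e) es \<tau>"

definition connected_scwol :: "('v, 'e, 'm) scwol_scheme \<Rightarrow> bool" where
  "connected_scwol X \<longleftrightarrow> (\<forall>\<sigma>\<in>verts X. \<forall>\<tau>\<in>verts X. \<exists>es. path_from X \<sigma> es \<tau>)"

record ('v, 'e, 'w, 'd) scwol_morphism =
  vmap :: "'v \<Rightarrow> 'w"
  emap :: "'e \<Rightarrow> 'd"

locale scwol_morphism = X: scwol X + Y: scwol Y
  for X :: "('v, 'e, 'm) scwol_scheme" and Y :: "('w, 'd, 'n) scwol_scheme" +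
  fixes f :: "('v, 'e, 'w, 'd, 'k) scwol_morphism_scheme"
  assumes vmap_closed: "\<sigma> \<in> verts X \<Longrightarrow> vmap f \<sigma> \<in> verts Y"
    and emap_closed: "a \<in> edges X \<Longrightarrow> emap f a \<in> edges Y"
    and ini_emap: "a \<in> edges X \<Longrightarrow> ini Y (emap f a) = vmap f (ini X a)"
    and ter_emap: "a \<in> edges X \<Longrightarrow> ter Y (emap f a) = vmap f (ter X a)"
    and emap_cmp: "(a, b) \<in> E2 X \<Longrightarrow> emap f (cmp X a b) = cmp Y (emap f a) (emap f b)"
    and emap_bij: "\<sigma> \<in> verts X \<Longrightarrow>
      bij_betw (emap f) {a \<in> edges X. ini X a = \<sigma>} {a' \<in> edges Y. ini Y a' = vmap f \<sigma>}"

definition scwol_iso ::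
  "('v, 'e, 'm) scwol_scheme \<Rightarrow> ('w, 'd, 'n) scwol_scheme
   \<Rightarrow> ('v, 'e, 'w, 'd, 'k) scwol_morphism_scheme \<Rightarrow> bool" where
  "scwol_iso X Y f \<longleftrightarrow> scwol_morphism X Y f \<and>
     bij_betw (vmap f) (verts X) (verts Y) \<and> bij_betw (emap f) (edges X) (edges Y)"


section \<open>Complexes of groups\<close>

text \<open>All local groups of a complex live in one element type; they need not be disjoint.\<close>

record ('v, 'e, 'g) complex_of_groups = "('v, 'e) scwol" +
  grp :: "'v \<Rightarrow> 'g monoid"
  psi :: "'e \<Rightarrow> 'g \<Rightarrow> 'g"
  tw :: "'e \<Rightarrow> 'e \<Rightarrow> 'g"

definition conj_by :: "('g, 'm) monoid_scheme \<Rightarrow> 'g \<Rightarrow> 'g \<Rightarrow> 'g" where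
  "conj_by G h g = h \<otimes>\<^bsub>G\<^esub> g \<otimes>\<^bsub>G\<^esub> inv\<^bsub>G\<^esub> h"

locale complex_of_groups = scwol X
  for X :: "('v, 'e, 'g, 'm) complex_of_groups_scheme" +
  assumes connected: "connected_scwol X"
    and grp_group: "\<sigma> \<in> verts X \<Longrightarrow> group (grp X \<sigma>)"
    and psi_mon: "a \<in> edges X \<Longrightarrow> psi X a \<in> mon (grp X (ini X a)) (grp X (ter X a))"
    and tw_closed: "(a, b) \<in> E2 X \<Longrightarrow> tw X a b \<in> carrier (grp X (ter X a))"
    and tw_conj: "\<lbrakk>(a, b) \<in> E2 X; g \<in> carrier (grp X (ini X b))\<rbrakk> \<Longrightarrow>
      conj_by (grp X (ter X a)) (tw X a b) (psi X (cmp X a b) g) = psi X a (psi X b g)"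
    and cocycle: "(a, b, c) \<in> E3 X \<Longrightarrow>
      psi X a (tw X b c) \<otimes>\<^bsub>grp X (ter X a)\<^esub> tw X a (cmp X b c)
        = tw X a b \<otimes>\<^bsub>grp X (ter X a)\<^esub> tw X (cmp X a b) c"


section \<open>Morphisms, homotopy, coverings\<close>

text \<open>A morphism carries its underlying scwol morphism; \<open>gmap \<phi> \<sigma>\<close> is the local homomorphism
  at \<open>\<sigma>\<close> and \<open>telt \<phi> a\<close> is the element written \<open>\<phi>(a)\<close>.\<close>

record ('v, 'e, 'w, 'd, 'g, 'h) cog_morphism = "('v, 'e, 'w, 'd) scwol_morphism" +
  gmap :: "'v \<Rightarrow> 'g \<Rightarrow> 'h"
  telt :: "'e \<Rightarrow> 'h"

locale cog_morphism =
  X: complex_of_groups X + Y: complex_of_groups Y + scwol_morphism X Y \<phi>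
  for X :: "('v, 'e, 'g, 'm) complex_of_groups_scheme"
    and Y :: "('w, 'd, 'h, 'n) complex_of_groups_scheme"
    and \<phi> :: "('v, 'e, 'w, 'd, 'g, 'h) cog_morphism" +
  assumes gmap_hom: "\<sigma> \<in> verts X \<Longrightarrow> gmap \<phi> \<sigma> \<in> hom (grp X \<sigma>) (grp Y (vmap \<phi> \<sigma>))"
    and telt_closed: "a \<in> edges X \<Longrightarrow> telt \<phi> a \<in> carrier (grp Y (vmap \<phi> (ter X a)))"
    and telt_conj: "\<lbrakk>a \<in> edges X; g \<in> carrier (grp X (ini X a))\<rbrakk> \<Longrightarrow>
      conj_by (grp Y (vmap \<phi> (ter X a))) (telt \<phi> a) (psi Y (emap \<phi> a) (gmap \<phi> (ini X a) g))
        = gmap \<phi> (ter X a) (psi X a g)"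
    and telt_cmp: "(a, b) \<in> E2 X \<Longrightarrow>
      gmap \<phi> (ter X a) (tw X a b) \<otimes>\<^bsub>grp Y (vmap \<phi> (ter X a))\<^esub> telt \<phi> (cmp X a b)
        = telt \<phi> a \<otimes>\<^bsub>grp Y (vmap \<phi> (ter X a))\<^esub> psi Y (emap \<phi> a) (telt \<phi> b)
            \<otimes>\<^bsub>grp Y (vmap \<phi> (ter X a))\<^esub> tw Y (emap \<phi> a) (emap \<phi> b)"

text \<open>\<open>cog_compose U Z \<eta> \<phi>\<close> is \<open>\<eta> \<circ> \<phi>\<close>, where \<open>\<phi>\<close> starts at \<open>U\<close> and \<open>\<eta>\<close> ends at \<open>Z\<close>.\<close>

definition cog_compose ::
  "('u, 'c, 'f, 'l) complex_of_groups_scheme \<Rightarrow> ('w, 'd, 'h, 'n) complex_of_groups_scheme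
   \<Rightarrow> ('v, 'e, 'w, 'd, 'g, 'h) cog_morphism \<Rightarrow> ('u, 'c, 'v, 'e, 'f, 'g) cog_morphism
   \<Rightarrow> ('u, 'c, 'w, 'd, 'f, 'h) cog_morphism" where
  "cog_compose U Z \<eta> \<phi> =
     \<lparr>vmap = vmap \<eta> \<circ> vmap \<phi>,
      emap = emap \<eta> \<circ> emap \<phi>,
      gmap = (\<lambda>\<sigma>. gmap \<eta> (vmap \<phi> \<sigma>) \<circ> gmap \<phi> \<sigma>),
      telt = (\<lambda>a. gmap \<eta> (vmap \<phi> (ter U a)) (telt \<phi> a)
                    \<otimes>\<^bsub>grp Z (vmap \<eta> (vmap \<phi> (ter U a)))\<^esub> telt \<eta> (emap \<phi> a))\<rparr>"

definition cog_id ::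
  "('v, 'e, 'g, 'm) complex_of_groups_scheme \<Rightarrow> ('v, 'e, 'v, 'e, 'g, 'g) cog_morphism" where
  "cog_id X = \<lparr>vmap = id, emap = id, gmap = (\<lambda>_. id), telt = (\<lambda>a. \<one>\<^bsub>grp X (ter X a)\<^esub>)\<rparr>"

definition Aut ::
  "('v, 'e, 'g, 'm) complex_of_groups_scheme \<Rightarrow> ('v, 'e, 'v, 'e, 'g, 'g) cog_morphism set" where
  "Aut X = {\<eta>. cog_morphism X X \<eta> \<and> scwol_iso X X \<eta> \<and>
                (\<forall>\<sigma>\<in>verts X. gmap \<eta> \<sigma> \<in> iso (grp X \<sigma>) (grp X (vmap \<eta> \<sigma>)))}"

text \<open>Morphisms are compared on the vertices, edges and local groups only, so two representations
  of the same morphism that differ outside these sets are homotopic (with all \<open>k\<^sub>\<sigma> = 1\<close>).\<close>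

definition homotopic ::
  "('v, 'e, 'g, 'm) complex_of_groups_scheme \<Rightarrow> ('w, 'd, 'h, 'n) complex_of_groups_scheme
   \<Rightarrow> ('v, 'e, 'w, 'd, 'g, 'h) cog_morphism \<Rightarrow> ('v, 'e, 'w, 'd, 'g, 'h) cog_morphism \<Rightarrow> bool" where
  "homotopic X Y \<phi> \<eta> \<longleftrightarrow>
     cog_morphism X Y \<phi> \<and> cog_morphism X Y \<eta> \<and>
     (\<forall>\<sigma>\<in>verts X. vmap \<eta> \<sigma> = vmap \<phi> \<sigma>) \<and> (\<forall>a\<in>edges X. emap \<eta> a = emap \<phi> a) \<and>
     (\<exists>k. (\<forall>\<sigma>\<in>verts X. k \<sigma> \<in> carrier (grp Y (vmap \<phi> \<sigma>))) \<and>
          (\<forall>\<sigma>\<in>verts X. \<forall>g\<in>carrier (grp X \<sigma>).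
             gmap \<eta> \<sigma> g = conj_by (grp Y (vmap \<phi> \<sigma>)) (k \<sigma>) (gmap \<phi> \<sigma> g)) \<and>
          (\<forall>a\<in>edges X.
             telt \<eta> a = k (ter X a) \<otimes>\<^bsub>grp Y (vmap \<phi> (ter X a))\<^esub> telt \<phi> a
               \<otimes>\<^bsub>grp Y (vmap \<phi> (ter X a))\<^esub>
                 psi Y (emap \<phi> a) (inv\<^bsub>grp Y (vmap \<phi> (ini X a))\<^esub> k (ini X a))))"

definition mor_class ::
  "('v, 'e, 'g, 'm) complex_of_groups_scheme \<Rightarrow> ('w, 'd, 'h, 'n) complex_of_groups_scheme
   \<Rightarrow> ('v, 'e, 'w, 'd, 'g, 'h) cog_morphism \<Rightarrow> ('v, 'e, 'w, 'd, 'g, 'h) cog_morphism set" where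
  "mor_class X Y \<phi> = {\<eta>. homotopic X Y \<phi> \<eta>}"

text \<open>Here and below, maps on classes are given as the union of the classes obtained from all
  representatives; when the map is well defined this is the class of any one of them.\<close>

definition Deck ::
  "('v, 'e, 'g, 'm) complex_of_groups_scheme \<Rightarrow> ('w, 'd, 'h, 'n) complex_of_groups_scheme
   \<Rightarrow> ('v, 'e, 'w, 'd, 'g, 'h) cog_morphism \<Rightarrow> ('v, 'e, 'v, 'e, 'g, 'g) cog_morphism set monoid"
  where
  "Deck X Y \<phi> =
     \<lparr>carrier = {mor_class X X \<eta> | \<eta>. \<eta> \<in> Aut X \<and> homotopic X Y \<phi> (cog_compose X Y \<phi> \<eta>)},
      mult = (\<lambda>c d. \<Union>\<eta>\<^sub>1\<in>c. \<Union>\<eta>\<^sub>2\<in>d. mor_class X X (cog_compose X X \<eta>\<^sub>1 \<eta>\<^sub>2)),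
      one = mor_class X X (cog_id X)\<rparr>"

definition covering_map ::
  "('v, 'e, 'g, 'm) complex_of_groups_scheme \<Rightarrow> ('w, 'd, 'h, 'n) complex_of_groups_scheme
   \<Rightarrow> ('v, 'e, 'w, 'd, 'g, 'h) cog_morphism \<Rightarrow> 'v \<Rightarrow> 'd \<Rightarrow> 'e \<times> 'g set \<Rightarrow> 'h set" where
  "covering_map X Y \<phi> \<sigma> a' = (\<lambda>(a, S). \<Union>g\<in>S.
     (gmap \<phi> \<sigma> g \<otimes>\<^bsub>grp Y (vmap \<phi> \<sigma>)\<^esub> telt \<phi> a)
       <#\<^bsub>grp Y (vmap \<phi> \<sigma>)\<^esub> (psi Y a' ` carrier (grp Y (ini Y a'))))"

locale covering = cog_morphism X Y \<phi>
  for X :: "('v, 'e, 'g, 'm) complex_of_groups_scheme"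
    and Y :: "('w, 'd, 'h, 'n) complex_of_groups_scheme"
    and \<phi> :: "('v, 'e, 'w, 'd, 'g, 'h) cog_morphism" +
  assumes surj_verts: "vmap \<phi> ` verts X = verts Y"
    and surj_edges: "emap \<phi> ` edges X = edges Y"
    and gmap_inj: "\<sigma> \<in> verts X \<Longrightarrow> inj_on (gmap \<phi> \<sigma>) (carrier (grp X \<sigma>))"
    and covering_bij: "\<lbrakk>\<sigma> \<in> verts X; a' \<in> edges Y; ter Y a' = vmap \<phi> \<sigma>\<rbrakk> \<Longrightarrow>
      bij_betw (covering_map X Y \<phi> \<sigma> a')
        (SIGMA a : {a \<in> edges X. emap \<phi> a = a' \<and> ter X a = \<sigma>}.
           lcosets\<^bsub>grp X \<sigma>\<^esub> (psi X a ` carrier (grp X (ini X a))))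
        (lcosets\<^bsub>grp Y (vmap \<phi> \<sigma>)\<^esub> (psi Y a' ` carrier (grp Y (ini Y a'))))"


section \<open>Paths in a complex of groups and the fundamental group\<close>

text \<open>The path \<open>(g\<^sub>0, e\<^sub>1, g\<^sub>1, \<dots>, e\<^sub>k, g\<^sub>k)\<close> starting at \<open>\<sigma>\<close> is represented by
  \<open>(\<sigma>, g\<^sub>0, [(e\<^sub>1, g\<^sub>1), \<dots>, (e\<^sub>k, g\<^sub>k)])\<close>. The initial vertex is recorded because it
  cannot be read off from a path of length \<open>0\<close>.\<close>

type_synonym ('v, 'e, 'g) xpath = "'v \<times> 'g \<times> ('e oriented \<times> 'g) list"

fun is_xpath :: "('v, 'e, 'g, 'm) complex_of_groups_scheme \<Rightarrow> ('v, 'e, 'g) xpath \<Rightarrow> bool" where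
  "is_xpath X (\<sigma>, g, l) \<longleftrightarrow>
     (\<exists>\<tau>. path_from X \<sigma> (map fst l) \<tau>) \<and> g \<in> carrier (grp X \<sigma>) \<and>
     (\<forall>(e, h)\<in>set l. h \<in> carrier (grp X (oter X e)))"

fun xini :: "('v, 'e, 'g) xpath \<Rightarrow> 'v" where
  "xini (\<sigma>, g, l) = \<sigma>"

fun xter :: "('v, 'e, 'g, 'm) complex_of_groups_scheme \<Rightarrow> ('v, 'e, 'g) xpath \<Rightarrow> 'v" where
  "xter X (\<sigma>, g, l) = (if l = [] then \<sigma> else oter X (fst (last l)))"

fun xconcat ::
  "('v, 'e, 'g, 'm) complex_of_groups_scheme
   \<Rightarrow> ('v, 'e, 'g) xpath \<Rightarrow> ('v, 'e, 'g) xpath \<Rightarrow> ('v, 'e, 'g) xpath" where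
  "xconcat X (\<sigma>, g, []) (\<tau>, h, m) = (\<sigma>, g \<otimes>\<^bsub>grp X \<sigma>\<^esub> h, m)"
| "xconcat X (\<sigma>, g, (e, g') # l) q =
     (case xconcat X (oter X e, g', l) q of (_, k, n) \<Rightarrow> (\<sigma>, g, (e, k) # n))"

definition xpaths_from ::
  "('v, 'e, 'g, 'm) complex_of_groups_scheme \<Rightarrow> 'v \<Rightarrow> ('v, 'e, 'g) xpath set" where
  "xpaths_from X \<sigma> = {p. is_xpath X p \<and> xini p = \<sigma>}"

text \<open>The group element path \<open>(g)\<close> at \<open>\<sigma>\<close> and the edge path \<open>(1, a, 1)\<close>.\<close>

definition gpath :: "'v \<Rightarrow> 'g \<Rightarrow> ('v, 'e, 'g) xpath" where
  "gpath \<sigma> g = (\<sigma>, g, [])"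

definition epath :: "('v, 'e, 'g, 'm) complex_of_groups_scheme \<Rightarrow> 'e \<Rightarrow> ('v, 'e, 'g) xpath" where
  "epath X a = (ini X a, \<one>\<^bsub>grp X (ini X a)\<^esub>, [(Fwd a, \<one>\<^bsub>grp X (ter X a)\<^esub>)])"

inductive elem_move ::
  "('v, 'e, 'g, 'm) complex_of_groups_scheme
   \<Rightarrow> ('v, 'e, 'g) xpath \<Rightarrow> ('v, 'e, 'g) xpath \<Rightarrow> bool"
  for X :: "('v, 'e, 'g, 'm) complex_of_groups_scheme" where
  slide_fwd:
    "\<lbrakk>a \<in> edges X; k \<in> carrier (grp X (ini X a)); g \<in> carrier (grp X (ini X a));
      h \<in> carrier (grp X (ter X a))\<rbrakk> \<Longrightarrow>
     elem_move X (ini X a, k \<otimes>\<^bsub>grp X (ini X a)\<^esub> g, [(Fwd a, h)])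
                 (ini X a, k, [(Fwd a, psi X a g \<otimes>\<^bsub>grp X (ter X a)\<^esub> h)])"
| slide_bwd:
    "\<lbrakk>a \<in> edges X; g \<in> carrier (grp X (ter X a)); h \<in> carrier (grp X (ini X a));
      k \<in> carrier (grp X (ini X a))\<rbrakk> \<Longrightarrow>
     elem_move X (ter X a, g, [(Bwd a, h \<otimes>\<^bsub>grp X (ini X a)\<^esub> k)])
                 (ter X a, g \<otimes>\<^bsub>grp X (ter X a)\<^esub> psi X a h, [(Bwd a, k)])"
| cancel_fwd:
    "\<lbrakk>a \<in> edges X; g \<in> carrier (grp X (ini X a)); h \<in> carrier (grp X (ini X a));
      k \<in> carrier (grp X (ini X a))\<rbrakk> \<Longrightarrow>
     elem_move X (ini X a, g, [(Fwd a, psi X a h), (Bwd a, k)])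
                 (ini X a, g \<otimes>\<^bsub>grp X (ini X a)\<^esub> h \<otimes>\<^bsub>grp X (ini X a)\<^esub> k, [])"
| cancel_bwd:
    "\<lbrakk>b \<in> edges X; g \<in> carrier (grp X (ter X b)); h \<in> carrier (grp X (ini X b));
      k \<in> carrier (grp X (ter X b))\<rbrakk> \<Longrightarrow>
     elem_move X (ter X b, g, [(Bwd b, h), (Fwd b, k)])
                 (ter X b, g \<otimes>\<^bsub>grp X (ter X b)\<^esub> psi X b h \<otimes>\<^bsub>grp X (ter X b)\<^esub> k, [])"
| compose_fwd:
    "\<lbrakk>(a, b) \<in> E2 X; g \<in> carrier (grp X (ini X b)); k \<in> carrier (grp X (ter X a))\<rbrakk> \<Longrightarrow>
     elem_move X (ini X b, g, [(Fwd b, \<one>\<^bsub>grp X (ter X b)\<^esub>), (Fwd a, k)])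
                 (ini X b, g, [(Fwd (cmp X a b),
                    inv\<^bsub>grp X (ter X a)\<^esub> (tw X a b) \<otimes>\<^bsub>grp X (ter X a)\<^esub> k)])"
| compose_bwd:
    "\<lbrakk>(a, b) \<in> E2 X; g \<in> carrier (grp X (ter X a)); k \<in> carrier (grp X (ini X b))\<rbrakk> \<Longrightarrow>
     elem_move X (ter X a, g, [(Bwd a, \<one>\<^bsub>grp X (ini X a)\<^esub>), (Bwd b, k)])
                 (ter X a, g \<otimes>\<^bsub>grp X (ter X a)\<^esub> tw X a b, [(Bwd (cmp X a b), k)])"

inductive subpath_move ::
  "('v, 'e, 'g, 'm) complex_of_groups_scheme
   \<Rightarrow> ('v, 'e, 'g) xpath \<Rightarrow> ('v, 'e, 'g) xpath \<Rightarrow> bool"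
  for X :: "('v, 'e, 'g, 'm) complex_of_groups_scheme" where
  "\<lbrakk>elem_move X s s'; is_xpath X r; is_xpath X r'; xter X r = xini s; xter X s = xini r'\<rbrakk> \<Longrightarrow>
   subpath_move X (xconcat X (xconcat X r s) r') (xconcat X (xconcat X r s') r')"

definition path_homotopic ::
  "('v, 'e, 'g, 'm) complex_of_groups_scheme
   \<Rightarrow> ('v, 'e, 'g) xpath \<Rightarrow> ('v, 'e, 'g) xpath \<Rightarrow> bool" where
  "path_homotopic X = equivclp (subpath_move X)"

definition path_class ::
  "('v, 'e, 'g, 'm) complex_of_groups_scheme
   \<Rightarrow> ('v, 'e, 'g) xpath \<Rightarrow> ('v, 'e, 'g) xpath set" where
  "path_class X p = {q. path_homotopic X p q}"

definition pi1 ::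
  "('v, 'e, 'g, 'm) complex_of_groups_scheme \<Rightarrow> 'v \<Rightarrow> ('v, 'e, 'g) xpath set monoid" where
  "pi1 X \<sigma>\<^sub>0 =
     \<lparr>carrier = {path_class X p | p. p \<in> xpaths_from X \<sigma>\<^sub>0 \<and> xter X p = \<sigma>\<^sub>0},
      mult = (\<lambda>c d. \<Union>p\<in>c. \<Union>q\<in>d. path_class X (xconcat X p q)),
      one = path_class X (gpath \<sigma>\<^sub>0 \<one>\<^bsub>grp X \<sigma>\<^sub>0\<^esub>)\<rparr>"

definition developable :: "('v, 'e, 'g, 'm) complex_of_groups_scheme \<Rightarrow> bool" where
  "developable X \<longleftrightarrow>
     (\<forall>\<sigma>\<in>verts X. inj_on (\<lambda>g. path_class X (gpath \<sigma> g)) (carrier (grp X \<sigma>)))"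

fun oedge_image ::
  "('v, 'e, 'g, 'm) complex_of_groups_scheme \<Rightarrow> ('w, 'd, 'h, 'n) complex_of_groups_scheme
   \<Rightarrow> ('v, 'e, 'w, 'd, 'g, 'h) cog_morphism \<Rightarrow> 'e oriented \<Rightarrow> ('w, 'd, 'h) xpath" where
  "oedge_image X Y \<phi> (Fwd a) =
     (vmap \<phi> (ini X a), \<one>\<^bsub>grp Y (vmap \<phi> (ini X a))\<^esub>,
      [(Fwd (emap \<phi> a), inv\<^bsub>grp Y (vmap \<phi> (ter X a))\<^esub> (telt \<phi> a))])"
| "oedge_image X Y \<phi> (Bwd a) =
     (vmap \<phi> (ter X a), telt \<phi> a, [(Bwd (emap \<phi> a), \<one>\<^bsub>grp Y (vmap \<phi> (ini X a))\<^esub>)])"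

fun path_image ::
  "('v, 'e, 'g, 'm) complex_of_groups_scheme \<Rightarrow> ('w, 'd, 'h, 'n) complex_of_groups_scheme
   \<Rightarrow> ('v, 'e, 'w, 'd, 'g, 'h) cog_morphism \<Rightarrow> ('v, 'e, 'g) xpath \<Rightarrow> ('w, 'd, 'h) xpath" where
  "path_image X Y \<phi> (\<sigma>, g, []) = gpath (vmap \<phi> \<sigma>) (gmap \<phi> \<sigma> g)"
| "path_image X Y \<phi> (\<sigma>, g, (e, h) # l) =
     xconcat Y (gpath (vmap \<phi> \<sigma>) (gmap \<phi> \<sigma> g))
       (xconcat Y (oedge_image X Y \<phi> e) (path_image X Y \<phi> (oter X e, h, l)))"

definition induced_hom ::
  "('v, 'e, 'g, 'm) complex_of_groups_scheme \<Rightarrow> ('w, 'd, 'h, 'n) complex_of_groups_scheme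
   \<Rightarrow> ('v, 'e, 'w, 'd, 'g, 'h) cog_morphism
   \<Rightarrow> ('v, 'e, 'g) xpath set \<Rightarrow> ('w, 'd, 'h) xpath set" where
  "induced_hom X Y \<phi> c = (\<Union>p\<in>c. path_class Y (path_image X Y \<phi> p))"


section \<open>The universal complex\<close>

definition univ_equiv ::
  "('v, 'e, 'g, 'm) complex_of_groups_scheme
   \<Rightarrow> ('v, 'e, 'g) xpath \<Rightarrow> ('v, 'e, 'g) xpath \<Rightarrow> bool" where
  "univ_equiv X p q \<longleftrightarrow>
     (\<exists>g\<in>carrier (grp X (xter X p)).
        path_class X q = path_class X (xconcat X p (gpath (xter X p) g)))"

definition univ_class ::
  "('v, 'e, 'g, 'm) complex_of_groups_scheme \<Rightarrow> 'v
   \<Rightarrow> ('v, 'e, 'g) xpath \<Rightarrow> ('v, 'e, 'g) xpath set" where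
  "univ_class X \<sigma>\<^sub>0 p = {q \<in> xpaths_from X \<sigma>\<^sub>0. univ_equiv X p q}"

definition universal_complex ::
  "('v, 'e, 'g, 'm) complex_of_groups_scheme \<Rightarrow> 'v
   \<Rightarrow> (('v, 'e, 'g) xpath set,
       ('v, 'e, 'g) xpath set \<times> 'e \<times> ('v, 'e, 'g) xpath set) scwol" where
  "universal_complex X \<sigma>\<^sub>0 =
     \<lparr>verts = univ_class X \<sigma>\<^sub>0 ` xpaths_from X \<sigma>\<^sub>0,
      edges = {(univ_class X \<sigma>\<^sub>0 p, a, univ_class X \<sigma>\<^sub>0 (xconcat X p (epath X a))) | p a.
                 p \<in> xpaths_from X \<sigma>\<^sub>0 \<and> a \<in> edges X \<and> ini X a = xter X p},
      ini = (\<lambda>(P, a, Q). P),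
      ter = (\<lambda>(P, a, Q). Q),
      cmp = (\<lambda>(Q, a, R) (P, b, Q').
               (P, cmp X a b, \<Union>p\<in>P. univ_class X \<sigma>\<^sub>0 (xconcat X p (epath X (cmp X a b)))))\<rparr>"

definition univ_act_vert ::
  "('v, 'e, 'g, 'm) complex_of_groups_scheme \<Rightarrow> 'v \<Rightarrow> ('v, 'e, 'g) xpath set
   \<Rightarrow> ('v, 'e, 'g) xpath set \<Rightarrow> ('v, 'e, 'g) xpath set" where
  "univ_act_vert X \<sigma>\<^sub>0 c P = (\<Union>q\<in>c. \<Union>p\<in>P. univ_class X \<sigma>\<^sub>0 (xconcat X q p))"

definition univ_act_edge ::
  "('v, 'e, 'g, 'm) complex_of_groups_scheme \<Rightarrow> 'v \<Rightarrow> ('v, 'e, 'g) xpath set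
   \<Rightarrow> ('v, 'e, 'g) xpath set \<times> 'e \<times> ('v, 'e, 'g) xpath set
   \<Rightarrow> ('v, 'e, 'g) xpath set \<times> 'e \<times> ('v, 'e, 'g) xpath set" where
  "univ_act_edge X \<sigma>\<^sub>0 c = (\<lambda>(P, a, Q). (univ_act_vert X \<sigma>\<^sub>0 c P, a, univ_act_vert X \<sigma>\<^sub>0 c Q))"

definition action_kernel ::
  "('v, 'e, 'g, 'm) complex_of_groups_scheme \<Rightarrow> 'v \<Rightarrow> ('v, 'e, 'g) xpath set set" where
  "action_kernel X \<sigma>\<^sub>0 = {c \<in> carrier (pi1 X \<sigma>\<^sub>0).
     (\<forall>v\<in>verts (universal_complex X \<sigma>\<^sub>0). univ_act_vert X \<sigma>\<^sub>0 c v = v) \<and>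
     (\<forall>e\<in>edges (universal_complex X \<sigma>\<^sub>0). univ_act_edge X \<sigma>\<^sub>0 c e = e)}"


section \<open>Centralizers\<close>

definition centralizer :: "('a, 'm) monoid_scheme \<Rightarrow> 'a set \<Rightarrow> 'a set" where
  "centralizer G U = {g \<in> carrier G. \<forall>u\<in>U. g \<otimes>\<^bsub>G\<^esub> u = u \<otimes>\<^bsub>G\<^esub> g}"

end

theory Submission
  imports Defs
begin

text \<open>A morphism \<open>\<phi>\<close> of complexes of groups induces a functor \<open>\<phi>\<^sub>*\<close> of fundamental groupoids. For a
  covering, every arrow of the target starting over \<open>\<sigma>\<close> is \<open>\<phi>\<^sub>*(x) g\<close> with \<open>x\<close> starting at \<open>\<sigma>\<close> and
  \<open>g\<close> in a local group, and \<open>\<phi>\<^sub>*(x)\<close> lies in a local group only if \<open>x\<close> does. Over developable targets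
  morphisms and homotopies can be recovered from their functors: homotopies are natural transformations with
  components in the local groups. If \<open>k\<close> is such a transformation from \<open>\<phi>\<close> to \<open>\<phi> \<circ> \<eta>\<close> and \<open>p\<close> is an
  arrow from the base vertex to its image under \<open>\<eta>\<close>, then \<open>n = \<phi>\<^sub>*(p) k\<close> normalizes \<open>U\<close>. Changing \<open>p\<close>
  multiplies \<open>n\<close> by an element of \<open>U\<close>, and changing \<open>k\<close> by a natural automorphism of \<open>\<phi>\<close>, that is, by
  an element of \<open>C\<close>. Conversely \<open>n\<close> determines \<open>\<eta>\<close> up to homotopy, and every \<open>n\<close> in the normalizer
  arises by lifting the arrows \<open>n \<phi>\<^sub>*(r)\<close>.\<close>

section \<open>Paths and the fundamental groupoid\<close>

text \<open>An automorphism of \<open>X\<close> may move the base vertex, and a homotopy has one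
  component per vertex; the groupoid handles both without transporting everything to one base point.
  Products follow the direction of paths: the left factor is travelled first. The crux is that the
  induced functor reflects local arrows. This cannot be proved by transferring a homotopy from
  \<open>Y\<close> back to \<open>X\<close> step by step, because the intermediate paths need not be
  images of paths. Instead the paths of \<open>Y\<close> act on lifts: homotopic paths act equally,
  and the image of \<open>x\<close> moves the trivial lift to \<open>x\<close>. Edges leaving a
  vertex lift by the definition of a scwol morphism; going back along an edge is where the coset
  bijections are used. Developability turns equal classes of local elements into equal elements. The
  two inclusions contained in the normalizer condition have separate tasks: conjugation by
  \<open>n\<close> yields the functor on \<open>X\<close>, and conjugation by its inverse helps to
  show that this functor is invertible. In \<open>C\<close>, the kernel of the action makes the
  components of a natural automorphism local, and the centralizer makes them independent of the path
  from the base vertex.\<close>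

definition xcons ::
  "('v, 'e, 'g, 'm) complex_of_groups_scheme \<Rightarrow> 'g \<Rightarrow> 'e oriented \<Rightarrow> ('v, 'e, 'g) xpath
   \<Rightarrow> ('v, 'e, 'g) xpath" where
  "xcons X g e = (\<lambda>(\<tau>, h, l). (oini X e, g, (e, h) # l))"

lemma xini_gpath [simp]: "xini (gpath \<sigma> g) = \<sigma>"
  by (simp add: gpath_def)

lemma xter_gpath [simp]: "xter X (gpath \<sigma> g) = \<sigma>"
  by (simp add: gpath_def)

lemma xini_xcons [simp]: "xini (xcons X g e p) = oini X e"
  by (cases p) (simp add: xcons_def)

lemma xter_xcons [simp]: "xini p = oter X e \<Longrightarrow> xter X (xcons X g e p) = xter X p"
  by (cases p) (auto simp: xcons_def)

lemma xconcat_xcons [simp]: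
  "xini p = oter X e \<Longrightarrow> xconcat X (xcons X g e p) q = xcons X g e (xconcat X p q)"
  by (cases p) (auto simp: xcons_def split: prod.splits)

lemma xini_xconcat [simp]: "xini (xconcat X p q) = xini p"
  by (induct X p q rule: xconcat.induct) (auto split: prod.splits)

lemma is_xpath_gpath [simp]:
  "is_xpath X (gpath \<sigma> g) \<longleftrightarrow> \<sigma> \<in> verts X \<and> g \<in> carrier (grp X \<sigma>)"
  by (auto simp: gpath_def)

lemma is_xpath_xcons [simp]:
  "xini p = oter X e \<Longrightarrow> is_xpath X (xcons X g e p) \<longleftrightarrow>
    e \<in> oedges X \<and> g \<in> carrier (grp X (oini X e)) \<and> is_xpath X p"
  by (cases p) (auto simp: xcons_def)

lemma ex_path_from [simp]:
  "Ex (path_from X \<sigma> []) \<longleftrightarrow> \<sigma> \<in> verts X"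
  "Ex (path_from X \<sigma> (e # es)) \<longleftrightarrow> e \<in> oedges X \<and> oini X e = \<sigma> \<and> Ex (path_from X (oter X e) es)"
  by auto

lemma Fwd_in_oedges [simp]: "Fwd a \<in> oedges X \<longleftrightarrow> a \<in> edges X"
  and Bwd_in_oedges [simp]: "Bwd a \<in> oedges X \<longleftrightarrow> a \<in> edges X"
  by (auto simp: oedges_def)

declare is_xpath.simps [simp del] xini.simps [simp del] xter.simps [simp del]

section \<open>Local groups and concatenation of paths\<close>

context complex_of_groups
begin

declare ini_closed [simp] ter_closed [simp]

lemma oini_closed [simp]: "e \<in> oedges X \<Longrightarrow> oini X e \<in> verts X"
  and oter_closed [simp]: "e \<in> oedges X \<Longrightarrow> oter X e \<in> verts X"
  by (auto simp: oedges_def)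

lemma grp_mult_closed [simp]:
  "\<lbrakk>\<sigma> \<in> verts X; g \<in> carrier (grp X \<sigma>); h \<in> carrier (grp X \<sigma>)\<rbrakk> \<Longrightarrow>
    g \<otimes>\<^bsub>grp X \<sigma>\<^esub> h \<in> carrier (grp X \<sigma>)"
  by (simp add: grp_group group.is_monoid monoid.m_closed)

lemma grp_inv_closed [simp]:
  "\<lbrakk>\<sigma> \<in> verts X; g \<in> carrier (grp X \<sigma>)\<rbrakk> \<Longrightarrow> inv\<^bsub>grp X \<sigma>\<^esub> g \<in> carrier (grp X \<sigma>)"
  by (simp add: grp_group group.inv_closed)

lemma grp_one_closed [simp]: "\<sigma> \<in> verts X \<Longrightarrow> \<one>\<^bsub>grp X \<sigma>\<^esub> \<in> carrier (grp X \<sigma>)"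
  by (simp add: grp_group group.is_monoid monoid.one_closed)

lemma grp_one_mult [simp]:
  "\<lbrakk>\<sigma> \<in> verts X; g \<in> carrier (grp X \<sigma>)\<rbrakk> \<Longrightarrow> \<one>\<^bsub>grp X \<sigma>\<^esub> \<otimes>\<^bsub>grp X \<sigma>\<^esub> g = g"
  by (simp add: grp_group group.is_monoid monoid.l_one)

lemma grp_mult_one [simp]:
  "\<lbrakk>\<sigma> \<in> verts X; g \<in> carrier (grp X \<sigma>)\<rbrakk> \<Longrightarrow> g \<otimes>\<^bsub>grp X \<sigma>\<^esub> \<one>\<^bsub>grp X \<sigma>\<^esub> = g"
  by (simp add: grp_group group.is_monoid monoid.r_one)

lemma grp_inv_mult [simp]:
  "\<lbrakk>\<sigma> \<in> verts X; g \<in> carrier (grp X \<sigma>)\<rbrakk> \<Longrightarrow> inv\<^bsub>grp X \<sigma>\<^esub> g \<otimes>\<^bsub>grp X \<sigma>\<^esub> g = \<one>\<^bsub>grp X \<sigma>\<^esub>"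
  by (simp add: grp_group group.l_inv)

lemma grp_mult_inv [simp]:
  "\<lbrakk>\<sigma> \<in> verts X; g \<in> carrier (grp X \<sigma>)\<rbrakk> \<Longrightarrow> g \<otimes>\<^bsub>grp X \<sigma>\<^esub> inv\<^bsub>grp X \<sigma>\<^esub> g = \<one>\<^bsub>grp X \<sigma>\<^esub>"
  by (simp add: grp_group group.r_inv)

lemma grp_inv_inv [simp]:
  "\<lbrakk>\<sigma> \<in> verts X; g \<in> carrier (grp X \<sigma>)\<rbrakk> \<Longrightarrow> inv\<^bsub>grp X \<sigma>\<^esub> (inv\<^bsub>grp X \<sigma>\<^esub> g) = g"
  by (simp add: grp_group group.inv_inv)

lemma grp_inv_one [simp]:
  "\<sigma> \<in> verts X \<Longrightarrow> inv\<^bsub>grp X \<sigma>\<^esub> \<one>\<^bsub>grp X \<sigma>\<^esub> = \<one>\<^bsub>grp X \<sigma>\<^esub>"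
  by (simp add: grp_group group.is_monoid monoid.inv_one)

lemma grp_assoc:
  "\<lbrakk>\<sigma> \<in> verts X; g \<in> carrier (grp X \<sigma>); h \<in> carrier (grp X \<sigma>); k \<in> carrier (grp X \<sigma>)\<rbrakk> \<Longrightarrow>
    g \<otimes>\<^bsub>grp X \<sigma>\<^esub> h \<otimes>\<^bsub>grp X \<sigma>\<^esub> k = g \<otimes>\<^bsub>grp X \<sigma>\<^esub> (h \<otimes>\<^bsub>grp X \<sigma>\<^esub> k)"
  by (simp add: grp_group group.is_monoid monoid.m_assoc)

lemma psi_closed [simp]:
  "\<lbrakk>a \<in> edges X; g \<in> carrier (grp X (ini X a))\<rbrakk> \<Longrightarrow> psi X a g \<in> carrier (grp X (ter X a))"
  using psi_mon by (auto simp: mon_def hom_def)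

lemma psi_mult:
  "\<lbrakk>a \<in> edges X; g \<in> carrier (grp X (ini X a)); h \<in> carrier (grp X (ini X a))\<rbrakk> \<Longrightarrow>
    psi X a (g \<otimes>\<^bsub>grp X (ini X a)\<^esub> h) = psi X a g \<otimes>\<^bsub>grp X (ter X a)\<^esub> psi X a h"
  using psi_mon by (auto simp: mon_def hom_def)

lemma psi_group_hom: "a \<in> edges X \<Longrightarrow> group_hom (grp X (ini X a)) (grp X (ter X a)) (psi X a)"
  using psi_mon by (auto simp: mon_def group_hom_def group_hom_axioms_def grp_group)

lemma psi_one [simp]:
  "a \<in> edges X \<Longrightarrow> psi X a \<one>\<^bsub>grp X (ini X a)\<^esub> = \<one>\<^bsub>grp X (ter X a)\<^esub>"
  using group_hom.hom_one[OF psi_group_hom] .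

lemma psi_inv:
  "\<lbrakk>a \<in> edges X; g \<in> carrier (grp X (ini X a))\<rbrakk> \<Longrightarrow>
    psi X a (inv\<^bsub>grp X (ini X a)\<^esub> g) = inv\<^bsub>grp X (ter X a)\<^esub> psi X a g"
  using group_hom.hom_inv[OF psi_group_hom] by simp

lemma psi_inj: "a \<in> edges X \<Longrightarrow> inj_on (psi X a) (carrier (grp X (ini X a)))"
  using psi_mon by (auto simp: mon_def)

lemma E2D:
  assumes "(a, b) \<in> E2 X"
  shows "a \<in> edges X" "b \<in> edges X" "ini X a = ter X b" "cmp X a b \<in> edges X"
    "ini X (cmp X a b) = ini X b" "ter X (cmp X a b) = ter X a"
  using assms cmp_closed ini_cmp ter_cmp by (auto simp: E2_def)

text \<open>A nested triple is awkward to recurse on, since concatenation rewrites its second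
  component and its list at once. The rule presents a path as a group element to which pairs of an
  element and an oriented edge are prepended, with the typing facts included, so that the simp rules
  for \<open>gpath\<close> and \<open>xcons\<close> carry the inductions below.\<close>

lemma is_xpath_induct [consumes 1, case_names gpath xcons]:
  assumes "is_xpath X p"
    and gp: "\<And>\<sigma> g. \<sigma> \<in> verts X \<Longrightarrow> g \<in> carrier (grp X \<sigma>) \<Longrightarrow> P (gpath \<sigma> g)"
    and xc: "\<And>g e q. e \<in> oedges X \<Longrightarrow> g \<in> carrier (grp X (oini X e)) \<Longrightarrow> is_xpath X q \<Longrightarrow>
          xini q = oter X e \<Longrightarrow> P q \<Longrightarrow> P (xcons X g e q)"
  shows "P p"
proof -
  have "\<And>\<sigma> g. is_xpath X (\<sigma>, g, l) \<Longrightarrow> P (\<sigma>, g, l)" for l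
  proof (induct l)
    case Nil
    then show ?case using gp[of \<sigma> g] by (auto simp: gpath_def is_xpath.simps)
  next
    case (Cons eh l)
    obtain e h where eh: "eh = (e, h)" by (cases eh)
    have "is_xpath X (oter X e, h, l)" using Cons.prems by (auto simp: eh is_xpath.simps)
    then have "P (xcons X g e (oter X e, h, l))"
      using Cons.prems by (intro xc Cons.hyps) (auto simp: eh is_xpath.simps xini.simps)
    moreover have "oini X e = \<sigma>" using Cons.prems by (auto simp: eh is_xpath.simps)
    ultimately show ?case by (simp add: xcons_def eh)
  qed
  then show ?thesis using assms(1) by (cases p) auto
qed

lemma xini_closed [simp]: "is_xpath X p \<Longrightarrow> xini p \<in> verts X"
  by (induct rule: is_xpath_induct) auto

lemma xter_closed [simp]: "is_xpath X p \<Longrightarrow> xter X p \<in> verts X"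
  by (induct rule: is_xpath_induct) auto

lemma xconcat_gpath_gpath [simp]:
  "xconcat X (gpath \<sigma> g) (gpath \<tau> h) = gpath \<sigma> (g \<otimes>\<^bsub>grp X \<sigma>\<^esub> h)"
  by (simp add: gpath_def)

lemma xconcat_gpath_xcons [simp]:
  "\<sigma> = oini X e \<Longrightarrow> xconcat X (gpath \<sigma> g) (xcons X h e p) = xcons X (g \<otimes>\<^bsub>grp X \<sigma>\<^esub> h) e p"
  by (cases p) (simp add: gpath_def xcons_def)

lemma is_xpath_cases:
  assumes "is_xpath X p"
  obtains \<sigma> g where "p = gpath \<sigma> g" "\<sigma> \<in> verts X" "g \<in> carrier (grp X \<sigma>)"
  | g e q where "p = xcons X g e q" "e \<in> oedges X" "g \<in> carrier (grp X (oini X e))"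
      "is_xpath X q" "xini q = oter X e"
  using assms by (induct rule: is_xpath_induct) blast+

lemma is_xpath_xconcat_gpath [simp]:
  assumes "is_xpath X q" "xini q = \<sigma>" "g \<in> carrier (grp X \<sigma>)"
  shows "is_xpath X (xconcat X (gpath \<sigma> g) q)" "xter X (xconcat X (gpath \<sigma> g) q) = xter X q"
  using assms(1) by (cases rule: is_xpath_cases; use assms in auto)+

lemma xconcat_valid [simp]:
  assumes "is_xpath X p" "is_xpath X q" "xter X p = xini q"
  shows is_xpath_xconcat: "is_xpath X (xconcat X p q)"
    and xter_xconcat: "xter X (xconcat X p q) = xter X q"
  using assms by (induct rule: is_xpath_induct) auto

lemma xconcat_gpath_assoc:
  assumes "is_xpath X q" "xini q = \<sigma>" "g \<in> carrier (grp X \<sigma>)" "h \<in> carrier (grp X \<sigma>)"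
  shows "xconcat X (gpath \<sigma> (g \<otimes>\<^bsub>grp X \<sigma>\<^esub> h)) q
    = xconcat X (gpath \<sigma> g) (xconcat X (gpath \<sigma> h) q)"
  using assms(1) by (cases rule: is_xpath_cases) (use assms in \<open>auto simp: grp_assoc\<close>)

lemma xconcat_assoc:
  assumes "is_xpath X p" "is_xpath X q" "is_xpath X r" "xter X p = xini q" "xter X q = xini r"
  shows "xconcat X (xconcat X p q) r = xconcat X p (xconcat X q r)"
  using assms(1,4)
proof (induct rule: is_xpath_induct)
  case (gpath \<sigma> g)
  show ?case using assms(2)
    by (cases rule: is_xpath_cases) (use assms(3,5) gpath in \<open>auto simp: grp_assoc xconcat_gpath_assoc\<close>)
qed (use assms in auto)

lemma xconcat_one_left [simp]:
  assumes "is_xpath X p" "xini p = \<sigma>"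
  shows "xconcat X (gpath \<sigma> \<one>\<^bsub>grp X \<sigma>\<^esub>) p = p"
  using assms(1) by (cases rule: is_xpath_cases) (use assms in auto)

lemma xconcat_one_right [simp]:
  assumes "is_xpath X p" "xter X p = \<sigma>"
  shows "xconcat X p (gpath \<sigma> \<one>\<^bsub>grp X \<sigma>\<^esub>) = p"
  using assms by (induct rule: is_xpath_induct) auto

abbreviation fstep :: "'g \<Rightarrow> 'e \<Rightarrow> 'g \<Rightarrow> ('v, 'e, 'g) xpath" where
  "fstep g a h \<equiv> xcons X g (Fwd a) (gpath (ter X a) h)"

abbreviation bstep :: "'g \<Rightarrow> 'e \<Rightarrow> 'g \<Rightarrow> ('v, 'e, 'g) xpath" where
  "bstep g a h \<equiv> xcons X g (Bwd a) (gpath (ini X a) h)"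

section \<open>Homotopy of paths as a congruence for concatenation\<close>

lemma elem_move_valid:
  assumes "elem_move X s s'"
  shows "is_xpath X s" "is_xpath X s'" "xini s' = xini s" "xter X s' = xter X s"
proof -
  have "is_xpath X s \<and> is_xpath X s' \<and> xini s' = xini s \<and> xter X s' = xter X s"
    using assms
  proof induct
    case (compose_fwd a b g k)
    then show ?case using E2D[OF compose_fwd(1)] tw_closed[OF compose_fwd(1)]
      by (simp add: is_xpath.simps xini.simps xter.simps)
  next
    case (compose_bwd a b g k)
    then show ?case using E2D[OF compose_bwd(1)] tw_closed[OF compose_bwd(1)]
      by (simp add: is_xpath.simps xini.simps xter.simps)
  qed (simp_all add: is_xpath.simps xini.simps xter.simps)
  then show "is_xpath X s" "is_xpath X s'" "xini s' = xini s" "xter X s' = xter X s" by auto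
qed

lemma subpath_move_valid:
  assumes "subpath_move X p q"
  shows "is_xpath X p" "is_xpath X q" "xini q = xini p" "xter X q = xter X p"
  using assms by (induct; simp add: elem_move_valid)+

text \<open>A move comes with a context on both sides; by associativity the new outer factors are
  absorbed into that context.\<close>

lemma subpath_move_xconcat:
  assumes "subpath_move X p p'" "is_xpath X q" "is_xpath X r" "xter X q = xini p" "xter X p = xini r"
  shows "subpath_move X (xconcat X q (xconcat X p r)) (xconcat X q (xconcat X p' r))"
  using assms
proof induct
  case (1 s s' t t')
  have *: "xconcat X q (xconcat X (xconcat X (xconcat X t s) t') r)
      = xconcat X (xconcat X (xconcat X q t) s) (xconcat X t' r)"
    if "is_xpath X s" "xini s = xter X t" "xter X s = xini t'" for s
    using 1 that by (simp add: xconcat_assoc elem_move_valid)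
  show ?case
    using 1 subpath_move.intros[of X s s' "xconcat X q t" "xconcat X t' r"]
    by (simp add: * elem_move_valid)
qed

lemma path_homotopic_refl [simp]: "path_homotopic X p p"
  by (simp add: path_homotopic_def)

lemma path_homotopic_sym: "path_homotopic X p q \<Longrightarrow> path_homotopic X q p"
  by (simp add: path_homotopic_def equivclp_sym)

lemma path_homotopic_trans [trans]:
  "path_homotopic X p q \<Longrightarrow> path_homotopic X q r \<Longrightarrow> path_homotopic X p r"
  unfolding path_homotopic_def by (rule equivclp_trans)

lemma path_homotopic_induct [consumes 1, case_names refl step]:
  assumes "path_homotopic X p q" "\<And>p. P p p"
    "\<And>p q r. path_homotopic X p q \<Longrightarrow> P p q \<Longrightarrow> subpath_move X q r \<or> subpath_move X r q \<Longrightarrow> P p r"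
  shows "P p q"
  using assms(1) unfolding path_homotopic_def
  by (induct rule: equivclp_induct) (auto intro: assms(2,3) simp: path_homotopic_def)

lemma path_homotopic_step: "subpath_move X p q \<Longrightarrow> path_homotopic X p q"
  by (auto simp: path_homotopic_def)

text \<open>The equivalence closure ranges over all triples, including ill-formed ones. Single moves
  only relate genuine paths with common ends, so validity and ends are constant along a chain of
  moves, whichever way each link is read.\<close>

lemma path_homotopic_valid:
  assumes "path_homotopic X p q"
  shows "is_xpath X q \<longleftrightarrow> is_xpath X p" "is_xpath X p \<Longrightarrow> xini q = xini p"
    "is_xpath X p \<Longrightarrow> xter X q = xter X p"
proof -
  have "is_xpath X q = is_xpath X p \<and> xini q = xini p \<and> xter X q = xter X p"
    using assms
  proof (induct rule: path_homotopic_induct)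
    case (step p q r)
    have "is_xpath X r = is_xpath X q \<and> xini r = xini q \<and> xter X r = xter X q"
      using step(3)
    proof
      assume "subpath_move X q r"
      from subpath_move_valid[OF this] show ?thesis by simp
    next
      assume "subpath_move X r q"
      from subpath_move_valid[OF this] show ?thesis by simp
    qed
    then show ?case using step(2) by metis
  qed auto
  then show "is_xpath X q \<longleftrightarrow> is_xpath X p" "is_xpath X p \<Longrightarrow> xini q = xini p"
    "is_xpath X p \<Longrightarrow> xter X q = xter X p"
    by auto
qed

lemma path_homotopic_xconcat3:
  assumes "path_homotopic X p p'" "is_xpath X p" "is_xpath X q" "is_xpath X r"
    "xter X q = xini p" "xter X p = xini r"
  shows "path_homotopic X (xconcat X q (xconcat X p r)) (xconcat X q (xconcat X p' r))"
  using assms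
proof (induct rule: path_homotopic_induct)
  case (step p q' r')
  note v = path_homotopic_valid[OF step(1)]
  have val: "is_xpath X q'" "xini q' = xini p" "xter X q' = xter X p"
    using v step.prems(1) by auto
  have "path_homotopic X (xconcat X q (xconcat X q' r)) (xconcat X q (xconcat X r' r))"
    using step.hyps(3)
  proof
    assume *: "subpath_move X q' r'"
    show ?thesis
      by (rule path_homotopic_step[OF subpath_move_xconcat[OF *]]) (simp_all add: step.prems val)
  next
    assume *: "subpath_move X r' q'"
    have r': "is_xpath X r'" "xini r' = xini p" "xter X r' = xter X p"
      using subpath_move_valid(1)[OF *] subpath_move_valid(3,4)[OF *, symmetric] val
      by (blast intro: trans)+
    show ?thesis
      by (rule path_homotopic_sym[OF path_homotopic_step[OF subpath_move_xconcat[OF *]]])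
        (simp_all add: step.prems r')
  qed
  with step.hyps(2)[OF step.prems] show ?case by (rule path_homotopic_trans)
qed auto

lemma path_homotopic_xconcat:
  assumes "path_homotopic X p p'" "path_homotopic X q q'" "is_xpath X p" "is_xpath X q"
    "xter X p = xini q"
  shows "path_homotopic X (xconcat X p q) (xconcat X p' q')"
proof -
  have p': "is_xpath X p'" "xini p' = xini p" "xter X p' = xini q"
    using path_homotopic_valid[OF assms(1)] assms(3,5) by auto
  have q': "is_xpath X q'" "xini q' = xini q" "xter X q' = xter X q"
    using path_homotopic_valid[OF assms(2)] assms(4) by auto
  have "path_homotopic X (xconcat X p q) (xconcat X p' q)"
    using path_homotopic_xconcat3[OF assms(1) assms(3), of "gpath (xini p) \<one>\<^bsub>grp X (xini p)\<^esub>" q]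
    by (simp add: assms(3-5) p')
  also have "path_homotopic X (xconcat X p' q) (xconcat X p' q')"
    using path_homotopic_xconcat3[OF assms(2) assms(4), of p' "gpath (xter X q) \<one>\<^bsub>grp X (xter X q)\<^esub>"]
    by (simp add: assms(3-5) p' q')
  finally show ?thesis .
qed

lemma path_class_eq_iff: "path_class X p = path_class X q \<longleftrightarrow> path_homotopic X p q"
  unfolding path_class_def
  using path_homotopic_sym path_homotopic_trans path_homotopic_refl by blast

lemma path_homotopic_elem_move: "elem_move X s s' \<Longrightarrow> path_homotopic X s s'"
  using subpath_move.intros[of X s s' "gpath (xini s) \<one>\<^bsub>grp X (xini s)\<^esub>"
      "gpath (xter X s) \<one>\<^bsub>grp X (xter X s)\<^esub>"]
  by (intro path_homotopic_step) (simp add: elem_move_valid)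

end

section \<open>The fundamental groupoid\<close>

definition arrows ::
  "('v, 'e, 'g, 'm) complex_of_groups_scheme \<Rightarrow> ('v, 'e, 'g) xpath set set" where
  "arrows X = {path_class X p | p. is_xpath X p}"

text \<open>The ends are read off an arbitrary representative; by
  \<open>path_homotopic_valid\<close> all representatives of an arrow agree on them.\<close>

definition src :: "('v, 'e, 'g) xpath set \<Rightarrow> 'v" where
  "src c = xini (SOME p. p \<in> c)"

definition tgt ::
  "('v, 'e, 'g, 'm) complex_of_groups_scheme \<Rightarrow> ('v, 'e, 'g) xpath set \<Rightarrow> 'v" where
  "tgt X c = xter X (SOME p. p \<in> c)"

text \<open>This has the shape of the multiplication in \<open>pi1\<close>, so the two products
  agree as sets without any typing condition, and the group becomes the loops of the
  groupoid.\<close>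

definition amult ::
  "('v, 'e, 'g) xpath set \<Rightarrow> ('v, 'e, 'g, 'm) complex_of_groups_scheme
   \<Rightarrow> ('v, 'e, 'g) xpath set \<Rightarrow> ('v, 'e, 'g) xpath set"
  ("(_ \<cdot>\<^sub>_ _)" [71, 1000, 70] 70) where
  "c \<cdot>\<^sub>X d = (\<Union>p\<in>c. \<Union>q\<in>d. path_class X (xconcat X p q))"

definition gcls ::
  "('v, 'e, 'g, 'm) complex_of_groups_scheme \<Rightarrow> 'v \<Rightarrow> 'g \<Rightarrow> ('v, 'e, 'g) xpath set" where
  "gcls X \<sigma> g = path_class X (gpath \<sigma> g)"

definition ecls ::
  "('v, 'e, 'g, 'm) complex_of_groups_scheme \<Rightarrow> 'e \<Rightarrow> ('v, 'e, 'g) xpath set" where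
  "ecls X a = path_class X (epath X a)"

abbreviation idcls ::
  "('v, 'e, 'g, 'm) complex_of_groups_scheme \<Rightarrow> 'v \<Rightarrow> ('v, 'e, 'g) xpath set" where
  "idcls X \<sigma> \<equiv> gcls X \<sigma> \<one>\<^bsub>grp X \<sigma>\<^esub>"

text \<open>Choosing the inverse by its defining property avoids reversing paths and checking that
  reversal respects homotopy.\<close>

definition ainv ::
  "('v, 'e, 'g, 'm) complex_of_groups_scheme \<Rightarrow> ('v, 'e, 'g) xpath set \<Rightarrow> ('v, 'e, 'g) xpath set" where
  "ainv X c = (SOME d. d \<in> arrows X \<and> src d = tgt X c \<and> tgt X d = src c \<and>
     c \<cdot>\<^sub>X d = idcls X (src c) \<and> d \<cdot>\<^sub>X c = idcls X (tgt X c))"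

context complex_of_groups
begin

lemma path_class_arrow [simp]: "is_xpath X p \<Longrightarrow> path_class X p \<in> arrows X"
  unfolding arrows_def by blast

lemma arrowE:
  assumes "c \<in> arrows X"
  obtains p where "is_xpath X p" "c = path_class X p"
  using assms unfolding arrows_def by blast

lemma some_in_path_class: "path_homotopic X p (SOME q. q \<in> path_class X p)"
proof -
  have "p \<in> path_class X p" by (simp add: path_class_def)
  then have "(SOME q. q \<in> path_class X p) \<in> path_class X p" by (rule someI)
  then show ?thesis by (simp add: path_class_def)
qed

lemma src_path_class [simp]: "is_xpath X p \<Longrightarrow> src (path_class X p) = xini p"
  unfolding src_def by (rule path_homotopic_valid(2)[OF some_in_path_class])

lemma tgt_path_class [simp]: "is_xpath X p \<Longrightarrow> tgt X (path_class X p) = xter X p"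
  unfolding tgt_def by (rule path_homotopic_valid(3)[OF some_in_path_class])

lemma amult_path_class [simp]:
  assumes "is_xpath X p" "is_xpath X q" "xter X p = xini q"
  shows "path_class X p \<cdot>\<^sub>X path_class X q = path_class X (xconcat X p q)"
proof -
  have "path_class X (xconcat X p' q') = path_class X (xconcat X p q)"
    if "p' \<in> path_class X p" "q' \<in> path_class X q" for p' q'
  proof -
    have "path_homotopic X (xconcat X p q) (xconcat X p' q')"
      using that assms by (intro path_homotopic_xconcat) (auto simp: path_class_def)
    then show ?thesis by (simp add: path_class_eq_iff path_homotopic_sym)
  qed
  then have "path_class X p \<cdot>\<^sub>X path_class X q
      = (\<Union>p'\<in>path_class X p. \<Union>q'\<in>path_class X q. path_class X (xconcat X p q))"
    unfolding amult_def by (intro SUP_cong refl)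
  moreover have "p \<in> path_class X p" "q \<in> path_class X q" by (auto simp: path_class_def)
  ultimately show ?thesis by auto
qed

lemma amult_typing [simp]:
  assumes "c \<in> arrows X" "d \<in> arrows X" "tgt X c = src d"
  shows "c \<cdot>\<^sub>X d \<in> arrows X" "src (c \<cdot>\<^sub>X d) = src c" "tgt X (c \<cdot>\<^sub>X d) = tgt X d"
  using assms by (auto elim!: arrowE)

lemma amult_assoc [simp]:
  assumes "c \<in> arrows X" "d \<in> arrows X" "e \<in> arrows X" "tgt X c = src d" "tgt X d = src e"
  shows "(c \<cdot>\<^sub>X d) \<cdot>\<^sub>X e = c \<cdot>\<^sub>X (d \<cdot>\<^sub>X e)"
  using assms by (auto elim!: arrowE simp: xconcat_assoc)

lemma src_closed [simp]: "c \<in> arrows X \<Longrightarrow> src c \<in> verts X"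
  and tgt_closed [simp]: "c \<in> arrows X \<Longrightarrow> tgt X c \<in> verts X"
  by (auto elim!: arrowE)

lemma gcls_typing [simp]:
  assumes "\<sigma> \<in> verts X" "g \<in> carrier (grp X \<sigma>)"
  shows "gcls X \<sigma> g \<in> arrows X" "src (gcls X \<sigma> g) = \<sigma>" "tgt X (gcls X \<sigma> g) = \<sigma>"
  using assms by (auto simp: gcls_def)

lemma gcls_mult:
  assumes "\<sigma> \<in> verts X" "g \<in> carrier (grp X \<sigma>)" "h \<in> carrier (grp X \<sigma>)"
  shows "gcls X \<sigma> (g \<otimes>\<^bsub>grp X \<sigma>\<^esub> h) = gcls X \<sigma> g \<cdot>\<^sub>X gcls X \<sigma> h"
  using assms by (auto simp: gcls_def)

lemma amult_id_left [simp]: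
  assumes "c \<in> arrows X" "src c = \<sigma>" shows "idcls X \<sigma> \<cdot>\<^sub>X c = c"
  using assms by (auto simp: gcls_def elim!: arrowE)

lemma amult_id_right [simp]:
  assumes "c \<in> arrows X" "tgt X c = \<sigma>" shows "c \<cdot>\<^sub>X idcls X \<sigma> = c"
  using assms by (auto simp: gcls_def elim!: arrowE)

lemma epath_eq: "epath X a = fstep \<one>\<^bsub>grp X (ini X a)\<^esub> a \<one>\<^bsub>grp X (ter X a)\<^esub>"
  by (simp add: epath_def xcons_def gpath_def)

lemma is_xpath_epath [simp]: "a \<in> edges X \<Longrightarrow> is_xpath X (epath X a)"
  and xini_epath [simp]: "xini (epath X a) = ini X a"
  and xter_epath [simp]: "xter X (epath X a) = ter X a"
  by (simp_all add: epath_eq)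

lemma ecls_typing [simp]:
  assumes "a \<in> edges X"
  shows "ecls X a \<in> arrows X" "src (ecls X a) = ini X a" "tgt X (ecls X a) = ter X a"
  using assms by (auto simp: ecls_def)

lemma ecls_bwd:
  assumes a: "a \<in> edges X"
  defines "b \<equiv> path_class X (bstep \<one>\<^bsub>grp X (ter X a)\<^esub> a \<one>\<^bsub>grp X (ini X a)\<^esub>)"
  shows "b \<in> arrows X" "src b = ter X a" "tgt X b = ini X a"
    "ecls X a \<cdot>\<^sub>X b = idcls X (ini X a)" "b \<cdot>\<^sub>X ecls X a = idcls X (ter X a)"
proof -
  note gpath_def [simp] xcons_def [simp] is_xpath.simps [simp] xini.simps [simp] xter.simps [simp]
  show "b \<in> arrows X" "src b = ter X a" "tgt X b = ini X a"
    using a by (simp_all add: b_def)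
  show "ecls X a \<cdot>\<^sub>X b = idcls X (ini X a)"
    using path_homotopic_elem_move[OF cancel_fwd[OF a, of "\<one>\<^bsub>grp X (ini X a)\<^esub>" "\<one>\<^bsub>grp X (ini X a)\<^esub>" "\<one>\<^bsub>grp X (ini X a)\<^esub>"]] a
    by (simp add: b_def ecls_def epath_eq gcls_def path_class_eq_iff)
  show "b \<cdot>\<^sub>X ecls X a = idcls X (ter X a)"
    using path_homotopic_elem_move[OF cancel_bwd[OF a, of "\<one>\<^bsub>grp X (ter X a)\<^esub>" "\<one>\<^bsub>grp X (ini X a)\<^esub>" "\<one>\<^bsub>grp X (ter X a)\<^esub>"]] a
    by (simp add: b_def ecls_def epath_eq gcls_def path_class_eq_iff)
qed

lemma gcls_ecls:
  assumes "a \<in> edges X" "g \<in> carrier (grp X (ini X a))"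
  shows "gcls X (ini X a) g \<cdot>\<^sub>X ecls X a = ecls X a \<cdot>\<^sub>X gcls X (ter X a) (psi X a g)"
  using path_homotopic_elem_move[OF slide_fwd[of a X "\<one>\<^bsub>grp X (ini X a)\<^esub>" g "\<one>\<^bsub>grp X (ter X a)\<^esub>"]] assms
  by (simp add: ecls_def epath_eq gcls_def path_class_eq_iff)
    (simp add: gpath_def xcons_def)

text \<open>The composition move leaves the inverse of the twisting element behind the composite
  edge. Letting the last group element of the move be \<open>tw X a b\<close> cancels it.\<close>

lemma ecls_cmp:
  assumes ab: "(a, b) \<in> E2 X"
  shows "ecls X b \<cdot>\<^sub>X ecls X a \<cdot>\<^sub>X gcls X (ter X a) (tw X a b) = ecls X (cmp X a b)"
proof -
  note v = E2D[OF ab] tw_closed[OF ab]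
  have "(ecls X b \<cdot>\<^sub>X ecls X a) \<cdot>\<^sub>X gcls X (ter X a) (tw X a b) = ecls X (cmp X a b)"
    using path_homotopic_elem_move[OF compose_fwd[OF ab, of "\<one>\<^bsub>grp X (ini X b)\<^esub>" "tw X a b"]] v
    by (simp add: ecls_def epath_eq gcls_def path_class_eq_iff)
      (simp add: gpath_def xcons_def)
  then show ?thesis using v by simp
qed

text \<open>Local elements and single oriented edges have inverses, inverses multiply in reverse
  order, and every path is a product of such pieces.\<close>

lemma ex_ainv:
  assumes "c \<in> arrows X"
  shows "\<exists>d. d \<in> arrows X \<and> src d = tgt X c \<and> tgt X d = src c \<and>
     c \<cdot>\<^sub>X d = idcls X (src c) \<and> d \<cdot>\<^sub>X c = idcls X (tgt X c)" (is "\<exists>d. ?inv c d")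
proof -
  have mul: "\<exists>d. ?inv (c1 \<cdot>\<^sub>X c2) d"
    if "c1 \<in> arrows X" "c2 \<in> arrows X" "tgt X c1 = src c2" "?inv c1 d1" "?inv c2 d2" for c1 c2 d1 d2
  proof (intro exI[of _ "d2 \<cdot>\<^sub>X d1"] conjI)
    have "c2 \<cdot>\<^sub>X (d2 \<cdot>\<^sub>X d1) = d1" "d1 \<cdot>\<^sub>X (c1 \<cdot>\<^sub>X c2) = c2"
      using that amult_assoc[of c2 d2 d1] amult_assoc[of d1 c1 c2] by (simp_all del: amult_assoc)
    then show "(c1 \<cdot>\<^sub>X c2) \<cdot>\<^sub>X (d2 \<cdot>\<^sub>X d1) = idcls X (src (c1 \<cdot>\<^sub>X c2))"
      "(d2 \<cdot>\<^sub>X d1) \<cdot>\<^sub>X (c1 \<cdot>\<^sub>X c2) = idcls X (tgt X (c1 \<cdot>\<^sub>X c2))"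
      using that by simp_all
  qed (use that in auto)
  have g: "\<exists>d. ?inv (gcls X \<sigma> g) d" if "\<sigma> \<in> verts X" "g \<in> carrier (grp X \<sigma>)" for \<sigma> g
    using that by (intro exI[of _ "gcls X \<sigma> (inv\<^bsub>grp X \<sigma>\<^esub> g)"]) (auto simp flip: gcls_mult)
  have e: "\<exists>d. ?inv (path_class X (xcons X \<one>\<^bsub>grp X (oini X e)\<^esub> e (gpath (oter X e) \<one>\<^bsub>grp X (oter X e)\<^esub>))) d"
    if "e \<in> oedges X" for e
  proof (cases e)
    case (Fwd a)
    then show ?thesis using that ecls_bwd[of a]
      by (auto simp: ecls_def epath_eq
        intro!: exI[of _ "path_class X (bstep \<one>\<^bsub>grp X (ter X a)\<^esub> a \<one>\<^bsub>grp X (ini X a)\<^esub>)"])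
  next
    case (Bwd a)
    then show ?thesis using that ecls_bwd[of a] ecls_typing[of a]
      by (intro exI[of _ "ecls X a"]) auto
  qed
  obtain p where "is_xpath X p" "c = path_class X p" using assms by (rule arrowE)
  have "\<exists>d. ?inv (path_class X p) d" using \<open>is_xpath X p\<close>
  proof (induct rule: is_xpath_induct)
    case (gpath \<sigma> g)
    then show ?case using g[of \<sigma> g] by (simp add: gcls_def)
  next
    case (xcons g e q)
    let ?u = "xcons X \<one>\<^bsub>grp X (oini X e)\<^esub> e (gpath (oter X e) \<one>\<^bsub>grp X (oter X e)\<^esub>)"
    obtain d1 where d1: "?inv (gcls X (oini X e) g) d1" using g xcons by (metis oini_closed)
    obtain d2 where d2: "?inv (path_class X ?u) d2" using e xcons by blast
    obtain d3 where d3: "?inv (path_class X q) d3" using xcons by blast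
    have "\<exists>d. ?inv (gcls X (oini X e) g \<cdot>\<^sub>X path_class X ?u) d"
      by (rule mul[OF _ _ _ d1 d2]) (use xcons in auto)
    then obtain d4 where d4: "?inv (gcls X (oini X e) g \<cdot>\<^sub>X path_class X ?u) d4" by blast
    have "\<exists>d. ?inv ((gcls X (oini X e) g \<cdot>\<^sub>X path_class X ?u) \<cdot>\<^sub>X path_class X q) d"
      by (rule mul[OF _ _ _ d4 d3]) (use xcons in \<open>auto simp: gcls_def\<close>)
    moreover have "(gcls X (oini X e) g \<cdot>\<^sub>X path_class X ?u) \<cdot>\<^sub>X path_class X q
        = path_class X (xcons X g e q)"
      using xcons by (simp add: gcls_def)
    ultimately show ?case by simp
  qed
  then show ?thesis using \<open>c = path_class X p\<close> by simp
qed

lemma ainv_typing [simp]: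
  assumes "c \<in> arrows X"
  shows "ainv X c \<in> arrows X" "src (ainv X c) = tgt X c" "tgt X (ainv X c) = src c"
    and ainv_right: "c \<cdot>\<^sub>X ainv X c = idcls X (src c)"
    and ainv_left: "ainv X c \<cdot>\<^sub>X c = idcls X (tgt X c)"
  unfolding ainv_def using someI_ex[OF ex_ainv[OF assms]] by blast+

lemma ainv_cancel [simp]:
  assumes "c \<in> arrows X" "d \<in> arrows X" "tgt X c = src d"
  shows "ainv X c \<cdot>\<^sub>X (c \<cdot>\<^sub>X d) = d"
  using assms amult_assoc[of "ainv X c" c d] by (simp add: ainv_left del: amult_assoc)

lemma ainv_cancel' [simp]:
  assumes "c \<in> arrows X" "d \<in> arrows X" "src c = src d"
  shows "c \<cdot>\<^sub>X (ainv X c \<cdot>\<^sub>X d) = d"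
  using assms amult_assoc[of c "ainv X c" d] by (simp add: ainv_right del: amult_assoc)

lemma amult_left_cancel [simp]:
  assumes "c \<in> arrows X" "d \<in> arrows X" "d' \<in> arrows X" "tgt X c = src d" "tgt X c = src d'"
  shows "c \<cdot>\<^sub>X d = c \<cdot>\<^sub>X d' \<longleftrightarrow> d = d'"
  using assms ainv_cancel by metis

lemma ainv_unique:
  assumes "c \<in> arrows X" "d \<in> arrows X" "tgt X c = src d" "c \<cdot>\<^sub>X d = idcls X (src c)"
  shows "ainv X c = d"
  using assms ainv_cancel[of c d] by simp

lemma amult_right_cancel:
  assumes "c \<in> arrows X" "d \<in> arrows X" "d' \<in> arrows X" "tgt X d = src c" "tgt X d' = src c"
  shows "d \<cdot>\<^sub>X c = d' \<cdot>\<^sub>X c \<longleftrightarrow> d = d'"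
proof
  assume "d \<cdot>\<^sub>X c = d' \<cdot>\<^sub>X c"
  then have "(d \<cdot>\<^sub>X c) \<cdot>\<^sub>X ainv X c = (d' \<cdot>\<^sub>X c) \<cdot>\<^sub>X ainv X c" by simp
  then show "d = d'" using assms by (simp add: ainv_right)
qed simp

lemma ainv_ainv [simp]: "c \<in> arrows X \<Longrightarrow> ainv X (ainv X c) = c"
  by (rule ainv_unique) (simp_all add: ainv_left)

lemma ainv_amult [simp]:
  assumes "c \<in> arrows X" "d \<in> arrows X" "tgt X c = src d"
  shows "ainv X (c \<cdot>\<^sub>X d) = ainv X d \<cdot>\<^sub>X ainv X c"
  using assms by (intro ainv_unique) (simp_all add: ainv_right)

lemma gcls_inv:
  assumes "\<sigma> \<in> verts X" "g \<in> carrier (grp X \<sigma>)"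
  shows "gcls X \<sigma> (inv\<^bsub>grp X \<sigma>\<^esub> g) = ainv X (gcls X \<sigma> g)"
  using assms by (intro ainv_unique[symmetric]) (simp_all flip: gcls_mult)

lemma ainv_ecls:
  "a \<in> edges X \<Longrightarrow>
    ainv X (ecls X a) = path_class X (bstep \<one>\<^bsub>grp X (ter X a)\<^esub> a \<one>\<^bsub>grp X (ini X a)\<^esub>)"
  using ecls_bwd[of a] by (intro ainv_unique) simp_all

text \<open>The generators of the groupoid are local elements, edges and inverse edges. The cases
  speak of arrows rather than paths, so inductions over them stay independent of
  representatives.\<close>

lemma arrow_induct [consumes 1, case_names gcls fwd bwd]:
  assumes "c \<in> arrows X"
    and "\<And>\<sigma> g. \<sigma> \<in> verts X \<Longrightarrow> g \<in> carrier (grp X \<sigma>) \<Longrightarrow> P (gcls X \<sigma> g)"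
    and "\<And>g a c. a \<in> edges X \<Longrightarrow> g \<in> carrier (grp X (ini X a)) \<Longrightarrow> c \<in> arrows X \<Longrightarrow>
      src c = ter X a \<Longrightarrow> P c \<Longrightarrow> P (gcls X (ini X a) g \<cdot>\<^sub>X (ecls X a \<cdot>\<^sub>X c))"
    and "\<And>g a c. a \<in> edges X \<Longrightarrow> g \<in> carrier (grp X (ter X a)) \<Longrightarrow> c \<in> arrows X \<Longrightarrow>
      src c = ini X a \<Longrightarrow> P c \<Longrightarrow> P (gcls X (ter X a) g \<cdot>\<^sub>X (ainv X (ecls X a) \<cdot>\<^sub>X c))"
  shows "P c"
proof -
  obtain p where p: "is_xpath X p" "c = path_class X p" using assms(1) by (rule arrowE)
  have "P (path_class X p)" using p(1)
  proof (induct rule: is_xpath_induct)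
    case (gpath \<sigma> g)
    then show ?case using assms(2)[of \<sigma> g] by (simp add: gcls_def)
  next
    case (xcons g e q)
    show ?case
    proof (cases e)
      case (Fwd a)
      then show ?thesis using xcons assms(3)[of a g "path_class X q"]
        by (simp add: gcls_def ecls_def epath_eq)
    next
      case (Bwd a)
      then show ?thesis using xcons assms(4)[of a g "path_class X q"]
        by (simp add: gcls_def ainv_ecls)
    qed
  qed
  then show ?thesis using p by simp
qed

lemma ex_arrow:
  assumes "\<sigma> \<in> verts X" "\<tau> \<in> verts X"
  shows "\<exists>c. c \<in> arrows X \<and> src c = \<sigma> \<and> tgt X c = \<tau>"
proof -
  have "\<exists>p. is_xpath X p \<and> xini p = \<sigma> \<and> xter X p = \<tau>" if "path_from X \<sigma> es \<tau>" for es
    using that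
  proof (induct es arbitrary: \<sigma>)
    case Nil
    then show ?case by (intro exI[of _ "gpath \<sigma> \<one>\<^bsub>grp X \<sigma>\<^esub>"]) simp
  next
    case (Cons e es)
    then obtain p where "is_xpath X p" "xini p = oter X e" "xter X p = \<tau>"
      unfolding path_from.simps by blast
    then show ?case using Cons.prems
      by (intro exI[of _ "xcons X \<one>\<^bsub>grp X (oini X e)\<^esub> e p"]) auto
  qed
  moreover obtain es where "path_from X \<sigma> es \<tau>"
    using connected assms unfolding connected_scwol_def by blast
  ultimately show ?thesis using path_class_arrow src_path_class tgt_path_class by blast
qed

section \<open>The fundamental group as the loops of the groupoid\<close>

lemma pi1_carrier: "carrier (pi1 X \<sigma>) = {c \<in> arrows X. src c = \<sigma> \<and> tgt X c = \<sigma>}"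
proof (intro equalityI subsetI)
  fix c assume "c \<in> carrier (pi1 X \<sigma>)"
  then obtain p where "c = path_class X p" "is_xpath X p" "xini p = \<sigma>" "xter X p = \<sigma>"
    unfolding pi1_def xpaths_from_def partial_object.simps by blast
  then show "c \<in> {c \<in> arrows X. src c = \<sigma> \<and> tgt X c = \<sigma>}" by simp
next
  fix c assume c: "c \<in> {c \<in> arrows X. src c = \<sigma> \<and> tgt X c = \<sigma>}"
  then obtain p where p: "c = path_class X p" "is_xpath X p" by (metis (no_types, lifting) arrowE mem_Collect_eq)
  then have "xini p = \<sigma>" "xter X p = \<sigma>" using c by auto
  then show "c \<in> carrier (pi1 X \<sigma>)"
    using p unfolding pi1_def xpaths_from_def partial_object.simps by blast
qed

lemma pi1_mult: "c \<otimes>\<^bsub>pi1 X \<sigma>\<^esub> d = c \<cdot>\<^sub>X d"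
  by (simp add: pi1_def amult_def)

lemma pi1_one: "\<one>\<^bsub>pi1 X \<sigma>\<^esub> = idcls X \<sigma>"
  by (simp add: pi1_def gcls_def)

lemma pi1_group: "\<sigma> \<in> verts X \<Longrightarrow> group (pi1 X \<sigma>)"
proof (rule groupI)
  fix c assume "c \<in> carrier (pi1 X \<sigma>)"
  then show "\<exists>d\<in>carrier (pi1 X \<sigma>). d \<otimes>\<^bsub>pi1 X \<sigma>\<^esub> c = \<one>\<^bsub>pi1 X \<sigma>\<^esub>"
    by (intro bexI[of _ "ainv X c"]) (auto simp: pi1_carrier pi1_mult pi1_one ainv_left)
qed (auto simp: pi1_carrier pi1_mult pi1_one)

lemma pi1_inv: "\<sigma> \<in> verts X \<Longrightarrow> c \<in> carrier (pi1 X \<sigma>) \<Longrightarrow> inv\<^bsub>pi1 X \<sigma>\<^esub> c = ainv X c"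
  by (rule group.inv_equality[OF pi1_group])
    (auto simp: pi1_carrier pi1_mult pi1_one ainv_left)

end

text \<open>Simplification associates products to the right, where an equation between two-fold
  products no longer matches once a third factor follows. This form applies there.\<close>

lemma (in complex_of_groups) amult_ext:
  assumes "c \<cdot>\<^sub>X d = c' \<cdot>\<^sub>X d'" "c \<in> arrows X" "d \<in> arrows X" "c' \<in> arrows X" "d' \<in> arrows X"
    "x \<in> arrows X" "tgt X c = src d" "tgt X d = src x" "tgt X c' = src d'" "tgt X d' = src x"
  shows "c \<cdot>\<^sub>X (d \<cdot>\<^sub>X x) = c' \<cdot>\<^sub>X (d' \<cdot>\<^sub>X x)"
  using assms amult_assoc[of c d x] amult_assoc[of c' d' x] by metis

lemma (in complex_of_groups) gcls_inv_gcls: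
  assumes "\<sigma> \<in> verts X" "g \<in> carrier (grp X \<sigma>)"
  shows "gcls X \<sigma> g \<cdot>\<^sub>X gcls X \<sigma> (inv\<^bsub>grp X \<sigma>\<^esub> g) = idcls X \<sigma>"
    "gcls X \<sigma> (inv\<^bsub>grp X \<sigma>\<^esub> g) \<cdot>\<^sub>X gcls X \<sigma> g = idcls X \<sigma>"
  using assms by (simp_all flip: gcls_mult)

text \<open>A right action of the groupoid, given on generators. The axioms mirror the slide and
  composition moves, and bijectivity of \<open>ae\<close> accounts for inverse edges and
  cancellation. There are two instances: multiplication by images of paths, which makes induced maps
  well defined, and the lifting of paths along a covering.\<close>

locale path_action = complex_of_groups X
  for X :: "('v, 'e, 'g, 'm) complex_of_groups_scheme" +
  fixes E :: "'v \<Rightarrow> 'z set" and ag :: "'v \<Rightarrow> 'g \<Rightarrow> 'z \<Rightarrow> 'z" and ae :: "'e \<Rightarrow> 'z \<Rightarrow> 'z"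
  assumes ag_closed [simp]: "\<lbrakk>\<sigma> \<in> verts X; g \<in> carrier (grp X \<sigma>); z \<in> E \<sigma>\<rbrakk> \<Longrightarrow> ag \<sigma> g z \<in> E \<sigma>"
    and ag_one [simp]: "\<lbrakk>\<sigma> \<in> verts X; z \<in> E \<sigma>\<rbrakk> \<Longrightarrow> ag \<sigma> \<one>\<^bsub>grp X \<sigma>\<^esub> z = z"
    and ag_mult [simp]: "\<lbrakk>\<sigma> \<in> verts X; g \<in> carrier (grp X \<sigma>); h \<in> carrier (grp X \<sigma>); z \<in> E \<sigma>\<rbrakk> \<Longrightarrow>
      ag \<sigma> (g \<otimes>\<^bsub>grp X \<sigma>\<^esub> h) z = ag \<sigma> h (ag \<sigma> g z)"
    and ae_bij: "a \<in> edges X \<Longrightarrow> bij_betw (ae a) (E (ini X a)) (E (ter X a))"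
    and ae_ag [simp]: "\<lbrakk>a \<in> edges X; g \<in> carrier (grp X (ini X a)); z \<in> E (ini X a)\<rbrakk> \<Longrightarrow>
      ae a (ag (ini X a) g z) = ag (ter X a) (psi X a g) (ae a z)"
    and ae_cmp: "\<lbrakk>(a, b) \<in> E2 X; z \<in> E (ini X b)\<rbrakk> \<Longrightarrow>
      ae (cmp X a b) z = ag (ter X a) (tw X a b) (ae a (ae b z))"
begin

fun ao :: "'e oriented \<Rightarrow> 'z \<Rightarrow> 'z" where
  "ao (Fwd a) = ae a"
| "ao (Bwd a) = inv_into (E (ini X a)) (ae a)"

fun act :: "('v, 'e, 'g) xpath \<Rightarrow> 'z \<Rightarrow> 'z" where
  "act (\<sigma>, g, l) z = fold (\<lambda>(e, h) z. ag (oter X e) h (ao e z)) l (ag \<sigma> g z)"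

declare act.simps [simp del]

lemma act_gpath [simp]: "act (gpath \<sigma> g) z = ag \<sigma> g z"
  by (simp add: gpath_def act.simps)

lemma act_xcons [simp]:
  "xini p = oter X e \<Longrightarrow> act (xcons X g e p) z = act p (ao e (ag (oini X e) g z))"
  by (cases p) (simp add: xcons_def act.simps xini.simps)

lemma ae_closed [simp]: "a \<in> edges X \<Longrightarrow> z \<in> E (ini X a) \<Longrightarrow> ae a z \<in> E (ter X a)"
  using ae_bij bij_betwE by blast

lemma inv_ae [simp]:
  assumes "a \<in> edges X" "z \<in> E (ter X a)"
  shows "inv_into (E (ini X a)) (ae a) z \<in> E (ini X a)" "ae a (inv_into (E (ini X a)) (ae a) z) = z"
  using assms ae_bij[of a] by (metis bij_betw_imp_surj_on f_inv_into_f inv_into_into)+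

lemma inv_ae_ae [simp]:
  "a \<in> edges X \<Longrightarrow> z \<in> E (ini X a) \<Longrightarrow> inv_into (E (ini X a)) (ae a) (ae a z) = z"
  using ae_bij[of a] by (simp add: bij_betw_def inv_into_f_f)

lemma ao_closed [simp]: "e \<in> oedges X \<Longrightarrow> z \<in> E (oini X e) \<Longrightarrow> ao e z \<in> E (oter X e)"
  by (cases e) simp_all

lemma act_closed [simp]:
  assumes "is_xpath X p" "z \<in> E (xini p)" shows "act p z \<in> E (xter X p)"
  using assms by (induct arbitrary: z rule: is_xpath_induct) simp_all

lemma act_xconcat:
  assumes "is_xpath X p" "is_xpath X q" "xter X p = xini q" "z \<in> E (xini p)"
  shows "act (xconcat X p q) z = act q (act p z)"
  using assms(1,3,4)
proof (induct arbitrary: z rule: is_xpath_induct)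
  case (gpath \<sigma> g)
  show ?case using assms(2) by (cases rule: is_xpath_cases) (use gpath in simp_all)
qed (use assms(2) in simp_all)

lemma inv_ae_ag:
  assumes "a \<in> edges X" "h \<in> carrier (grp X (ini X a))" "z \<in> E (ter X a)"
  shows "inv_into (E (ini X a)) (ae a) (ag (ter X a) (psi X a h) z)
    = ag (ini X a) h (inv_into (E (ini X a)) (ae a) z)"
proof -
  have "ag (ter X a) (psi X a h) z = ae a (ag (ini X a) h (inv_into (E (ini X a)) (ae a) z))"
    using assms by simp
  then show ?thesis using assms by (simp del: ae_ag)
qed

text \<open>Every move corresponds to an axiom of the action; for inverse edges the axiom is applied
  to the preimage and then inverted.\<close>

lemma act_elem_move:
  assumes "elem_move X s s'" "z \<in> E (xini s)" shows "act s z = act s' z"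
  using assms
proof induct
  case (slide_bwd a g h k)
  then show ?case by (simp add: act.simps xini.simps inv_ae_ag)
next
  case (compose_fwd a b g k)
  note v = E2D[OF compose_fwd(1)] tw_closed[OF compose_fwd(1)]
  have z: "ag (ini X b) g z \<in> E (ini X b)" using compose_fwd v by (simp add: xini.simps)
  \<comment> \<open>The action of the composite edge contributes the twisting element, which the
    inverse appearing in the move removes again.\<close>
  then have "ag (ter X a) (inv\<^bsub>grp X (ter X a)\<^esub> tw X a b) (ae (cmp X a b) (ag (ini X b) g z))
      = ag (ter X a) (tw X a b \<otimes>\<^bsub>grp X (ter X a)\<^esub> inv\<^bsub>grp X (ter X a)\<^esub> tw X a b) (ae a (ae b (ag (ini X b) g z)))"
    using v by (simp add: ae_cmp[OF compose_fwd(1)] del: grp_mult_inv ae_ag)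
  also have "\<dots> = ae a (ae b (ag (ini X b) g z))"
    using v z by (simp del: ag_mult ae_ag)
  finally show ?case
    using compose_fwd v z ae_closed[of "cmp X a b" "ag (ini X b) g z"]
    by (simp add: act.simps xini.simps del: ae_ag)
next
  case (compose_bwd a b g k)
  note v = E2D[OF compose_bwd(1)] tw_closed[OF compose_bwd(1)]
  let ?w = "ag (ter X a) g z"
  let ?u = "inv_into (E (ini X a)) (ae a) ?w"
  let ?v = "inv_into (E (ini X b)) (ae b) ?u"
  have w: "?w \<in> E (ter X a)" using compose_bwd v by (simp add: xini.simps)
  then have u: "?u \<in> E (ter X b)" using inv_ae(1)[OF v(1) w] v by simp
  have vv: "?v \<in> E (ini X b)" using inv_ae(1)[OF v(2) u] .
  \<comment> \<open>\<open>?v\<close> is obtained from \<open>?w\<close> by going back along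
    \<open>a\<close> and then \<open>b\<close>. The composition axiom at \<open>?v\<close> shows
    that going back along the composite edge from the twisted point also leads to
    \<open>?v\<close>.\<close>
  have "ag (ter X a) (tw X a b) ?w = ae (cmp X a b) ?v"
    using ae_cmp[OF compose_bwd(1) vv] inv_ae(2)[OF v(2) u] inv_ae(2)[OF v(1) w] by simp
  then have "inv_into (E (ini X (cmp X a b))) (ae (cmp X a b)) (ag (ter X a) (tw X a b) ?w) = ?v"
    using inv_ae_ae[OF v(4)] vv v(5) by simp
  then show ?case
    using compose_bwd v u by (simp add: act.simps xini.simps)
qed (simp_all add: act.simps xini.simps inv_ae_ag)

lemma act_subpath_move:
  assumes "subpath_move X p q" "z \<in> E (xini p)" shows "act p z = act q z"
  using assms
proof induct
  case (1 s s' r r')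
  then show ?case
    using act_elem_move[OF 1(1), of "act r z"] elem_move_valid[OF 1(1)] act_closed[of r z]
    by (simp add: act_xconcat)
qed

lemma act_homotopic:
  assumes "path_homotopic X p q" "z \<in> E (xini p)"
  shows "act p z = act q z"
proof -
  have "xini q = xini p \<and> act p z = act q z" using assms
  proof (induct rule: path_homotopic_induct)
    case (step p q r)
    then have "xini q = xini p" "act p z = act q z" by auto
    moreover have "xini r = xini q \<and> act q z = act r z" using step.hyps(3)
    proof
      assume *: "subpath_move X q r"
      show ?thesis using subpath_move_valid(3)[OF *] act_subpath_move[OF *] step.prems
          \<open>xini q = xini p\<close> by simp
    next
      assume *: "subpath_move X r q"
      show ?thesis using subpath_move_valid(3)[OF *] act_subpath_move[OF *] step.prems
          \<open>xini q = xini p\<close> by simp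
    qed
    ultimately show ?case by simp
  qed simp
  then show ?thesis ..
qed

end

section \<open>The induced functor of a morphism\<close>

context cog_morphism
begin

declare vmap_closed [simp] emap_closed [simp] ini_emap [simp] ter_emap [simp] telt_closed [simp]

lemma gmap_closed [simp]:
  "\<lbrakk>\<sigma> \<in> verts X; g \<in> carrier (grp X \<sigma>)\<rbrakk> \<Longrightarrow> gmap \<phi> \<sigma> g \<in> carrier (grp Y (vmap \<phi> \<sigma>))"
  using gmap_hom by (auto simp: hom_def)

lemma gmap_mult [simp]:
  "\<lbrakk>\<sigma> \<in> verts X; g \<in> carrier (grp X \<sigma>); h \<in> carrier (grp X \<sigma>)\<rbrakk> \<Longrightarrow>
    gmap \<phi> \<sigma> (g \<otimes>\<^bsub>grp X \<sigma>\<^esub> h) = gmap \<phi> \<sigma> g \<otimes>\<^bsub>grp Y (vmap \<phi> \<sigma>)\<^esub> gmap \<phi> \<sigma> h"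
  using gmap_hom by (auto simp: hom_def)

lemma gmap_group_hom: "\<sigma> \<in> verts X \<Longrightarrow> group_hom (grp X \<sigma>) (grp Y (vmap \<phi> \<sigma>)) (gmap \<phi> \<sigma>)"
  using gmap_hom by (auto simp: group_hom_def group_hom_axioms_def X.grp_group Y.grp_group)

lemma gmap_one [simp]: "\<sigma> \<in> verts X \<Longrightarrow> gmap \<phi> \<sigma> \<one>\<^bsub>grp X \<sigma>\<^esub> = \<one>\<^bsub>grp Y (vmap \<phi> \<sigma>)\<^esub>"
  using group_hom.hom_one[OF gmap_group_hom] .

lemma gmap_inv [simp]:
  "\<lbrakk>\<sigma> \<in> verts X; g \<in> carrier (grp X \<sigma>)\<rbrakk> \<Longrightarrow>
    gmap \<phi> \<sigma> (inv\<^bsub>grp X \<sigma>\<^esub> g) = inv\<^bsub>grp Y (vmap \<phi> \<sigma>)\<^esub> gmap \<phi> \<sigma> g"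
  using group_hom.hom_inv[OF gmap_group_hom] by simp

lemma E2_emap: "(a, b) \<in> E2 X \<Longrightarrow> (emap \<phi> a, emap \<phi> b) \<in> E2 Y"
  by (auto simp: E2_def)

text \<open>The arrow assigned to an edge by the induced path map: the element of the morphism
  enters inverted and behind the edge.\<close>

abbreviation edge_arrow :: "'e \<Rightarrow> ('w, 'd, 'h) xpath set" where
  "edge_arrow a \<equiv> ecls Y (emap \<phi> a) \<cdot>\<^sub>Y
     gcls Y (vmap \<phi> (ter X a)) (inv\<^bsub>grp Y (vmap \<phi> (ter X a))\<^esub> telt \<phi> a)"

text \<open>This is \<open>telt_conj\<close> as a commutation rule. The image of
  \<open>psi X a g\<close> is a conjugate by \<open>telt \<phi> a\<close>, whose left factor cancels
  against the inverse at the end of the edge arrow.\<close>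

lemma edge_arrow_slide:
  assumes a: "a \<in> edges X" and g: "g \<in> carrier (grp X (ini X a))"
  shows "gcls Y (vmap \<phi> (ini X a)) (gmap \<phi> (ini X a) g) \<cdot>\<^sub>Y edge_arrow a
    = edge_arrow a \<cdot>\<^sub>Y gcls Y (vmap \<phi> (ter X a)) (gmap \<phi> (ter X a) (psi X a g))"
proof -
  let ?t = "vmap \<phi> (ter X a)" and ?i = "vmap \<phi> (ini X a)" and ?p = "psi Y (emap \<phi> a) (gmap \<phi> (ini X a) g)"
  let ?u = "gcls Y ?t (telt \<phi> a)"
  have p: "?p \<in> carrier (grp Y ?t)"
    using a g Y.psi_closed[of "emap \<phi> a" "gmap \<phi> (ini X a) g"] by simp
  have "gcls Y ?t (gmap \<phi> (ter X a) (psi X a g)) = ?u \<cdot>\<^sub>Y (gcls Y ?t ?p \<cdot>\<^sub>Y ainv Y ?u)"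
    using a g p by (simp add: conj_by_def Y.gcls_mult Y.gcls_inv flip: telt_conj)
  moreover have "gcls Y ?i (gmap \<phi> (ini X a) g) \<cdot>\<^sub>Y ecls Y (emap \<phi> a) = ecls Y (emap \<phi> a) \<cdot>\<^sub>Y gcls Y ?t ?p"
    using Y.gcls_ecls[of "emap \<phi> a" "gmap \<phi> (ini X a) g"] a g by simp
  then have "gcls Y ?i (gmap \<phi> (ini X a) g) \<cdot>\<^sub>Y (ecls Y (emap \<phi> a) \<cdot>\<^sub>Y ainv Y ?u)
      = ecls Y (emap \<phi> a) \<cdot>\<^sub>Y (gcls Y ?t ?p \<cdot>\<^sub>Y ainv Y ?u)"
    by (rule Y.amult_ext) (use a g p in simp_all)
  ultimately show ?thesis
    using a g p by (simp add: Y.gcls_inv)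
qed

text \<open>\<open>telt_cmp\<close> is solved for the image of the twisting element. Sliding the
  element of \<open>b\<close> across the edge of \<open>a\<close> then cancels everything except the
  composition rule in \<open>Y\<close> and the inverse element of the composite.\<close>

lemma edge_arrow_cmp:
  assumes ab: "(a, b) \<in> E2 X"
  shows "edge_arrow b \<cdot>\<^sub>Y (edge_arrow a \<cdot>\<^sub>Y gcls Y (vmap \<phi> (ter X a)) (gmap \<phi> (ter X a) (tw X a b)))
    = edge_arrow (cmp X a b)"
proof -
  note v = X.E2D[OF ab] X.tw_closed[OF ab]
  note v' = Y.E2D[OF E2_emap[OF ab]] Y.tw_closed[OF E2_emap[OF ab]]
  let ?t = "vmap \<phi> (ter X a)" and ?s = "vmap \<phi> (ter X b)"
  let ?A = "ecls Y (emap \<phi> a)" and ?B = "ecls Y (emap \<phi> b)"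
  let ?ta = "gcls Y ?t (telt \<phi> a)" and ?tb = "gcls Y ?s (telt \<phi> b)"
    and ?tab = "gcls Y ?t (telt \<phi> (cmp X a b))"
    and ?p = "gcls Y ?t (psi Y (emap \<phi> a) (telt \<phi> b))"
    and ?w = "gcls Y ?t (tw Y (emap \<phi> a) (emap \<phi> b))"
    and ?F = "gcls Y ?t (gmap \<phi> (ter X a) (tw X a b))"
  have tb: "telt \<phi> b \<in> carrier (grp Y ?s)" using v by simp
  have tab: "telt \<phi> (cmp X a b) \<in> carrier (grp Y ?t)" using telt_closed[of "cmp X a b"] v by simp
  have p: "psi Y (emap \<phi> a) (telt \<phi> b) \<in> carrier (grp Y ?t)"
    using v Y.psi_closed[of "emap \<phi> a" "telt \<phi> b"] by simp
  have w: "tw Y (emap \<phi> a) (emap \<phi> b) \<in> carrier (grp Y ?t)" using v v' by simp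
  have 1: "?F \<cdot>\<^sub>Y ?tab = ?ta \<cdot>\<^sub>Y (?p \<cdot>\<^sub>Y ?w)"
    using arg_cong[OF telt_cmp[OF ab], of "gcls Y ?t"] v tb tab p w by (simp add: Y.gcls_mult)
  then have F: "?F = ?ta \<cdot>\<^sub>Y (?p \<cdot>\<^sub>Y (?w \<cdot>\<^sub>Y ainv Y ?tab))"
  proof -
    have "?F = (?F \<cdot>\<^sub>Y ?tab) \<cdot>\<^sub>Y ainv Y ?tab"
      using v tab by (simp add: Y.ainv_right)
    then show ?thesis unfolding 1 using v tab p w by simp
  qed
  have 2: "?A \<cdot>\<^sub>Y ?p = ?tb \<cdot>\<^sub>Y ?A"
    using Y.gcls_ecls[of "emap \<phi> a" "telt \<phi> b"] v by simp
  have 3: "?B \<cdot>\<^sub>Y (?A \<cdot>\<^sub>Y ?w) = ecls Y (emap \<phi> (cmp X a b))"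
    using Y.ecls_cmp[OF E2_emap[OF ab]] v by (simp add: emap_cmp[OF ab])
  have "edge_arrow b \<cdot>\<^sub>Y (edge_arrow a \<cdot>\<^sub>Y ?F)
      = ?B \<cdot>\<^sub>Y (ainv Y ?tb \<cdot>\<^sub>Y ((?A \<cdot>\<^sub>Y ?p) \<cdot>\<^sub>Y (?w \<cdot>\<^sub>Y ainv Y ?tab)))"
    unfolding F using v tb tab p w by (simp add: Y.gcls_inv)
  also have "\<dots> = (?B \<cdot>\<^sub>Y (?A \<cdot>\<^sub>Y ?w)) \<cdot>\<^sub>Y ainv Y ?tab"
    unfolding 2 using v tb tab p w by simp
  also have "\<dots> = edge_arrow (cmp X a b)"
    unfolding 3 using v tab by (simp add: Y.gcls_inv)
  finally show ?thesis .
qed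

text \<open>Arrows of \<open>Y\<close> ending over \<sigma> are multiplied on the right by images of
  generators. A path sends an identity arrow to the class of its image path, so homotopy invariance
  of the action is well-definedness of the induced map.\<close>

interpretation T: path_action X "\<lambda>\<sigma>. {z \<in> arrows Y. tgt Y z = vmap \<phi> \<sigma>}"
  "\<lambda>\<sigma> g z. z \<cdot>\<^sub>Y gcls Y (vmap \<phi> \<sigma>) (gmap \<phi> \<sigma> g)" "\<lambda>a z. z \<cdot>\<^sub>Y edge_arrow a"
proof (unfold_locales, goal_cases)
  case (4 a)
  then show ?case
    by (intro bij_betw_byWitness[where f' = "\<lambda>z. z \<cdot>\<^sub>Y ainv Y (edge_arrow a)"])
      (auto simp: Y.ainv_right Y.ainv_left)
next
  case (5 a g z)
  then show ?case using edge_arrow_slide[of a g] by simp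
next
  case (6 a b z)
  then show ?case using edge_arrow_cmp[OF 6(1)] X.E2D[OF 6(1)] X.tw_closed[OF 6(1)] by simp
qed (auto simp: Y.gcls_mult)

lemma edge_arrow_typing [simp]:
  assumes "a \<in> edges X"
  shows "edge_arrow a \<in> arrows Y" "src (edge_arrow a) = vmap \<phi> (ini X a)"
    "tgt Y (edge_arrow a) = vmap \<phi> (ter X a)"
  using assms by simp_all

lemma path_image_gpath [simp]: "path_image X Y \<phi> (gpath \<sigma> g) = gpath (vmap \<phi> \<sigma>) (gmap \<phi> \<sigma> g)"
  by (simp add: gpath_def)

lemma path_image_xcons [simp]:
  "xini p = oter X e \<Longrightarrow> path_image X Y \<phi> (xcons X g e p) =
     xconcat Y (gpath (vmap \<phi> (oini X e)) (gmap \<phi> (oini X e) g))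
       (xconcat Y (oedge_image X Y \<phi> e) (path_image X Y \<phi> p))"
  by (cases p) (simp add: xcons_def xini.simps)

lemma oedge_image_Fwd:
  "a \<in> edges X \<Longrightarrow> oedge_image X Y \<phi> (Fwd a) = xcons Y \<one>\<^bsub>grp Y (vmap \<phi> (ini X a))\<^esub> (Fwd (emap \<phi> a))
     (gpath (vmap \<phi> (ter X a)) (inv\<^bsub>grp Y (vmap \<phi> (ter X a))\<^esub> telt \<phi> a))"
  by (simp add: xcons_def gpath_def)

lemma oedge_image_Bwd:
  "a \<in> edges X \<Longrightarrow> oedge_image X Y \<phi> (Bwd a) = xcons Y (telt \<phi> a) (Bwd (emap \<phi> a))
     (gpath (vmap \<phi> (ini X a)) \<one>\<^bsub>grp Y (vmap \<phi> (ini X a))\<^esub>)"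
  by (simp add: xcons_def gpath_def)

lemma oedge_image_valid [simp]:
  assumes "e \<in> oedges X"
  shows "is_xpath Y (oedge_image X Y \<phi> e)" "xini (oedge_image X Y \<phi> e) = vmap \<phi> (oini X e)"
    "xter Y (oedge_image X Y \<phi> e) = vmap \<phi> (oter X e)"
  using assms by (cases e; simp add: oedge_image_Fwd oedge_image_Bwd del: oedge_image.simps)+

lemma class_oedge_image_Fwd:
  assumes "a \<in> edges X"
  shows "path_class Y (oedge_image X Y \<phi> (Fwd a)) = edge_arrow a"
  using assms
  by (simp add: oedge_image_Fwd ecls_def gcls_def Y.epath_eq del: oedge_image.simps)

lemma class_oedge_image_Bwd:
  assumes "a \<in> edges X"
  shows "path_class Y (oedge_image X Y \<phi> (Bwd a)) = ainv Y (edge_arrow a)"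
  using assms
  by (simp add: Y.gcls_inv Y.ainv_ecls del: oedge_image.simps)
    (simp add: oedge_image_Bwd gcls_def del: oedge_image.simps)

lemma path_image_valid [simp]:
  assumes "is_xpath X p"
  shows "is_xpath Y (path_image X Y \<phi> p)" "xini (path_image X Y \<phi> p) = vmap \<phi> (xini p)"
    "xter Y (path_image X Y \<phi> p) = vmap \<phi> (xter X p)"
proof -
  have "is_xpath Y (path_image X Y \<phi> p) \<and> xini (path_image X Y \<phi> p) = vmap \<phi> (xini p)
    \<and> xter Y (path_image X Y \<phi> p) = vmap \<phi> (xter X p)" using assms
    by (induct rule: X.is_xpath_induct) simp_all
  then show "is_xpath Y (path_image X Y \<phi> p)" "xini (path_image X Y \<phi> p) = vmap \<phi> (xini p)"
    "xter Y (path_image X Y \<phi> p) = vmap \<phi> (xter X p)" by auto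
qed

lemma class_path_image_xcons:
  assumes "e \<in> oedges X" "g \<in> carrier (grp X (oini X e))" "is_xpath X p" "xini p = oter X e"
  shows "path_class Y (path_image X Y \<phi> (xcons X g e p))
    = gcls Y (vmap \<phi> (oini X e)) (gmap \<phi> (oini X e) g) \<cdot>\<^sub>Y
        (path_class Y (oedge_image X Y \<phi> e) \<cdot>\<^sub>Y path_class Y (path_image X Y \<phi> p))"
  using assms by (simp add: gcls_def del: oedge_image.simps)

lemma act_eq_path_image:
  assumes "is_xpath X p" "z \<in> arrows Y" "tgt Y z = vmap \<phi> (xini p)"
  shows "T.act p z = z \<cdot>\<^sub>Y path_class Y (path_image X Y \<phi> p)"
  using assms
proof (induct arbitrary: z rule: X.is_xpath_induct)
  case (gpath \<sigma> g)
  then show ?case by (simp flip: gcls_def)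
next
  case (xcons g e q)
  have ao: "T.ao e z = z \<cdot>\<^sub>Y path_class Y (oedge_image X Y \<phi> e)"
    if "z \<in> arrows Y" "tgt Y z = vmap \<phi> (oini X e)" for z
  proof (cases e)
    case (Fwd a)
    then show ?thesis using that xcons by (simp add: class_oedge_image_Fwd del: oedge_image.simps)
  next
    case (Bwd a)
    have a: "a \<in> edges X" using xcons Bwd by simp
    let ?z = "z \<cdot>\<^sub>Y ainv Y (edge_arrow a)"
    \<comment> \<open>Writing \<open>z\<close> as \<open>?z\<close> followed by the edge arrow
      exhibits it as a value of the edge bijection, whose inverse can then be evaluated.\<close>
    have "T.ao e z = T.ao e (?z \<cdot>\<^sub>Y edge_arrow a)"
      using that a Bwd by (simp add: Y.gcls_inv Y.ainv_left)
    also have "\<dots> = ?z"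
      using T.inv_ae_ae[OF a, of ?z] that Bwd a by simp
    finally show ?thesis using Bwd a by (simp add: class_oedge_image_Bwd del: oedge_image.simps)
  qed
  show ?case
    using xcons by (simp add: ao class_path_image_xcons del: path_image_xcons oedge_image.simps)
qed

lemma path_image_homotopic:
  assumes "path_homotopic X p q" "is_xpath X p"
  shows "path_class Y (path_image X Y \<phi> p) = path_class Y (path_image X Y \<phi> q)"
proof -
  have q: "is_xpath X q" "xini q = xini p" using X.path_homotopic_valid[OF assms(1)] assms(2) by auto
  show ?thesis
    using T.act_homotopic[OF assms(1), of "idcls Y (vmap \<phi> (xini p))"] assms(2) q
    by (simp add: act_eq_path_image)
qed

lemma induced_path_class:
  assumes "is_xpath X p"
  shows "induced_hom X Y \<phi> (path_class X p) = path_class Y (path_image X Y \<phi> p)"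
proof -
  have "path_class Y (path_image X Y \<phi> q) = path_class Y (path_image X Y \<phi> p)"
    if "q \<in> path_class X p" for q
    using path_image_homotopic[of p q] that assms by (simp add: path_class_def)
  then have "induced_hom X Y \<phi> (path_class X p) = (\<Union>q\<in>path_class X p. path_class Y (path_image X Y \<phi> p))"
    unfolding induced_hom_def by (intro SUP_cong refl)
  moreover have "p \<in> path_class X p" by (simp add: path_class_def)
  ultimately show ?thesis by auto
qed

abbreviation ind :: "('v, 'e, 'g) xpath set \<Rightarrow> ('w, 'd, 'h) xpath set" where
  "ind \<equiv> induced_hom X Y \<phi>"

lemma ind_typing [simp]:
  assumes "c \<in> arrows X"
  shows "ind c \<in> arrows Y" "src (ind c) = vmap \<phi> (src c)" "tgt Y (ind c) = vmap \<phi> (tgt X c)"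
  using assms by (auto elim!: X.arrowE simp: induced_path_class)

lemma ind_gcls [simp]:
  "\<sigma> \<in> verts X \<Longrightarrow> g \<in> carrier (grp X \<sigma>) \<Longrightarrow> ind (gcls X \<sigma> g) = gcls Y (vmap \<phi> \<sigma>) (gmap \<phi> \<sigma> g)"
  unfolding gcls_def by (simp add: induced_path_class)

lemma path_image_xconcat:
  assumes "is_xpath X p" "is_xpath X q" "xter X p = xini q"
  shows "path_image X Y \<phi> (xconcat X p q) = xconcat Y (path_image X Y \<phi> p) (path_image X Y \<phi> q)"
  using assms(1,3)
proof (induct rule: X.is_xpath_induct)
  case (gpath \<sigma> g)
  show ?case using assms(2)
  proof (cases rule: X.is_xpath_cases)
    case (2 h e r)
    then show ?thesis using gpath
      by (simp add: Y.xconcat_gpath_assoc del: oedge_image.simps)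
  qed (use gpath in simp)
next
  case (xcons g e r)
  then show ?case using assms(2) by (simp add: Y.xconcat_assoc del: oedge_image.simps)
qed

lemma ind_amult [simp]:
  assumes "c \<in> arrows X" "d \<in> arrows X" "tgt X c = src d"
  shows "ind (c \<cdot>\<^sub>X d) = ind c \<cdot>\<^sub>Y ind d"
  using assms by (auto elim!: X.arrowE simp: induced_path_class path_image_xconcat)

lemma ind_ainv [simp]:
  assumes "c \<in> arrows X" shows "ind (ainv X c) = ainv Y (ind c)"
proof -
  have "ind c \<cdot>\<^sub>Y ind (ainv X c) = ind (c \<cdot>\<^sub>X ainv X c)"
    by (rule ind_amult[symmetric]) (use assms in simp_all)
  also have "\<dots> = idcls Y (src (ind c))" unfolding X.ainv_right[OF assms] using assms by simp
  finally show ?thesis using assms by (intro Y.ainv_unique[symmetric]) simp_all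
qed

lemma ind_ecls [simp]:
  assumes "a \<in> edges X"
  shows "ind (ecls X a) = edge_arrow a"
  using assms
  by (simp add: ecls_def[of X] induced_path_class X.epath_eq class_path_image_xcons
      class_oedge_image_Fwd Y.amult_id_right[unfolded gcls_def] gcls_def[symmetric] del: path_image_xcons oedge_image.simps)

end

section \<open>Lifting along a covering\<close>

lemma (in complex_of_groups) gcls_ainv_ecls:
  assumes "a \<in> edges X" "m \<in> carrier (grp X (ini X a))"
  shows "gcls X (ter X a) (psi X a m) \<cdot>\<^sub>X ainv X (ecls X a)
    = ainv X (ecls X a) \<cdot>\<^sub>X gcls X (ini X a) m"
proof -
  have "gcls X (ter X a) (psi X a m) = ainv X (ecls X a) \<cdot>\<^sub>X (gcls X (ini X a) m \<cdot>\<^sub>X ecls X a)"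
    unfolding gcls_ecls[OF assms] using assms by simp
  then show ?thesis using assms by simp
qed

text \<open>Outgoing edges are determined by their images because scwol morphisms are bijective on
  the edges starting at a vertex. For incoming edges only the coset condition of a covering is
  available.\<close>

lemma (in cog_morphism) emap_inj:
  assumes "a \<in> edges X" "b \<in> edges X" "ini X a = ini X b" "emap \<phi> a = emap \<phi> b"
  shows "a = b"
  using emap_bij[of "ini X a"] assms by (auto simp: bij_betw_def inj_on_def)

lemma (in cog_morphism) ex_edge_lift:
  assumes "\<sigma> \<in> verts X" "a' \<in> edges Y" "ini Y a' = vmap \<phi> \<sigma>"
  shows "\<exists>a. a \<in> edges X \<and> ini X a = \<sigma> \<and> emap \<phi> a = a'"
proof -
  have "a' \<in> emap \<phi> ` {a \<in> edges X. ini X a = \<sigma>}"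
    using emap_bij[OF assms(1)] assms by (simp add: bij_betw_def)
  then show ?thesis by auto
qed

lemma (in group) l_coset_subgroup_eq:
  assumes "subgroup H G" "x \<in> carrier G" "h \<in> H"
  shows "(x \<otimes> h) <# H = x <# H"
proof -
  have "h <# H = H" using assms lcos_m_assoc subgroup.mem_carrier
    by (metis coset_join3)
  then show ?thesis using assms
    by (metis lcos_m_assoc subgroup.mem_carrier subgroup.subset)
qed

context covering
begin

section \<open>The covering condition in terms of elements\<close>

lemma psi_image_subgroup:
  "a \<in> edges Y \<Longrightarrow> subgroup (psi Y a ` carrier (grp Y (ini Y a))) (grp Y (ter Y a))"
  using group_hom.img_is_subgroup[OF Y.psi_group_hom] by simp

lemma telt_psi:
  assumes a: "a \<in> edges X" and m: "m \<in> carrier (grp X (ini X a))"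
  shows "gmap \<phi> (ter X a) (psi X a m) \<otimes>\<^bsub>grp Y (vmap \<phi> (ter X a))\<^esub> telt \<phi> a
    = telt \<phi> a \<otimes>\<^bsub>grp Y (vmap \<phi> (ter X a))\<^esub> psi Y (emap \<phi> a) (gmap \<phi> (ini X a) m)"
  using a m Y.psi_closed[of "emap \<phi> a" "gmap \<phi> (ini X a) m"]
  by (simp add: conj_by_def Y.grp_assoc flip: telt_conj)

text \<open>By \<open>telt_psi\<close> a factor from the image of \<open>psi X a\<close> passes the
  element of the edge and becomes a factor from the image of \<open>psi Y\<close>, which the target
  coset absorbs. All members of the union therefore coincide.\<close>

lemma covering_map_l_coset:
  assumes a: "a \<in> edges X" "ter X a = \<sigma>" and g: "g \<in> carrier (grp X \<sigma>)"
  shows "covering_map X Y \<phi> \<sigma> (emap \<phi> a) (a, g <#\<^bsub>grp X \<sigma>\<^esub> (psi X a ` carrier (grp X (ini X a))))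
    = (gmap \<phi> \<sigma> g \<otimes>\<^bsub>grp Y (vmap \<phi> \<sigma>)\<^esub> telt \<phi> a)
       <#\<^bsub>grp Y (vmap \<phi> \<sigma>)\<^esub> (psi Y (emap \<phi> a) ` carrier (grp Y (ini Y (emap \<phi> a))))"
    (is "_ = ?R")
proof -
  interpret H: group "grp Y (vmap \<phi> \<sigma>)" using a by (auto intro: Y.grp_group)
  have \<sigma>: "\<sigma> \<in> verts X" using a by auto
  have "(gmap \<phi> \<sigma> x \<otimes>\<^bsub>grp Y (vmap \<phi> \<sigma>)\<^esub> telt \<phi> a)
       <#\<^bsub>grp Y (vmap \<phi> \<sigma>)\<^esub> (psi Y (emap \<phi> a) ` carrier (grp Y (ini Y (emap \<phi> a)))) = ?R"
    if x: "x \<in> g <#\<^bsub>grp X \<sigma>\<^esub> (psi X a ` carrier (grp X (ini X a)))" for x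
  proof -
    obtain m where m: "m \<in> carrier (grp X (ini X a))" "x = g \<otimes>\<^bsub>grp X \<sigma>\<^esub> psi X a m"
      using x by (auto simp: l_coset_def)
    have pm: "psi X a m \<in> carrier (grp X \<sigma>)" using a m by auto
    have pm': "psi Y (emap \<phi> a) (gmap \<phi> (ini X a) m) \<in> carrier (grp Y (vmap \<phi> \<sigma>))"
      using a m Y.psi_closed[of "emap \<phi> a" "gmap \<phi> (ini X a) m"] by simp
    have ta: "telt \<phi> a \<in> carrier (grp Y (vmap \<phi> \<sigma>))" using a by auto
    have "gmap \<phi> \<sigma> x \<otimes>\<^bsub>grp Y (vmap \<phi> \<sigma>)\<^esub> telt \<phi> a
      = (gmap \<phi> \<sigma> g \<otimes>\<^bsub>grp Y (vmap \<phi> \<sigma>)\<^esub> telt \<phi> a) \<otimes>\<^bsub>grp Y (vmap \<phi> \<sigma>)\<^esub> psi Y (emap \<phi> a) (gmap \<phi> (ini X a) m)"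
      using telt_psi[OF a(1) m(1)] a(2) g \<sigma> m(2) pm pm' ta by (simp add: H.m_assoc)
    then show ?thesis
      using a m g ta \<sigma> psi_image_subgroup[of "emap \<phi> a"]
      by (simp add: H.l_coset_subgroup_eq)
  qed
  then have "covering_map X Y \<phi> \<sigma> (emap \<phi> a) (a, g <#\<^bsub>grp X \<sigma>\<^esub> (psi X a ` carrier (grp X (ini X a))))
      = (\<Union>x\<in>g <#\<^bsub>grp X \<sigma>\<^esub> (psi X a ` carrier (grp X (ini X a))). ?R)"
    unfolding covering_map_def prod.case by (intro SUP_cong refl)
  moreover have "psi X a \<one>\<^bsub>grp X (ini X a)\<^esub> \<in> psi X a ` carrier (grp X (ini X a))"
    by (rule imageI) (simp add: a(1))
  then have "g <#\<^bsub>grp X \<sigma>\<^esub> (psi X a ` carrier (grp X (ini X a))) \<noteq> {}"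
    unfolding l_coset_def by blast
  ultimately show ?thesis by (simp only: UN_constant if_False)
qed

lemma covering_surj:
  assumes "\<sigma> \<in> verts X" "a' \<in> edges Y" "ter Y a' = vmap \<phi> \<sigma>" "k \<in> carrier (grp Y (vmap \<phi> \<sigma>))"
  obtains a h m where "a \<in> edges X" "emap \<phi> a = a'" "ter X a = \<sigma>" "h \<in> carrier (grp X \<sigma>)"
    "m \<in> carrier (grp Y (ini Y a'))"
    "k = (gmap \<phi> \<sigma> h \<otimes>\<^bsub>grp Y (vmap \<phi> \<sigma>)\<^esub> telt \<phi> a) \<otimes>\<^bsub>grp Y (vmap \<phi> \<sigma>)\<^esub> psi Y a' m"
proof -
  let ?H = "psi Y a' ` carrier (grp Y (ini Y a'))" and ?G = "grp Y (vmap \<phi> \<sigma>)"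
  have "k <#\<^bsub>?G\<^esub> ?H \<in> lcosets\<^bsub>?G\<^esub> ?H" using assms by (auto simp: LCOSETS_def)
  then have "k <#\<^bsub>?G\<^esub> ?H \<in> covering_map X Y \<phi> \<sigma> a' ` (SIGMA a : {a \<in> edges X. emap \<phi> a = a' \<and> ter X a = \<sigma>}.
           lcosets\<^bsub>grp X \<sigma>\<^esub> (psi X a ` carrier (grp X (ini X a))))"
    using covering_bij[OF assms(1-3)] by (simp add: bij_betw_def)
  then obtain a h where a: "a \<in> edges X" "emap \<phi> a = a'" "ter X a = \<sigma>" and h: "h \<in> carrier (grp X \<sigma>)"
    and eq: "k <#\<^bsub>?G\<^esub> ?H = covering_map X Y \<phi> \<sigma> a' (a, h <#\<^bsub>grp X \<sigma>\<^esub> (psi X a ` carrier (grp X (ini X a))))"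
    by (auto simp: LCOSETS_def)
  have "psi Y a' \<one>\<^bsub>grp Y (ini Y a')\<^esub> \<in> ?H"
    by (rule imageI) (simp add: assms(2))
  then have "\<one>\<^bsub>?G\<^esub> \<in> ?H" using assms(2,3) by simp
  then have "k \<otimes>\<^bsub>?G\<^esub> \<one>\<^bsub>?G\<^esub> \<in> k <#\<^bsub>?G\<^esub> ?H" unfolding l_coset_def by blast
  then have "k \<in> (gmap \<phi> \<sigma> h \<otimes>\<^bsub>?G\<^esub> telt \<phi> a) <#\<^bsub>?G\<^esub> ?H"
    using eq covering_map_l_coset[OF a(1,3) h] a assms by simp
  then show ?thesis using that a h unfolding l_coset_def by blast
qed

text \<open>The right factors \<open>m\<close> and \<open>m'\<close> vanish in the cosets, so the
  equation says that the coset of \<open>h\<close> at \<open>a\<close> and the trivial coset at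
  \<open>b\<close> have the same image. Injectivity on the disjoint union identifies the edges as
  well as the cosets.\<close>

lemma covering_inj:
  assumes ab: "a \<in> edges X" "b \<in> edges X" "ter X a = ter X b" "emap \<phi> a = emap \<phi> b"
    and h: "h \<in> carrier (grp X (ter X a))" and m: "m \<in> carrier (grp Y (vmap \<phi> (ini X a)))"
    and m': "m' \<in> carrier (grp Y (vmap \<phi> (ini X a)))"
    and eq: "(gmap \<phi> (ter X a) h \<otimes>\<^bsub>grp Y (vmap \<phi> (ter X a))\<^esub> telt \<phi> a)
        \<otimes>\<^bsub>grp Y (vmap \<phi> (ter X a))\<^esub> psi Y (emap \<phi> a) m
      = telt \<phi> b \<otimes>\<^bsub>grp Y (vmap \<phi> (ter X a))\<^esub> psi Y (emap \<phi> a) m'"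
  obtains n where "a = b" "n \<in> carrier (grp X (ini X a))" "h = psi X a n"
proof -
  let ?\<sigma> = "ter X a" and ?a' = "emap \<phi> a"
  let ?G = "grp Y (vmap \<phi> ?\<sigma>)" and ?H = "psi Y ?a' ` carrier (grp Y (ini Y ?a'))"
  interpret G: group ?G using ab by (auto intro: Y.grp_group)
  let ?HX = "\<lambda>a. psi X a ` carrier (grp X (ini X a))"
  have \<sigma>: "?\<sigma> \<in> verts X" using ab by auto
  have sub: "subgroup ?H ?G" using psi_image_subgroup[of ?a'] ab(1) by simp
  have tb: "telt \<phi> b \<in> carrier ?G" using telt_closed[OF ab(2)] ab by simp
  have mm: "psi Y ?a' m \<in> ?H" "psi Y ?a' m' \<in> ?H" using m m' ab(1) by simp_all
  have "covering_map X Y \<phi> ?\<sigma> ?a' (a, h <#\<^bsub>grp X ?\<sigma>\<^esub> ?HX a)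
      = (gmap \<phi> ?\<sigma> h \<otimes>\<^bsub>?G\<^esub> telt \<phi> a) <#\<^bsub>?G\<^esub> ?H"
    using covering_map_l_coset[OF ab(1) refl h] .
  also have "\<dots> = ((gmap \<phi> ?\<sigma> h \<otimes>\<^bsub>?G\<^esub> telt \<phi> a) \<otimes>\<^bsub>?G\<^esub> psi Y ?a' m) <#\<^bsub>?G\<^esub> ?H"
    using G.l_coset_subgroup_eq[OF sub _ mm(1)] ab(1) h \<sigma> by simp
  also have "\<dots> = telt \<phi> b <#\<^bsub>?G\<^esub> ?H"
    unfolding eq using G.l_coset_subgroup_eq[OF sub _ mm(2)] tb by simp
  also have "\<dots> = covering_map X Y \<phi> ?\<sigma> ?a' (b, \<one>\<^bsub>grp X ?\<sigma>\<^esub> <#\<^bsub>grp X ?\<sigma>\<^esub> ?HX b)"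
    using covering_map_l_coset[OF ab(2) ab(3)[symmetric], of "\<one>\<^bsub>grp X ?\<sigma>\<^esub>"] \<sigma> ab(4) tb by simp
  finally have eq': "covering_map X Y \<phi> ?\<sigma> ?a' (a, h <#\<^bsub>grp X ?\<sigma>\<^esub> ?HX a)
    = covering_map X Y \<phi> ?\<sigma> ?a' (b, \<one>\<^bsub>grp X ?\<sigma>\<^esub> <#\<^bsub>grp X ?\<sigma>\<^esub> ?HX b)" .
  have inj: "inj_on (covering_map X Y \<phi> ?\<sigma> ?a') (SIGMA c : {c \<in> edges X. emap \<phi> c = ?a' \<and> ter X c = ?\<sigma>}.
           lcosets\<^bsub>grp X ?\<sigma>\<^esub> (?HX c))"
    using covering_bij[OF \<sigma>, of ?a'] ab by (simp add: bij_betw_def)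
  have mem: "h <#\<^bsub>grp X ?\<sigma>\<^esub> ?HX a \<in> lcosets\<^bsub>grp X ?\<sigma>\<^esub> (?HX a)"
    "\<one>\<^bsub>grp X ?\<sigma>\<^esub> <#\<^bsub>grp X ?\<sigma>\<^esub> ?HX b \<in> lcosets\<^bsub>grp X ?\<sigma>\<^esub> (?HX b)"
    using h X.grp_one_closed[OF \<sigma>] unfolding LCOSETS_def by blast+
  have "(a, h <#\<^bsub>grp X ?\<sigma>\<^esub> ?HX a) = (b, \<one>\<^bsub>grp X ?\<sigma>\<^esub> <#\<^bsub>grp X ?\<sigma>\<^esub> ?HX b)"
    using inj eq' by (rule inj_onD) (simp_all add: mem ab(1,2) ab(3,4)[symmetric])
  then have *: "a = b" "h <#\<^bsub>grp X ?\<sigma>\<^esub> ?HX a = \<one>\<^bsub>grp X ?\<sigma>\<^esub> <#\<^bsub>grp X ?\<sigma>\<^esub> ?HX b"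
    unfolding prod.inject by blast+
  have "psi X a \<one>\<^bsub>grp X (ini X a)\<^esub> \<in> ?HX a"
    by (rule imageI) (simp add: ab(1))
  then have "h \<otimes>\<^bsub>grp X ?\<sigma>\<^esub> psi X a \<one>\<^bsub>grp X (ini X a)\<^esub> \<in> h <#\<^bsub>grp X ?\<sigma>\<^esub> ?HX a"
    unfolding l_coset_def by blast
  then have "h \<in> \<one>\<^bsub>grp X ?\<sigma>\<^esub> <#\<^bsub>grp X ?\<sigma>\<^esub> ?HX a" using * ab h \<sigma> by simp
  then obtain n where "n \<in> carrier (grp X (ini X a))" "h = \<one>\<^bsub>grp X ?\<sigma>\<^esub> \<otimes>\<^bsub>grp X ?\<sigma>\<^esub> psi X a n"
    unfolding l_coset_def by blast
  then show ?thesis using that * ab \<sigma> by simp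
qed

text \<open>The leading factor \<open>k\<close> makes the induction work: lifting one edge leaves an
  error in the local group at its end, which must be passed on to the rest of the arrow. At the end
  the accumulated error becomes \<open>g\<close>.\<close>

lemma arrow_lift_translate:
  assumes "y \<in> arrows Y" "\<sigma> \<in> verts X" "src y = vmap \<phi> \<sigma>" "k \<in> carrier (grp Y (vmap \<phi> \<sigma>))"
  shows "\<exists>x g. x \<in> arrows X \<and> src x = \<sigma> \<and> vmap \<phi> (tgt X x) = tgt Y y \<and> g \<in> carrier (grp Y (tgt Y y))
    \<and> gcls Y (vmap \<phi> \<sigma>) k \<cdot>\<^sub>Y y = ind x \<cdot>\<^sub>Y gcls Y (tgt Y y) g"
  using assms
proof (induct arbitrary: \<sigma> k rule: Y.arrow_induct)
  case (gcls \<tau> g)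
  then show ?case
    by (intro exI[of _ "idcls X \<sigma>"] exI[of _ "k \<otimes>\<^bsub>grp Y \<tau>\<^esub> g"]) (simp add: Y.gcls_mult)
next
  case (fwd g a' c)
  then have ini: "ini Y a' = vmap \<phi> \<sigma>" by simp
  obtain a where a: "a \<in> edges X" "ini X a = \<sigma>" "emap \<phi> a = a'"
    using ex_edge_lift[OF fwd(6,1) ini] by auto
  let ?\<rho> = "ter X a" and ?k = "k \<otimes>\<^bsub>grp Y (vmap \<phi> \<sigma>)\<^esub> g"
  have t: "ter Y a' = vmap \<phi> ?\<rho>" using a ter_emap[of a] by simp
  have k: "?k \<in> carrier (grp Y (ini Y a'))" using fwd ini by simp
  have pk: "psi Y a' ?k \<in> carrier (grp Y (vmap \<phi> ?\<rho>))" using Y.psi_closed[OF fwd(1) k] t by simp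
  \<comment> \<open>The error after a forward edge: \<open>?k\<close> slides across as its image
    under \<open>psi Y a'\<close>, and \<open>telt \<phi> a\<close> compensates the inverse in the
    image of the lifted edge.\<close>
  let ?u = "telt \<phi> a \<otimes>\<^bsub>grp Y (vmap \<phi> ?\<rho>)\<^esub> psi Y a' ?k"
  have u: "?u \<in> carrier (grp Y (vmap \<phi> ?\<rho>))" using a pk by simp
  obtain x g' where x: "x \<in> arrows X" "src x = ?\<rho>" "vmap \<phi> (tgt X x) = tgt Y c" "g' \<in> carrier (grp Y (tgt Y c))"
    and xe: "gcls Y (vmap \<phi> ?\<rho>) ?u \<cdot>\<^sub>Y c = ind x \<cdot>\<^sub>Y gcls Y (tgt Y c) g'"
    using fwd(5)[of ?\<rho> ?u] fwd(4) a t u by auto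
  have "gcls Y (vmap \<phi> \<sigma>) k \<cdot>\<^sub>Y (gcls Y (ini Y a') g \<cdot>\<^sub>Y (ecls Y a' \<cdot>\<^sub>Y c))
      = (gcls Y (ini Y a') ?k \<cdot>\<^sub>Y ecls Y a') \<cdot>\<^sub>Y c"
    using fwd ini k by (simp add: Y.gcls_mult)
  also have "\<dots> = (ecls Y a' \<cdot>\<^sub>Y gcls Y (ter Y a') (psi Y a' ?k)) \<cdot>\<^sub>Y c"
    unfolding Y.gcls_ecls[OF fwd(1) k] ..
  also have "\<dots> = ind (ecls X a) \<cdot>\<^sub>Y (gcls Y (vmap \<phi> ?\<rho>) ?u \<cdot>\<^sub>Y c)"
    using a fwd pk t by (simp add: Y.gcls_mult Y.gcls_inv)
  also have "\<dots> = ind (ecls X a \<cdot>\<^sub>X x) \<cdot>\<^sub>Y gcls Y (tgt Y c) g'"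
    unfolding xe using x a fwd t by simp
  finally show ?case using x a fwd ini
    by (intro exI[of _ "ecls X a \<cdot>\<^sub>X x"] exI[of _ g']) simp
next
  case (bwd g a' c)
  then have ter: "ter Y a' = vmap \<phi> \<sigma>" by simp
  let ?k = "k \<otimes>\<^bsub>grp Y (vmap \<phi> \<sigma>)\<^esub> g" and ?G = "grp Y (vmap \<phi> \<sigma>)"
  have k: "?k \<in> carrier ?G" using bwd ter by simp
  \<comment> \<open>Going back along \<open>a'\<close>, the lift of the edge is not prescribed by
    its start. The decomposition of \<open>?k\<close> selects it: \<open>h\<close> and the element
    of \<open>a\<close> belong to the lifted part, and \<open>m\<close> passes the inverse edge to
    become the next error.\<close>
  obtain a h m where a: "a \<in> edges X" "emap \<phi> a = a'" "ter X a = \<sigma>" and h: "h \<in> carrier (grp X \<sigma>)"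
    and m: "m \<in> carrier (grp Y (ini Y a'))"
    and ke: "?k = (gmap \<phi> \<sigma> h \<otimes>\<^bsub>?G\<^esub> telt \<phi> a) \<otimes>\<^bsub>?G\<^esub> psi Y a' m"
    using covering_surj[OF bwd(6,1) ter k] by blast
  let ?\<rho> = "ini X a"
  have i: "ini Y a' = vmap \<phi> ?\<rho>" using a ini_emap[of a] by simp
  have pm: "psi Y a' m \<in> carrier ?G" using Y.psi_closed[OF bwd(1) m] ter by simp
  have ta: "telt \<phi> a \<in> carrier ?G" using telt_closed[OF a(1)] a by simp
  obtain x g' where x: "x \<in> arrows X" "src x = ?\<rho>" "vmap \<phi> (tgt X x) = tgt Y c" "g' \<in> carrier (grp Y (tgt Y c))"
    and xe: "gcls Y (vmap \<phi> ?\<rho>) m \<cdot>\<^sub>Y c = ind x \<cdot>\<^sub>Y gcls Y (tgt Y c) g'"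
    using bwd(5)[of ?\<rho> m] bwd(4) a i m by auto
  have sl: "gcls Y (vmap \<phi> \<sigma>) (psi Y a' m) \<cdot>\<^sub>Y ainv Y (ecls Y a') = ainv Y (ecls Y a') \<cdot>\<^sub>Y gcls Y (ini Y a') m"
    using Y.gcls_ainv_ecls[OF bwd(1) m] ter by simp
  let ?x = "gcls X \<sigma> h \<cdot>\<^sub>X (ainv X (ecls X a) \<cdot>\<^sub>X x)"
  have "gcls Y (vmap \<phi> \<sigma>) k \<cdot>\<^sub>Y (gcls Y (ter Y a') g \<cdot>\<^sub>Y (ainv Y (ecls Y a') \<cdot>\<^sub>Y c))
      = gcls Y (vmap \<phi> \<sigma>) ?k \<cdot>\<^sub>Y (ainv Y (ecls Y a') \<cdot>\<^sub>Y c)"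
    using bwd ter k by (simp add: Y.gcls_mult)
  also have "\<dots> = gcls Y (vmap \<phi> \<sigma>) (gmap \<phi> \<sigma> h) \<cdot>\<^sub>Y (gcls Y (vmap \<phi> \<sigma>) (telt \<phi> a) \<cdot>\<^sub>Y
      ((gcls Y (vmap \<phi> \<sigma>) (psi Y a' m) \<cdot>\<^sub>Y ainv Y (ecls Y a')) \<cdot>\<^sub>Y c))"
    unfolding ke using bwd ter h pm ta by (simp add: Y.gcls_mult)
  also have "\<dots> = ind (gcls X \<sigma> h \<cdot>\<^sub>X ainv X (ecls X a)) \<cdot>\<^sub>Y (gcls Y (vmap \<phi> ?\<rho>) m \<cdot>\<^sub>Y c)"
    unfolding sl using bwd ter h ta a m i by (simp add: Y.gcls_inv)
  also have "\<dots> = ind ?x \<cdot>\<^sub>Y gcls Y (tgt Y c) g'"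
    unfolding xe using x a h ta i bwd by simp
  finally show ?case using x a h bwd ter
    by (intro exI[of _ ?x] exI[of _ g']) simp
qed

lemma ex_arrow_lift:
  assumes "y \<in> arrows Y" "\<sigma> \<in> verts X" "src y = vmap \<phi> \<sigma>"
  obtains x g where "x \<in> arrows X" "src x = \<sigma>" "vmap \<phi> (tgt X x) = tgt Y y"
    "g \<in> carrier (grp Y (tgt Y y))" "y = ind x \<cdot>\<^sub>Y gcls Y (tgt Y y) g"
proof -
  have "idcls Y (vmap \<phi> \<sigma>) \<cdot>\<^sub>Y y = y" using assms by simp
  then show ?thesis
    using arrow_lift_translate[OF assms, of "\<one>\<^bsub>grp Y (vmap \<phi> \<sigma>)\<^esub>"] assms that by auto
qed

text \<open>The fundamental groupoid of \<open>Y\<close> acts on the pairs \<open>(x, g)\<close>, where \<open>x\<close> is an arrow of \<open>X\<close> with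
  a fixed source and \<open>g\<close> is in the local group over its target, modulo \<open>(x h, g) = (x, \<phi>(h) g)\<close>.
  The covering condition is exactly what makes each edge act bijectively.\<close>

definition fibre_point :: "('v, 'e, 'g) xpath set \<Rightarrow> 'h \<Rightarrow> (('v, 'e, 'g) xpath set \<times> 'h) set" where
  "fibre_point x g = (\<lambda>h. (x \<cdot>\<^sub>X gcls X (tgt X x) h,
     inv\<^bsub>grp Y (vmap \<phi> (tgt X x))\<^esub> (gmap \<phi> (tgt X x) h) \<otimes>\<^bsub>grp Y (vmap \<phi> (tgt X x))\<^esub> g))
     ` carrier (grp X (tgt X x))"

definition fibre :: "'v \<Rightarrow> 'w \<Rightarrow> (('v, 'e, 'g) xpath set \<times> 'h) set set" where
  "fibre \<sigma>\<^sub>0 \<tau> = {fibre_point x g | x g. x \<in> arrows X \<and> src x = \<sigma>\<^sub>0 \<and> vmap \<phi> (tgt X x) = \<tau> \<and>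
     g \<in> carrier (grp Y \<tau>)}"

definition edge_lift :: "'v \<Rightarrow> 'd \<Rightarrow> 'e" where
  "edge_lift \<sigma> a' = (SOME a. a \<in> edges X \<and> ini X a = \<sigma> \<and> emap \<phi> a = a')"

definition fibre_grp :: "'w \<Rightarrow> 'h \<Rightarrow> (('v, 'e, 'g) xpath set \<times> 'h) set
    \<Rightarrow> (('v, 'e, 'g) xpath set \<times> 'h) set" where
  "fibre_grp \<tau> k S = (\<lambda>(x, g). (x, g \<otimes>\<^bsub>grp Y \<tau>\<^esub> k)) ` S"

text \<open>The pair \<open>(x, g)\<close> stands for the image of \<open>x\<close> followed by
  \<open>g\<close>. After the edge \<open>a'\<close> this is the image of \<open>x\<close> extended
  by the lifted edge, followed by the new second component: \<open>g\<close> has crossed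
  \<open>a'\<close>, and the element of the lifted edge undoes the inverse in its image.\<close>

definition fibre_edge :: "'d \<Rightarrow> (('v, 'e, 'g) xpath set \<times> 'h) set
    \<Rightarrow> (('v, 'e, 'g) xpath set \<times> 'h) set" where
  "fibre_edge a' S = (\<Union>(x, g)\<in>S. fibre_point (x \<cdot>\<^sub>X ecls X (edge_lift (tgt X x) a'))
     (telt \<phi> (edge_lift (tgt X x) a') \<otimes>\<^bsub>grp Y (ter Y a')\<^esub> psi Y a' g))"

lemma edge_lift_props [simp]:
  assumes "\<sigma> \<in> verts X" "a' \<in> edges Y" "ini Y a' = vmap \<phi> \<sigma>"
  shows "edge_lift \<sigma> a' \<in> edges X" "ini X (edge_lift \<sigma> a') = \<sigma>" "emap \<phi> (edge_lift \<sigma> a') = a'"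
    and vmap_ter_edge_lift: "vmap \<phi> (ter X (edge_lift \<sigma> a')) = ter Y a'"
proof -
  note * = someI_ex[OF ex_edge_lift[OF assms], folded edge_lift_def]
  then show "edge_lift \<sigma> a' \<in> edges X" "ini X (edge_lift \<sigma> a') = \<sigma>" "emap \<phi> (edge_lift \<sigma> a') = a'"
    by auto
  then show "vmap \<phi> (ter X (edge_lift \<sigma> a')) = ter Y a'"
    using ter_emap[of "edge_lift \<sigma> a'"] by simp
qed

lemma edge_lift_emap [simp]: "a \<in> edges X \<Longrightarrow> edge_lift (ini X a) (emap \<phi> a) = a"
  by (rule emap_inj) simp_all

lemma fibre_point_subset:
  assumes "x \<in> arrows X" "h \<in> carrier (grp X (tgt X x))" "g \<in> carrier (grp Y (vmap \<phi> (tgt X x)))"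
  shows "fibre_point (x \<cdot>\<^sub>X gcls X (tgt X x) h)
     (inv\<^bsub>grp Y (vmap \<phi> (tgt X x))\<^esub> (gmap \<phi> (tgt X x) h) \<otimes>\<^bsub>grp Y (vmap \<phi> (tgt X x))\<^esub> g)
     \<subseteq> fibre_point x g"
proof -
  interpret G: group "grp Y (vmap \<phi> (tgt X x))" using assms by (simp add: Y.grp_group)
  have "(x \<cdot>\<^sub>X gcls X (tgt X x) h) \<cdot>\<^sub>X gcls X (tgt X x) k
      = x \<cdot>\<^sub>X gcls X (tgt X x) (h \<otimes>\<^bsub>grp X (tgt X x)\<^esub> k)"
    "inv\<^bsub>grp Y (vmap \<phi> (tgt X x))\<^esub> (gmap \<phi> (tgt X x) k) \<otimes>\<^bsub>grp Y (vmap \<phi> (tgt X x))\<^esub>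
      (inv\<^bsub>grp Y (vmap \<phi> (tgt X x))\<^esub> (gmap \<phi> (tgt X x) h) \<otimes>\<^bsub>grp Y (vmap \<phi> (tgt X x))\<^esub> g)
      = inv\<^bsub>grp Y (vmap \<phi> (tgt X x))\<^esub> (gmap \<phi> (tgt X x) (h \<otimes>\<^bsub>grp X (tgt X x)\<^esub> k))
        \<otimes>\<^bsub>grp Y (vmap \<phi> (tgt X x))\<^esub> g"
    if "k \<in> carrier (grp X (tgt X x))" for k
    using that assms by (simp_all add: X.gcls_mult G.inv_mult_group G.m_assoc)
  then show ?thesis
    using assms unfolding fibre_point_def by auto
qed

text \<open>One inclusion is \<open>fibre_point_subset\<close> for \<open>h\<close>, the other is
  the same lemma for the inverse of \<open>h\<close>.\<close>

lemma fibre_point_shift: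
  assumes x: "x \<in> arrows X" and h: "h \<in> carrier (grp X (tgt X x))"
    and g: "g \<in> carrier (grp Y (vmap \<phi> (tgt X x)))"
  shows "fibre_point (x \<cdot>\<^sub>X gcls X (tgt X x) h) g
     = fibre_point x (gmap \<phi> (tgt X x) h \<otimes>\<^bsub>grp Y (vmap \<phi> (tgt X x))\<^esub> g)"
proof
  interpret G: group "grp Y (vmap \<phi> (tgt X x))" using assms by (simp add: Y.grp_group)
  let ?g = "gmap \<phi> (tgt X x) h \<otimes>\<^bsub>grp Y (vmap \<phi> (tgt X x))\<^esub> g" and ?x = "x \<cdot>\<^sub>X gcls X (tgt X x) h"
  show "fibre_point ?x g \<subseteq> fibre_point x ?g"
    using fibre_point_subset[OF x h, of ?g] x h g by (simp flip: G.m_assoc)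
  have "x = ?x \<cdot>\<^sub>X gcls X (tgt X ?x) (inv\<^bsub>grp X (tgt X x)\<^esub> h)"
    using x h by (simp add: X.gcls_inv_gcls)
  then show "fibre_point x ?g \<subseteq> fibre_point ?x g"
    using fibre_point_subset[of ?x "inv\<^bsub>grp X (tgt X x)\<^esub> h" g] x h g by simp
qed

lemma fibre_point_self:
  assumes "x \<in> arrows X" "g \<in> carrier (grp Y (vmap \<phi> (tgt X x)))"
  shows "(x, g) \<in> fibre_point x g"
  unfolding fibre_point_def
  using assms by (intro image_eqI[of _ _ "\<one>\<^bsub>grp X (tgt X x)\<^esub>"]) simp_all

lemma fibre_pointE:
  assumes "(y, k) \<in> fibre_point x g"
  obtains h where "h \<in> carrier (grp X (tgt X x))" "y = x \<cdot>\<^sub>X gcls X (tgt X x) h"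
    "k = inv\<^bsub>grp Y (vmap \<phi> (tgt X x))\<^esub> (gmap \<phi> (tgt X x) h) \<otimes>\<^bsub>grp Y (vmap \<phi> (tgt X x))\<^esub> g"
  using assms unfolding fibre_point_def by blast

lemma fibre_point_eqD:
  assumes "fibre_point x g = fibre_point y k" "x \<in> arrows X" "y \<in> arrows X"
    "g \<in> carrier (grp Y (vmap \<phi> (tgt X x)))" "k \<in> carrier (grp Y (vmap \<phi> (tgt X y)))"
  obtains h where "h \<in> carrier (grp X (tgt X x))" "y = x \<cdot>\<^sub>X gcls X (tgt X x) h"
    "g = gmap \<phi> (tgt X x) h \<otimes>\<^bsub>grp Y (vmap \<phi> (tgt X x))\<^esub> k"
proof -
  interpret G: group "grp Y (vmap \<phi> (tgt X x))" using assms by (simp add: Y.grp_group)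
  have "(y, k) \<in> fibre_point x g" using assms fibre_point_self by metis
  then obtain h where h: "h \<in> carrier (grp X (tgt X x))" "y = x \<cdot>\<^sub>X gcls X (tgt X x) h"
    and k: "k = inv\<^bsub>grp Y (vmap \<phi> (tgt X x))\<^esub> (gmap \<phi> (tgt X x) h) \<otimes>\<^bsub>grp Y (vmap \<phi> (tgt X x))\<^esub> g"
    by (rule fibre_pointE)
  have "g = gmap \<phi> (tgt X x) h \<otimes>\<^bsub>grp Y (vmap \<phi> (tgt X x))\<^esub> k"
    unfolding k using h assms(2,4) by (simp flip: G.m_assoc)
  then show ?thesis using that h by blast
qed

lemma fibre_grp_point:
  assumes "x \<in> arrows X" "vmap \<phi> (tgt X x) = \<tau>" "g \<in> carrier (grp Y \<tau>)" "k \<in> carrier (grp Y \<tau>)"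
  shows "fibre_grp \<tau> k (fibre_point x g) = fibre_point x (g \<otimes>\<^bsub>grp Y \<tau>\<^esub> k)"
proof -
  interpret G: group "grp Y \<tau>" using assms by (auto simp: Y.grp_group)
  show ?thesis unfolding fibre_grp_def fibre_point_def image_image prod.case
    using assms by (intro image_cong refl) (auto simp: Y.grp_assoc)
qed

text \<open>Representatives differ by some \<open>h\<close>. Across the edge it becomes
  \<open>psi X a h\<close> in the arrow, while its image slides in the group component;
  \<open>telt_psi\<close> shows that the two changes cancel modulo the relation defining the
  points.\<close>

lemma fibre_edge_point:
  assumes x: "x \<in> arrows X" "a \<in> edges X" "tgt X x = ini X a"
    and g: "g \<in> carrier (grp Y (vmap \<phi> (ini X a)))"
  shows "fibre_edge (emap \<phi> a) (fibre_point x g)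
    = fibre_point (x \<cdot>\<^sub>X ecls X a) (telt \<phi> a \<otimes>\<^bsub>grp Y (vmap \<phi> (ter X a))\<^esub> psi Y (emap \<phi> a) g)"
    (is "_ = ?R")
proof -
  let ?T = "grp Y (vmap \<phi> (ter X a))"
  interpret T: group ?T using assms by (simp add: Y.grp_group)
  have "fibre_point (y \<cdot>\<^sub>X ecls X (edge_lift (tgt X y) (emap \<phi> a)))
     (telt \<phi> (edge_lift (tgt X y) (emap \<phi> a)) \<otimes>\<^bsub>grp Y (ter Y (emap \<phi> a))\<^esub> psi Y (emap \<phi> a) k) = ?R"
    if yk: "(y, k) \<in> fibre_point x g" for y k
  proof -
    obtain h where h: "h \<in> carrier (grp X (ini X a))" and y: "y = x \<cdot>\<^sub>X gcls X (ini X a) h"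
      and k: "k = inv\<^bsub>grp Y (vmap \<phi> (ini X a))\<^esub> (gmap \<phi> (ini X a) h) \<otimes>\<^bsub>grp Y (vmap \<phi> (ini X a))\<^esub> g"
      using fibre_pointE[OF yk] unfolding x(3) by metis
    let ?p = "psi Y (emap \<phi> a) (gmap \<phi> (ini X a) h)" and ?q = "psi Y (emap \<phi> a) g"
    have p: "?p \<in> carrier ?T" and q: "?q \<in> carrier ?T"
      using Y.psi_closed[of "emap \<phi> a"] x h g by simp_all
    have ya: "y \<cdot>\<^sub>X ecls X a = (x \<cdot>\<^sub>X ecls X a) \<cdot>\<^sub>X gcls X (ter X a) (psi X a h)"
      unfolding y using x h by (simp add: X.gcls_ecls)
    have ty: "tgt X y = ini X a" unfolding y using x h by simp
    have "psi Y (emap \<phi> a) k = inv\<^bsub>?T\<^esub> ?p \<otimes>\<^bsub>?T\<^esub> ?q"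
      unfolding k using Y.psi_mult[of "emap \<phi> a"] Y.psi_inv[of "emap \<phi> a"] x h g by simp
    then have eq: "gmap \<phi> (ter X a) (psi X a h) \<otimes>\<^bsub>?T\<^esub> (telt \<phi> a \<otimes>\<^bsub>?T\<^esub> psi Y (emap \<phi> a) k)
        = (telt \<phi> a \<otimes>\<^bsub>?T\<^esub> ?p) \<otimes>\<^bsub>?T\<^esub> (inv\<^bsub>?T\<^esub> ?p \<otimes>\<^bsub>?T\<^esub> ?q)"
      unfolding telt_psi[OF x(2) h, symmetric] using x h p q by (simp add: T.m_assoc)
    have "?p \<otimes>\<^bsub>?T\<^esub> (inv\<^bsub>?T\<^esub> ?p \<otimes>\<^bsub>?T\<^esub> ?q) = ?q"
      using T.m_assoc[of ?p "inv\<^bsub>?T\<^esub> ?p" ?q] p q by simp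
    then have "(telt \<phi> a \<otimes>\<^bsub>?T\<^esub> ?p) \<otimes>\<^bsub>?T\<^esub> (inv\<^bsub>?T\<^esub> ?p \<otimes>\<^bsub>?T\<^esub> ?q) = telt \<phi> a \<otimes>\<^bsub>?T\<^esub> ?q"
      using x p q by (simp add: T.m_assoc)
    with eq have "gmap \<phi> (ter X a) (psi X a h) \<otimes>\<^bsub>?T\<^esub> (telt \<phi> a \<otimes>\<^bsub>?T\<^esub> psi Y (emap \<phi> a) k)
        = telt \<phi> a \<otimes>\<^bsub>?T\<^esub> ?q" by simp
    moreover have "psi Y (emap \<phi> a) k \<in> carrier ?T"
      using \<open>psi Y (emap \<phi> a) k = _\<close> p q by simp
    ultimately show ?thesis
      using fibre_point_shift[of "x \<cdot>\<^sub>X ecls X a" "psi X a h" "telt \<phi> a \<otimes>\<^bsub>?T\<^esub> psi Y (emap \<phi> a) k"] x h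
      by (simp add: ty ya del: X.amult_assoc)
  qed
  then have "fibre_edge (emap \<phi> a) (fibre_point x g) = (\<Union>(y, k)\<in>fibre_point x g. ?R)"
    unfolding fibre_edge_def by (intro SUP_cong refl) (clarsimp split: prod.splits)
  moreover have "fibre_point x g \<noteq> {}" using fibre_point_self[of x g] x g by auto
  ultimately show ?thesis by auto
qed

text \<open>Equality after the edge provides an element \<open>h\<close> at its end.
  \<open>covering_inj\<close> forces the two lifted edges to coincide and \<open>h\<close> to come
  from an element \<open>n\<close> at their start, and injectivity of \<open>psi Y\<close> pulls the
  remaining equation back across the edge.\<close>

lemma fibre_edge_inj:
  assumes "x \<in> arrows X" "a \<in> edges X" "tgt X x = ini X a" "g \<in> carrier (grp Y (vmap \<phi> (ini X a)))"
    "y \<in> arrows X" "b \<in> edges X" "tgt X y = ini X b" "k \<in> carrier (grp Y (vmap \<phi> (ini X a)))"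
    "emap \<phi> b = emap \<phi> a"
    "fibre_edge (emap \<phi> a) (fibre_point x g) = fibre_edge (emap \<phi> a) (fibre_point y k)"
  shows "fibre_point x g = fibre_point y k"
proof -
  have ib: "vmap \<phi> (ini X b) = vmap \<phi> (ini X a)" and tb: "vmap \<phi> (ter X b) = vmap \<phi> (ter X a)"
    using ini_emap[OF assms(2)] ini_emap[OF assms(6)] ter_emap[OF assms(2)] ter_emap[OF assms(6)] assms(9)
    by simp_all
  let ?T = "grp Y (vmap \<phi> (ter X a))" and ?I = "grp Y (vmap \<phi> (ini X a))"
  interpret T: group ?T using assms by (simp add: Y.grp_group)
  interpret I: group ?I using assms by (simp add: Y.grp_group)
  have pg: "psi Y (emap \<phi> a) g \<in> carrier ?T" and pk: "psi Y (emap \<phi> a) k \<in> carrier ?T"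
    using Y.psi_closed[of "emap \<phi> a"] assms(2,4,8) by simp_all
  have tb': "telt \<phi> b \<in> carrier ?T" using telt_closed[OF assms(6)] tb by simp
  have ta: "telt \<phi> a \<in> carrier ?T" using telt_closed[OF assms(2)] .
  have "fibre_point (x \<cdot>\<^sub>X ecls X a) (telt \<phi> a \<otimes>\<^bsub>?T\<^esub> psi Y (emap \<phi> a) g)
    = fibre_point (y \<cdot>\<^sub>X ecls X b) (telt \<phi> b \<otimes>\<^bsub>?T\<^esub> psi Y (emap \<phi> a) k)"
    using assms(10) fibre_edge_point[OF assms(1-4)] fibre_edge_point[OF assms(5-7), of k] assms(8,9) ib tb
    by simp
  then obtain h where h: "h \<in> carrier (grp X (ter X a))"
    and yb: "y \<cdot>\<^sub>X ecls X b = (x \<cdot>\<^sub>X ecls X a) \<cdot>\<^sub>X gcls X (ter X a) h"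
    and eq: "telt \<phi> a \<otimes>\<^bsub>?T\<^esub> psi Y (emap \<phi> a) g
      = gmap \<phi> (ter X a) h \<otimes>\<^bsub>?T\<^esub> (telt \<phi> b \<otimes>\<^bsub>?T\<^esub> psi Y (emap \<phi> a) k)"
    by (rule fibre_point_eqD) (use assms(1-3,5-7) pg pk ta tb tb' in simp_all)
  have tt: "ter X b = ter X a"
    using arg_cong[OF yb, of "tgt X"] assms(1-3,5-7) h by simp
  have "(gmap \<phi> (ter X b) h \<otimes>\<^bsub>?T\<^esub> telt \<phi> b) \<otimes>\<^bsub>?T\<^esub> psi Y (emap \<phi> b) k
      = telt \<phi> a \<otimes>\<^bsub>?T\<^esub> psi Y (emap \<phi> b) g"
    using eq pk tb' assms(2,9) h tt by (simp add: T.m_assoc)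
  then obtain n where ba: "b = a" and n: "n \<in> carrier (grp X (ini X b))" "h = psi X b n"
    using covering_inj[OF assms(6,2) tt assms(9), of h k g] h tt assms(4,8) ib by auto
  have n': "n \<in> carrier (grp X (ini X a))" and hn: "h = psi X a n" using n ba by auto
  have gn: "gmap \<phi> (ini X a) n \<in> carrier ?I" using assms(2) n' by simp
  have "y \<cdot>\<^sub>X ecls X a = (x \<cdot>\<^sub>X gcls X (ini X a) n) \<cdot>\<^sub>X ecls X a"
    using yb X.gcls_ecls[OF assms(2) n'] assms(1-3) n' unfolding ba hn by simp
  then have y: "y = x \<cdot>\<^sub>X gcls X (ini X a) n"
    using X.amult_right_cancel[of "ecls X a" y "x \<cdot>\<^sub>X gcls X (ini X a) n"] assms(1-3,5,7) n' ba by simp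
  have pn: "psi Y (emap \<phi> a) (gmap \<phi> (ini X a) n) \<in> carrier ?T"
    using Y.psi_closed[of "emap \<phi> a"] assms(2) gn by simp
  have "telt \<phi> a \<otimes>\<^bsub>?T\<^esub> psi Y (emap \<phi> a) g
      = (gmap \<phi> (ter X a) h \<otimes>\<^bsub>?T\<^esub> telt \<phi> a) \<otimes>\<^bsub>?T\<^esub> psi Y (emap \<phi> a) k"
    unfolding eq ba using assms(2) h ta pk by (simp add: T.m_assoc)
  also have "\<dots> = telt \<phi> a \<otimes>\<^bsub>?T\<^esub> psi Y (emap \<phi> a) (gmap \<phi> (ini X a) n \<otimes>\<^bsub>?I\<^esub> k)"
    unfolding hn telt_psi[OF assms(2) n']
    using Y.psi_mult[of "emap \<phi> a" "gmap \<phi> (ini X a) n" k] assms(2,8) gn ta pk pn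
    by (simp add: T.m_assoc)
  finally have "psi Y (emap \<phi> a) g = psi Y (emap \<phi> a) (gmap \<phi> (ini X a) n \<otimes>\<^bsub>?I\<^esub> k)"
    using ta pg Y.psi_closed[of "emap \<phi> a" "gmap \<phi> (ini X a) n \<otimes>\<^bsub>?I\<^esub> k"] assms(2,8) gn by simp
  then have "g = gmap \<phi> (ini X a) n \<otimes>\<^bsub>?I\<^esub> k"
    using inj_onD[OF Y.psi_inj[of "emap \<phi> a"], of g "gmap \<phi> (ini X a) n \<otimes>\<^bsub>?I\<^esub> k"] assms(2,4,8) gn by simp
  then show ?thesis
    unfolding y using fibre_point_shift[of x n k] assms(1,3,8) n' by simp
qed

text \<open>The decomposition of \<open>k\<close> from \<open>covering_surj\<close> names the edge
  to go back along; \<open>h\<close> moves into the arrow and \<open>m\<close> stays as group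
  component.\<close>

lemma fibre_edge_surj:
  assumes y: "y \<in> arrows X" "vmap \<phi> (tgt X y) = ter Y a'" "k \<in> carrier (grp Y (ter Y a'))"
    and a': "a' \<in> edges Y"
  obtains x a g where "x \<in> arrows X" "src x = src y" "a \<in> edges X" "emap \<phi> a = a'" "tgt X x = ini X a"
    "g \<in> carrier (grp Y (ini Y a'))" "fibre_edge a' (fibre_point x g) = fibre_point y k"
proof -
  obtain a h m where a: "a \<in> edges X" "emap \<phi> a = a'" "ter X a = tgt X y" and h: "h \<in> carrier (grp X (tgt X y))"
    and m: "m \<in> carrier (grp Y (ini Y a'))"
    and k: "k = (gmap \<phi> (tgt X y) h \<otimes>\<^bsub>grp Y (ter Y a')\<^esub> telt \<phi> a) \<otimes>\<^bsub>grp Y (ter Y a')\<^esub> psi Y a' m"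
    using covering_surj[of "tgt X y" a' k] y a' by auto
  interpret T: group "grp Y (ter Y a')" using a' by (simp add: Y.grp_group)
  let ?x = "y \<cdot>\<^sub>X (gcls X (tgt X y) h \<cdot>\<^sub>X ainv X (ecls X a))"
  have i: "ini Y a' = vmap \<phi> (ini X a)" using ini_emap[OF a(1)] a(2) by simp
  have ta: "telt \<phi> a \<in> carrier (grp Y (ter Y a'))" using telt_closed[OF a(1)] a y by simp
  have pm: "psi Y a' m \<in> carrier (grp Y (ter Y a'))" using Y.psi_closed[OF a' m] .
  have gh: "gmap \<phi> (tgt X y) h \<in> carrier (grp Y (ter Y a'))" using gmap_closed[of "tgt X y" h] y h by simp
  have x: "?x \<in> arrows X" "src ?x = src y" "tgt X ?x = ini X a"
    using y a h by simp_all
  have "fibre_edge a' (fibre_point ?x m)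
      = fibre_point (?x \<cdot>\<^sub>X ecls X a) (telt \<phi> a \<otimes>\<^bsub>grp Y (ter Y a')\<^esub> psi Y a' m)"
    using fibre_edge_point[OF x(1) a(1) x(3), of m] a m i y by simp
  also have "?x \<cdot>\<^sub>X ecls X a = y \<cdot>\<^sub>X gcls X (tgt X y) h" using y a h by simp
  also have "fibre_point (y \<cdot>\<^sub>X gcls X (tgt X y) h) (telt \<phi> a \<otimes>\<^bsub>grp Y (ter Y a')\<^esub> psi Y a' m) = fibre_point y k"
    using fibre_point_shift[OF y(1) h, of "telt \<phi> a \<otimes>\<^bsub>grp Y (ter Y a')\<^esub> psi Y a' m"] y ta pm gh
    unfolding k by (simp add: T.m_assoc)
  finally show ?thesis using that[OF x(1,2) a(1,2) x(3) m] by simp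
qed

lemma fibreE:
  assumes "S \<in> fibre \<sigma>\<^sub>0 \<tau>"
  obtains x g where "S = fibre_point x g" "x \<in> arrows X" "src x = \<sigma>\<^sub>0" "vmap \<phi> (tgt X x) = \<tau>"
    "g \<in> carrier (grp Y \<tau>)"
  using assms unfolding fibre_def by blast

lemma fibreI:
  assumes "x \<in> arrows X" "src x = \<sigma>\<^sub>0" "vmap \<phi> (tgt X x) = \<tau>" "g \<in> carrier (grp Y \<tau>)"
  shows "fibre_point x g \<in> fibre \<sigma>\<^sub>0 \<tau>"
  using assms unfolding fibre_def by blast

lemma fibre_edgeE:
  assumes "S \<in> fibre \<sigma>\<^sub>0 (ini Y a')" "a' \<in> edges Y"
  obtains x a g where "S = fibre_point x g" "x \<in> arrows X" "src x = \<sigma>\<^sub>0" "a \<in> edges X" "emap \<phi> a = a'"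
    "tgt X x = ini X a" "g \<in> carrier (grp Y (vmap \<phi> (ini X a)))"
proof -
  obtain x g where x: "S = fibre_point x g" "x \<in> arrows X" "src x = \<sigma>\<^sub>0" "vmap \<phi> (tgt X x) = ini Y a'"
    "g \<in> carrier (grp Y (ini Y a'))" using assms(1) by (rule fibreE)
  obtain a where a: "a \<in> edges X" "ini X a = tgt X x" "emap \<phi> a = a'"
    using ex_edge_lift[of "tgt X x" a'] x assms(2) by auto
  show ?thesis using that[OF x(1,2,3) a(1,3)] a x by simp
qed

lemma fibre_action: "path_action Y (fibre \<sigma>\<^sub>0) fibre_grp fibre_edge"
proof (unfold_locales, goal_cases)
  case (1 \<tau> g S)
  then show ?case by (auto elim!: fibreE simp: fibre_grp_point intro!: fibreI)
next
  case (2 \<tau> S)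
  then show ?case by (auto elim!: fibreE simp: fibre_grp_point)
next
  case (3 \<tau> g h S)
  then show ?case by (auto elim!: fibreE simp: fibre_grp_point Y.grp_assoc)
next
  case (4 a')
  show ?case unfolding bij_betw_def
  proof (intro conjI inj_onI)
    fix S S' assume S: "S \<in> fibre \<sigma>\<^sub>0 (ini Y a')" "S' \<in> fibre \<sigma>\<^sub>0 (ini Y a')"
      and eq: "fibre_edge a' S = fibre_edge a' S'"
    obtain x a g where x: "S = fibre_point x g" "x \<in> arrows X" "src x = \<sigma>\<^sub>0" "a \<in> edges X" "emap \<phi> a = a'"
      "tgt X x = ini X a" "g \<in> carrier (grp Y (vmap \<phi> (ini X a)))" using S(1) 4 by (rule fibre_edgeE)
    obtain y b k where y: "S' = fibre_point y k" "y \<in> arrows X" "src y = \<sigma>\<^sub>0" "b \<in> edges X" "emap \<phi> b = a'"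
      "tgt X y = ini X b" "k \<in> carrier (grp Y (vmap \<phi> (ini X b)))" using S(2) 4 by (rule fibre_edgeE)
    have "vmap \<phi> (ini X b) = vmap \<phi> (ini X a)" using ini_emap x(4,5) y(4,5) by metis
    then show "S = S'"
      using fibre_edge_inj[OF x(2,4,6,7) y(2,4,6)] x y eq by simp
  next
    show "fibre_edge a' ` fibre \<sigma>\<^sub>0 (ini Y a') = fibre \<sigma>\<^sub>0 (ter Y a')"
    proof (intro subset_antisym subsetI)
    fix T assume "T \<in> fibre_edge a' ` fibre \<sigma>\<^sub>0 (ini Y a')"
    then obtain S where S: "S \<in> fibre \<sigma>\<^sub>0 (ini Y a')" "T = fibre_edge a' S" by auto
    obtain x a g where x: "S = fibre_point x g" "x \<in> arrows X" "src x = \<sigma>\<^sub>0" "a \<in> edges X" "emap \<phi> a = a'"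
      "tgt X x = ini X a" "g \<in> carrier (grp Y (vmap \<phi> (ini X a)))" using S(1) 4 by (rule fibre_edgeE)
    have "psi Y (emap \<phi> a) g \<in> carrier (grp Y (vmap \<phi> (ter X a)))"
      using Y.psi_closed[of "emap \<phi> a" g] x(4,7) by simp
    then show "T \<in> fibre \<sigma>\<^sub>0 (ter Y a')"
      using fibre_edge_point[OF x(2,4,6,7)] x S(2) ter_emap[OF x(4)] by (auto intro!: fibreI)
  next
    fix T assume "T \<in> fibre \<sigma>\<^sub>0 (ter Y a')"
    then obtain y k where y: "T = fibre_point y k" "y \<in> arrows X" "src y = \<sigma>\<^sub>0"
      "vmap \<phi> (tgt X y) = ter Y a'" "k \<in> carrier (grp Y (ter Y a'))" by (rule fibreE)
    obtain x a g where x: "x \<in> arrows X" "src x = src y" "a \<in> edges X" "emap \<phi> a = a'" "tgt X x = ini X a"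
      "g \<in> carrier (grp Y (ini Y a'))" and e: "fibre_edge a' (fibre_point x g) = fibre_point y k"
      using fibre_edge_surj[OF y(2,4,5) 4] by blast
    have "fibre_point x g \<in> fibre \<sigma>\<^sub>0 (ini Y a')"
      using x y ini_emap[OF x(3)] by (intro fibreI) auto
    then show "T \<in> fibre_edge a' ` fibre \<sigma>\<^sub>0 (ini Y a')" using e y(1) by blast
    qed
  qed
next
  case (5 a' k S)
  obtain x a g where x: "S = fibre_point x g" "x \<in> arrows X" "src x = \<sigma>\<^sub>0" "a \<in> edges X" "emap \<phi> a = a'"
      "tgt X x = ini X a" "g \<in> carrier (grp Y (vmap \<phi> (ini X a)))" using 5(3,1) by (rule fibre_edgeE)
  have i: "ini Y a' = vmap \<phi> (ini X a)" "ter Y a' = vmap \<phi> (ter X a)"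
    using ini_emap[OF x(4)] ter_emap[OF x(4)] x(5) by simp_all
  have k: "k \<in> carrier (grp Y (vmap \<phi> (ini X a)))" using 5(2) i by simp
  have p: "psi Y a' k \<in> carrier (grp Y (vmap \<phi> (ter X a)))" "psi Y a' g \<in> carrier (grp Y (vmap \<phi> (ter X a)))"
    using Y.psi_closed[OF 5(1)] i k x by simp_all
  have m: "psi Y a' (g \<otimes>\<^bsub>grp Y (vmap \<phi> (ini X a))\<^esub> k)
      = psi Y a' g \<otimes>\<^bsub>grp Y (vmap \<phi> (ter X a))\<^esub> psi Y a' k"
    using Y.psi_mult[OF 5(1)] i k x by simp
  show ?case
    using fibre_edge_point[OF x(2,4,6,7)] fibre_edge_point[OF x(2,4,6), of "g \<otimes>\<^bsub>grp Y (vmap \<phi> (ini X a))\<^esub> k"]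
      x(1-7) i k p m
    by (simp add: fibre_grp_point Y.grp_assoc)
next
  case (6 a' b' S)
  note v' = Y.E2D[OF 6(1)] Y.tw_closed[OF 6(1)]
  obtain x b g where x: "S = fibre_point x g" "x \<in> arrows X" "src x = \<sigma>\<^sub>0" "b \<in> edges X" "emap \<phi> b = b'"
      "tgt X x = ini X b" "g \<in> carrier (grp Y (vmap \<phi> (ini X b)))" using 6(2) v'(2) by (rule fibre_edgeE)
  have ib: "ini Y b' = vmap \<phi> (ini X b)" "ter Y b' = vmap \<phi> (ter X b)"
    using ini_emap[OF x(4)] ter_emap[OF x(4)] x(5) by simp_all
  obtain a where a: "a \<in> edges X" "ini X a = ter X b" "emap \<phi> a = a'"
    using ex_edge_lift[of "ter X b" a'] v' x(4) ib by auto
  have ab: "(a, b) \<in> E2 X" using a x by (simp add: E2_def)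
  note v = X.E2D[OF ab] X.tw_closed[OF ab]
  have ta: "ter Y a' = vmap \<phi> (ter X a)" using ter_emap[OF a(1)] a(3) by simp
  have ia: "ini Y a' = vmap \<phi> (ter X b)" using v'(3) ib by simp
  let ?T = "grp Y (vmap \<phi> (ter X a))" and ?M = "grp Y (vmap \<phi> (ter X b))"
  interpret T: group ?T using a by (simp add: Y.grp_group)
  let ?pg = "psi Y b' g"
  have pg: "?pg \<in> carrier ?M" using Y.psi_closed[OF v'(2)] ib x by simp
  have tb: "telt \<phi> b \<in> carrier ?M" and tta: "telt \<phi> a \<in> carrier ?T"
    and ttab: "telt \<phi> (cmp X a b) \<in> carrier ?T"
    using telt_closed[of b] telt_closed[of a] telt_closed[of "cmp X a b"] v by simp_all
  have ppg: "psi Y a' ?pg \<in> carrier ?T" "psi Y a' (telt \<phi> b) \<in> carrier ?T"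
    using Y.psi_closed[OF v'(1)] ia ta pg tb by simp_all
  have tw: "tw Y a' b' \<in> carrier ?T" using v'(7) ta by simp
  have gtw: "gmap \<phi> (ter X a) (tw X a b) \<in> carrier ?T" using v by simp
  have pab: "psi Y (cmp Y a' b') g \<in> carrier ?T"
    using Y.psi_closed[OF v'(4)] v'(5,6) ib ta x(7) by simp
  have m: "psi Y a' (telt \<phi> b \<otimes>\<^bsub>?M\<^esub> ?pg) = psi Y a' (telt \<phi> b) \<otimes>\<^bsub>?T\<^esub> psi Y a' ?pg"
    using Y.psi_mult[OF v'(1)] ia ta pg tb by simp
  \<comment> \<open>The twisting element has to stand directly behind the image of the element of
    \<open>b\<close>, where \<open>telt_cmp\<close> can be applied.\<close>
  have c: "psi Y a' ?pg \<otimes>\<^bsub>?T\<^esub> tw Y a' b' = tw Y a' b' \<otimes>\<^bsub>?T\<^esub> psi Y (cmp Y a' b') g"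
  proof -
    have "psi Y a' ?pg = tw Y a' b' \<otimes>\<^bsub>?T\<^esub> (psi Y (cmp Y a' b') g \<otimes>\<^bsub>?T\<^esub> inv\<^bsub>?T\<^esub> tw Y a' b')"
      using Y.tw_conj[OF 6(1), of g] ta ib x(7) tw pab by (simp add: conj_by_def T.m_assoc)
    then show ?thesis using tw pab by (simp add: T.m_assoc)
  qed
  have e: "emap \<phi> (cmp X a b) = cmp Y a' b'" using emap_cmp[OF ab] a x by simp
  have tc: "gmap \<phi> (ter X a) (tw X a b) \<otimes>\<^bsub>?T\<^esub> telt \<phi> (cmp X a b)
      = telt \<phi> a \<otimes>\<^bsub>?T\<^esub> psi Y a' (telt \<phi> b) \<otimes>\<^bsub>?T\<^esub> tw Y a' b'"
    using telt_cmp[OF ab] a x by simp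
  have "fibre_grp (ter Y a') (tw Y a' b') (fibre_edge a' (fibre_edge b' S))
    = fibre_grp (ter Y a') (tw Y a' b') (fibre_edge a' (fibre_point (x \<cdot>\<^sub>X ecls X b) (telt \<phi> b \<otimes>\<^bsub>?M\<^esub> ?pg)))"
    using fibre_edge_point[OF x(2,4,6,7)] x(1,5) by simp
  also have "\<dots> = fibre_grp (ter Y a') (tw Y a' b') (fibre_point ((x \<cdot>\<^sub>X ecls X b) \<cdot>\<^sub>X ecls X a)
      (telt \<phi> a \<otimes>\<^bsub>?T\<^esub> (psi Y a' (telt \<phi> b) \<otimes>\<^bsub>?T\<^esub> psi Y a' ?pg)))"
    using fibre_edge_point[of "x \<cdot>\<^sub>X ecls X b" a "telt \<phi> b \<otimes>\<^bsub>?M\<^esub> ?pg"] x a tb pg m by simp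
  also have "\<dots> = fibre_point (x \<cdot>\<^sub>X (ecls X b \<cdot>\<^sub>X ecls X a))
      ((telt \<phi> a \<otimes>\<^bsub>?T\<^esub> (psi Y a' (telt \<phi> b) \<otimes>\<^bsub>?T\<^esub> psi Y a' ?pg)) \<otimes>\<^bsub>?T\<^esub> tw Y a' b')"
    using x a ta tta ppg tw by (simp add: fibre_grp_point)
  also have "(telt \<phi> a \<otimes>\<^bsub>?T\<^esub> (psi Y a' (telt \<phi> b) \<otimes>\<^bsub>?T\<^esub> psi Y a' ?pg)) \<otimes>\<^bsub>?T\<^esub> tw Y a' b'
      = (telt \<phi> a \<otimes>\<^bsub>?T\<^esub> psi Y a' (telt \<phi> b) \<otimes>\<^bsub>?T\<^esub> tw Y a' b') \<otimes>\<^bsub>?T\<^esub> psi Y (cmp Y a' b') g"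
    using tta ppg tw pab c by (simp add: T.m_assoc)
  also have "\<dots> = gmap \<phi> (ter X a) (tw X a b) \<otimes>\<^bsub>?T\<^esub> (telt \<phi> (cmp X a b) \<otimes>\<^bsub>?T\<^esub> psi Y (cmp Y a' b') g)"
    unfolding tc[symmetric] using gtw ttab pab by (simp add: T.m_assoc)
  \<comment> \<open>The image of the twisting element of \<open>X\<close>, now leftmost in the group
    component, moves into the arrow, where it turns the two edges into their composite.\<close>
  also have "fibre_point (x \<cdot>\<^sub>X (ecls X b \<cdot>\<^sub>X ecls X a)) \<dots>
      = fibre_point ((x \<cdot>\<^sub>X (ecls X b \<cdot>\<^sub>X ecls X a)) \<cdot>\<^sub>X gcls X (ter X a) (tw X a b))
          (telt \<phi> (cmp X a b) \<otimes>\<^bsub>?T\<^esub> psi Y (cmp Y a' b') g)"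
    using fibre_point_shift[of "x \<cdot>\<^sub>X (ecls X b \<cdot>\<^sub>X ecls X a)" "tw X a b"] x a v ttab pab by simp
  also have "(x \<cdot>\<^sub>X (ecls X b \<cdot>\<^sub>X ecls X a)) \<cdot>\<^sub>X gcls X (ter X a) (tw X a b) = x \<cdot>\<^sub>X ecls X (cmp X a b)"
    using x a v X.ecls_cmp[OF ab] by simp
  also have "fibre_point \<dots> (telt \<phi> (cmp X a b) \<otimes>\<^bsub>?T\<^esub> psi Y (cmp Y a' b') g) = fibre_edge (cmp Y a' b') S"
    using fibre_edge_point[of x "cmp X a b" g] x v e by simp
  finally show ?case by simp
qed

text \<open>Both sides act on the point of the identity arrow. The image of \<open>c\<close> leads
  to the point of \<open>c\<close>, whereas \<open>k\<close> changes only the group component; since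
  equal classes act equally, these points coincide. Coinciding points differ by a local element,
  which is the required \<open>h\<close>.\<close>

lemma ind_eq_gclsD:
  assumes c: "c \<in> arrows X" and k: "k \<in> carrier (grp Y (vmap \<phi> (src c)))"
    and eq: "ind c = gcls Y (vmap \<phi> (src c)) k"
  obtains h where "h \<in> carrier (grp X (src c))" "c = gcls X (src c) h" "gmap \<phi> (src c) h = k"
proof -
  interpret F: path_action Y "fibre (src c)" fibre_grp fibre_edge by (rule fibre_action)
  let ?pt = "\<lambda>x. fibre_point x \<one>\<^bsub>grp Y (vmap \<phi> (tgt X x))\<^esub>"
  have pt: "?pt x \<in> fibre (src c) (vmap \<phi> (tgt X x))" if "x \<in> arrows X" "src x = src c" for x
    using that by (intro fibreI) simp_all
  have gp: "fibre_grp (vmap \<phi> (tgt X x)) (gmap \<phi> (tgt X x) h) (?pt x) = ?pt (x \<cdot>\<^sub>X gcls X (tgt X x) h)"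
    if "x \<in> arrows X" "h \<in> carrier (grp X (tgt X x))" for x h
    using that fibre_point_shift[of x h "\<one>\<^bsub>grp Y (vmap \<phi> (tgt X x))\<^esub>"] by (simp add: fibre_grp_point)
  \<comment> \<open>The image of an edge lifts to the edge itself: the element that
    \<open>oedge_image\<close> puts next to the edge cancels the one introduced by
    \<open>fibre_edge\<close>, so the group component stays trivial.\<close>
  have step: "F.act (oedge_image X Y \<phi> e) (?pt x)
      = ?pt (x \<cdot>\<^sub>X path_class X (xcons X \<one>\<^bsub>grp X (oini X e)\<^esub> e (gpath (oter X e) \<one>\<^bsub>grp X (oter X e)\<^esub>)))"
    if "e \<in> oedges X" "x \<in> arrows X" "src x = src c" "tgt X x = oini X e" for e x
  proof (cases e)
    case (Fwd a)
    then have a: "a \<in> edges X" "tgt X x = ini X a" using that by simp_all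
    show ?thesis
      using a that pt[of x] fibre_edge_point[of x a "\<one>\<^bsub>grp Y (vmap \<phi> (ini X a))\<^esub>"]
        Y.psi_one[of "emap \<phi> a"]
      by (simp add: Fwd oedge_image_Fwd fibre_grp_point flip: X.epath_eq ecls_def del: oedge_image.simps)
  next
    case (Bwd a)
    then have a: "a \<in> edges X" "tgt X x = ter X a" using that by simp_all
    let ?y = "x \<cdot>\<^sub>X ainv X (ecls X a)"
    have y: "?y \<in> arrows X" "src ?y = src c" "tgt X ?y = ini X a" using a that by simp_all
    have "fibre_grp (vmap \<phi> (ter X a)) (telt \<phi> a) (?pt x) = fibre_edge (emap \<phi> a) (?pt ?y)"
      using a that y fibre_edge_point[OF y(1) a(1) y(3), of "\<one>\<^bsub>grp Y (vmap \<phi> (ini X a))\<^esub>"]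
        Y.psi_one[of "emap \<phi> a"] by (simp add: fibre_grp_point)
    moreover have "inv_into (fibre (src c) (vmap \<phi> (ini X a))) (fibre_edge (emap \<phi> a)) (fibre_edge (emap \<phi> a) (?pt ?y)) = ?pt ?y"
      using F.inv_ae_ae[of "emap \<phi> a" "?pt ?y"] pt[OF y(1,2)] a y(3) by simp
    ultimately show ?thesis
      using a that pt[OF y(1,2)] y(3)
      by (simp add: Bwd oedge_image_Bwd X.ainv_ecls del: oedge_image.simps)
  qed
  have act: "F.act (path_image X Y \<phi> p) (?pt x) = ?pt (x \<cdot>\<^sub>X path_class X p)"
    if "is_xpath X p" "x \<in> arrows X" "src x = src c" "tgt X x = xini p" for p x
    using that
  proof (induct arbitrary: x rule: X.is_xpath_induct)
    case (gpath \<sigma> g)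
    then show ?case using gp[of x g] by (simp flip: gcls_def)
  next
    case (xcons g e q)
    let ?e = "path_class X (xcons X \<one>\<^bsub>grp X (oini X e)\<^esub> e (gpath (oter X e) \<one>\<^bsub>grp X (oter X e)\<^esub>))"
    let ?x = "x \<cdot>\<^sub>X gcls X (oini X e) g"
    have x: "?x \<in> arrows X" "src ?x = src c" "tgt X ?x = oini X e" using xcons by simp_all
    have p: "path_class X (xcons X g e q) = gcls X (oini X e) g \<cdot>\<^sub>X (?e \<cdot>\<^sub>X path_class X q)"
      using xcons by (simp add: gcls_def)
    have "F.act (path_image X Y \<phi> (xcons X g e q)) (?pt x)
        = F.act (path_image X Y \<phi> q) (F.act (oedge_image X Y \<phi> e) (?pt ?x))"
      using xcons pt[of x] gp[of x g] pt[OF x(1,2)] x(3) F.act_xconcat by (simp del: oedge_image.simps)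
    also have "\<dots> = ?pt ((?x \<cdot>\<^sub>X ?e) \<cdot>\<^sub>X path_class X q)"
      using step[OF xcons(1) x] xcons x by simp
    also have "(?x \<cdot>\<^sub>X ?e) \<cdot>\<^sub>X path_class X q = x \<cdot>\<^sub>X path_class X (xcons X g e q)"
      unfolding p using xcons by simp
    finally show ?case .
  qed
  obtain p where p: "is_xpath X p" "c = path_class X p" using c by (rule X.arrowE)
  then have src_p: "xini p = src c" by simp
  have "path_homotopic Y (path_image X Y \<phi> p) (gpath (vmap \<phi> (src c)) k)"
    using eq p by (simp add: induced_path_class gcls_def Y.path_class_eq_iff)
  then have "F.act (path_image X Y \<phi> p) (?pt (idcls X (src c)))
      = F.act (gpath (vmap \<phi> (src c)) k) (?pt (idcls X (src c)))"
    by (rule F.act_homotopic) (use pt[of "idcls X (src c)"] p c in simp)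
  then have "fibre_point c \<one>\<^bsub>grp Y (vmap \<phi> (tgt X c))\<^esub> = fibre_point (idcls X (src c)) k"
    using act[OF p(1), of "idcls X (src c)"] p(1) c k
    by (simp add: fibre_grp_point src_p flip: p(2))
  then obtain h where h: "h \<in> carrier (grp X (src c))" "c = idcls X (src c) \<cdot>\<^sub>X gcls X (src c) h"
    and "k = gmap \<phi> (src c) h \<otimes>\<^bsub>grp Y (vmap \<phi> (src c))\<^esub> \<one>\<^bsub>grp Y (vmap \<phi> (tgt X c))\<^esub>"
    using fibre_point_eqD[of "idcls X (src c)" k c "\<one>\<^bsub>grp Y (vmap \<phi> (tgt X c))\<^esub>"] c k by auto
  moreover have ch: "c = gcls X (src c) h" using h c by simp
  moreover have "tgt X c = src c" using arg_cong[OF ch, of "tgt X"] h c by simp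
  ultimately show ?thesis using that c by simp
qed

text \<open>Reflection of local arrows applied to the inverse of \<open>c\<close> followed by
  \<open>d\<close>. Equality of the targets is part of the conclusion; this is how the vertices to
  which automorphisms send a given vertex are compared later.\<close>

lemma ind_eq_mult_gclsD:
  assumes c: "c \<in> arrows X" "d \<in> arrows X" "src c = src d"
    and k: "k \<in> carrier (grp Y (vmap \<phi> (tgt X c)))"
    and eq: "ind d = ind c \<cdot>\<^sub>Y gcls Y (vmap \<phi> (tgt X c)) k"
  obtains h where "h \<in> carrier (grp X (tgt X c))" "d = c \<cdot>\<^sub>X gcls X (tgt X c) h"
    "gmap \<phi> (tgt X c) h = k"
proof -
  have "ind (ainv X c \<cdot>\<^sub>X d) = gcls Y (vmap \<phi> (tgt X c)) k"
    using c k eq by simp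
  then obtain h where h: "h \<in> carrier (grp X (tgt X c))" "ainv X c \<cdot>\<^sub>X d = gcls X (tgt X c) h"
    "gmap \<phi> (tgt X c) h = k"
    using ind_eq_gclsD[of "ainv X c \<cdot>\<^sub>X d" k] c k by auto
  have "d = c \<cdot>\<^sub>X (ainv X c \<cdot>\<^sub>X d)" using c by simp
  then show ?thesis using that h by simp
qed

text \<open>The difference of the two arrows is a local element with trivial image, hence trivial by
  \<open>gmap_inj\<close>.\<close>

lemma ind_inj:
  assumes "c \<in> arrows X" "d \<in> arrows X" "src c = src d" "tgt X c = tgt X d" "ind c = ind d"
  shows "c = d"
proof -
  have "ind d = ind c \<cdot>\<^sub>Y idcls Y (vmap \<phi> (tgt X c))" using assms by simp
  then obtain h where h: "h \<in> carrier (grp X (tgt X c))" "d = c \<cdot>\<^sub>X gcls X (tgt X c) h"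
    "gmap \<phi> (tgt X c) h = \<one>\<^bsub>grp Y (vmap \<phi> (tgt X c))\<^esub>"
    using ind_eq_mult_gclsD[OF assms(1,2,3), of "\<one>\<^bsub>grp Y (vmap \<phi> (tgt X c))\<^esub>"] assms(1) by auto
  have "h = \<one>\<^bsub>grp X (tgt X c)\<^esub>"
    using inj_onD[OF gmap_inj, of "tgt X c" h "\<one>\<^bsub>grp X (tgt X c)\<^esub>"] h assms(1) by simp
  then show ?thesis using h assms(1) by simp
qed

end

section \<open>Morphisms and homotopies in terms of induced functors\<close>

lemma (in complex_of_groups) gcls_inj:
  assumes "developable X" "\<sigma> \<in> verts X" "g \<in> carrier (grp X \<sigma>)" "h \<in> carrier (grp X \<sigma>)"
    "gcls X \<sigma> g = gcls X \<sigma> h"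
  shows "g = h"
  using assms unfolding developable_def gcls_def by (blast dest: inj_onD)

lemma (in complex_of_groups) gcls_cancel [simp]:
  assumes "\<sigma> \<in> verts X" "g \<in> carrier (grp X \<sigma>)" "c \<in> arrows X" "src c = \<sigma>"
  shows "gcls X \<sigma> g \<cdot>\<^sub>X (gcls X \<sigma> (inv\<^bsub>grp X \<sigma>\<^esub> g) \<cdot>\<^sub>X c) = c"
    "gcls X \<sigma> (inv\<^bsub>grp X \<sigma>\<^esub> g) \<cdot>\<^sub>X (gcls X \<sigma> g \<cdot>\<^sub>X c) = c"
  using assms by (simp_all add: gcls_inv)

text \<open>Over a developable target, a functor of the right shape on generators comes from a morphism,
  because all axioms can be checked in the fundamental groupoid.\<close>

lemma cog_morphismI:
  assumes "complex_of_groups X" "complex_of_groups Y" and dev: "developable Y" and "scwol_morphism X Y \<eta>"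
    and gc: "\<And>\<sigma> g. \<sigma> \<in> verts X \<Longrightarrow> g \<in> carrier (grp X \<sigma>) \<Longrightarrow> gmap \<eta> \<sigma> g \<in> carrier (grp Y (vmap \<eta> \<sigma>))"
    and tc: "\<And>a. a \<in> edges X \<Longrightarrow> telt \<eta> a \<in> carrier (grp Y (vmap \<eta> (ter X a)))"
    and F_mult: "\<And>c d. c \<in> arrows X \<Longrightarrow> d \<in> arrows X \<Longrightarrow> tgt X c = src d \<Longrightarrow> F (c \<cdot>\<^sub>X d) = F c \<cdot>\<^sub>Y F d"
    and F_gcls: "\<And>\<sigma> g. \<sigma> \<in> verts X \<Longrightarrow> g \<in> carrier (grp X \<sigma>) \<Longrightarrow>
      F (gcls X \<sigma> g) = gcls Y (vmap \<eta> \<sigma>) (gmap \<eta> \<sigma> g)"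
    and F_ecls: "\<And>a. a \<in> edges X \<Longrightarrow> F (ecls X a) = ecls Y (emap \<eta> a) \<cdot>\<^sub>Y
      gcls Y (vmap \<eta> (ter X a)) (inv\<^bsub>grp Y (vmap \<eta> (ter X a))\<^esub> telt \<eta> a)"
  shows "cog_morphism X Y \<eta>"
proof -
  interpret X: complex_of_groups X by fact
  interpret Y: complex_of_groups Y by fact
  interpret f: scwol_morphism X Y \<eta> by fact
  note [simp] = f.vmap_closed f.emap_closed f.ini_emap f.ter_emap gc tc
  show ?thesis
  proof
    fix \<sigma> assume \<sigma>: "\<sigma> \<in> verts X"
    show "gmap \<eta> \<sigma> \<in> hom (grp X \<sigma>) (grp Y (vmap \<eta> \<sigma>))"
    proof (rule homI)
      fix g h assume gh: "g \<in> carrier (grp X \<sigma>)" "h \<in> carrier (grp X \<sigma>)"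
      have "gcls Y (vmap \<eta> \<sigma>) (gmap \<eta> \<sigma> (g \<otimes>\<^bsub>grp X \<sigma>\<^esub> h))
        = gcls Y (vmap \<eta> \<sigma>) (gmap \<eta> \<sigma> g \<otimes>\<^bsub>grp Y (vmap \<eta> \<sigma>)\<^esub> gmap \<eta> \<sigma> h)"
        using F_mult[of "gcls X \<sigma> g" "gcls X \<sigma> h"] \<sigma> gh
        by (simp add: F_gcls Y.gcls_mult flip: X.gcls_mult)
      then show "gmap \<eta> \<sigma> (g \<otimes>\<^bsub>grp X \<sigma>\<^esub> h) = gmap \<eta> \<sigma> g \<otimes>\<^bsub>grp Y (vmap \<eta> \<sigma>)\<^esub> gmap \<eta> \<sigma> h"
        using \<sigma> gh by (intro Y.gcls_inj[OF dev, of "vmap \<eta> \<sigma>"]) simp_all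
    qed (use \<sigma> in simp)
  next
    fix a g assume a: "a \<in> edges X" and g: "g \<in> carrier (grp X (ini X a))"
    let ?t = "vmap \<eta> (ter X a)" and ?i = "vmap \<eta> (ini X a)"
    let ?u = "gcls Y ?t (telt \<eta> a)" and ?p = "psi Y (emap \<eta> a) (gmap \<eta> (ini X a) g)"
      and ?q = "gmap \<eta> (ter X a) (psi X a g)"
    have p: "?p \<in> carrier (grp Y ?t)" using Y.psi_closed[of "emap \<eta> a"] a g by simp
    have q: "?q \<in> carrier (grp Y ?t)" using a g by simp
    have pt: "conj_by (grp Y ?t) (telt \<eta> a) ?p \<in> carrier (grp Y ?t)"
      using a p by (simp add: conj_by_def)
    have "gcls Y ?i (gmap \<eta> (ini X a) g) \<cdot>\<^sub>Y ecls Y (emap \<eta> a) = ecls Y (emap \<eta> a) \<cdot>\<^sub>Y gcls Y ?t ?p"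
      using Y.gcls_ecls[of "emap \<eta> a" "gmap \<eta> (ini X a) g"] a g by simp
    then have "gcls Y ?i (gmap \<eta> (ini X a) g) \<cdot>\<^sub>Y (ecls Y (emap \<eta> a) \<cdot>\<^sub>Y ainv Y ?u)
        = ecls Y (emap \<eta> a) \<cdot>\<^sub>Y (gcls Y ?t ?p \<cdot>\<^sub>Y ainv Y ?u)"
      by (rule Y.amult_ext) (use a g p in simp_all)
    moreover have "gcls Y ?i (gmap \<eta> (ini X a) g) \<cdot>\<^sub>Y (ecls Y (emap \<eta> a) \<cdot>\<^sub>Y ainv Y ?u)
        = ecls Y (emap \<eta> a) \<cdot>\<^sub>Y (ainv Y ?u \<cdot>\<^sub>Y gcls Y ?t ?q)"
      using arg_cong[OF X.gcls_ecls[OF a g], of F] a g q by (simp add: F_mult F_gcls F_ecls Y.gcls_inv)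
    ultimately have "gcls Y ?t ?p \<cdot>\<^sub>Y ainv Y ?u = ainv Y ?u \<cdot>\<^sub>Y gcls Y ?t ?q"
      using a p q by simp
    then have "?u \<cdot>\<^sub>Y (gcls Y ?t ?p \<cdot>\<^sub>Y ainv Y ?u) = gcls Y ?t ?q"
      using a q by simp
    then have "gcls Y ?t (conj_by (grp Y ?t) (telt \<eta> a) ?p) = gcls Y ?t ?q"
      using a p by (simp add: conj_by_def Y.gcls_mult Y.gcls_inv)
    then show "conj_by (grp Y ?t) (telt \<eta> a) ?p = ?q"
      using a pt q by (intro Y.gcls_inj[OF dev, of ?t]) simp_all
  next
    fix a b assume ab: "(a, b) \<in> E2 X"
    have ab': "(emap \<eta> a, emap \<eta> b) \<in> E2 Y" using ab by (auto simp: E2_def)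
    note v = X.E2D[OF ab] X.tw_closed[OF ab]
    note v' = Y.E2D[OF ab'] Y.tw_closed[OF ab']
    let ?t = "vmap \<eta> (ter X a)" and ?s = "vmap \<eta> (ter X b)"
    let ?A = "ecls Y (emap \<eta> a)" and ?B = "ecls Y (emap \<eta> b)"
    let ?ta = "gcls Y ?t (telt \<eta> a)" and ?tb = "gcls Y ?s (telt \<eta> b)"
      and ?tab = "gcls Y ?t (telt \<eta> (cmp X a b))"
      and ?p = "gcls Y ?t (psi Y (emap \<eta> a) (telt \<eta> b))"
      and ?w = "gcls Y ?t (tw Y (emap \<eta> a) (emap \<eta> b))"
      and ?F = "gcls Y ?t (gmap \<eta> (ter X a) (tw X a b))"
    have tb: "telt \<eta> b \<in> carrier (grp Y ?s)" using v by simp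
    have ta: "telt \<eta> a \<in> carrier (grp Y ?t)" using v by simp
    have tab: "telt \<eta> (cmp X a b) \<in> carrier (grp Y ?t)" using tc[of "cmp X a b"] v by simp
    have p: "psi Y (emap \<eta> a) (telt \<eta> b) \<in> carrier (grp Y ?t)"
      using v Y.psi_closed[of "emap \<eta> a" "telt \<eta> b"] by simp
    have w: "tw Y (emap \<eta> a) (emap \<eta> b) \<in> carrier (grp Y ?t)" using v v' by simp
    have f: "gmap \<eta> (ter X a) (tw X a b) \<in> carrier (grp Y ?t)" using v by simp
    have 2: "?A \<cdot>\<^sub>Y ?p = ?tb \<cdot>\<^sub>Y ?A"
      using Y.gcls_ecls[of "emap \<eta> a" "telt \<eta> b"] v by simp
    have 3: "?B \<cdot>\<^sub>Y (?A \<cdot>\<^sub>Y ?w) = ecls Y (emap \<eta> (cmp X a b))"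
      using Y.ecls_cmp[OF ab'] v by (simp add: f.emap_cmp[OF ab])
    \<comment> \<open>The slide \<open>2\<close> in inverted form, which brings the inverse element
      of \<open>b\<close> behind the edge of \<open>a\<close>.\<close>
    have pA: "ainv Y ?tb \<cdot>\<^sub>Y ?A = ?A \<cdot>\<^sub>Y ainv Y ?p"
    proof -
      have "ainv Y ?tb \<cdot>\<^sub>Y ?A = ainv Y ?tb \<cdot>\<^sub>Y ((?tb \<cdot>\<^sub>Y ?A) \<cdot>\<^sub>Y ainv Y ?p)"
        unfolding 2[symmetric] using v p tb by simp
      then show ?thesis using v p tb by simp
    qed
    have "F (ecls X b \<cdot>\<^sub>X (ecls X a \<cdot>\<^sub>X gcls X (ter X a) (tw X a b)))
        = ?B \<cdot>\<^sub>Y ((ainv Y ?tb \<cdot>\<^sub>Y ?A) \<cdot>\<^sub>Y (ainv Y ?ta \<cdot>\<^sub>Y ?F))"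
      using v ta tb f by (simp add: F_mult F_gcls F_ecls Y.gcls_inv)
    \<comment> \<open>\<open>F\<close> is applied to the composition rule of \<open>X\<close>. Both
      sides now begin with \<open>?B\<close> and \<open>?A\<close>, which can be cancelled, leaving
      an equation between local elements.\<close>
    then have "?B \<cdot>\<^sub>Y (?A \<cdot>\<^sub>Y (ainv Y ?p \<cdot>\<^sub>Y (ainv Y ?ta \<cdot>\<^sub>Y ?F)))
        = (?B \<cdot>\<^sub>Y (?A \<cdot>\<^sub>Y ?w)) \<cdot>\<^sub>Y ainv Y ?tab"
      unfolding pA X.ecls_cmp[OF ab] 3 using F_ecls[OF v(4)] v ta tb f p tab by (simp add: Y.gcls_inv)
    then have e: "ainv Y ?p \<cdot>\<^sub>Y (ainv Y ?ta \<cdot>\<^sub>Y ?F) = ?w \<cdot>\<^sub>Y ainv Y ?tab"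
      using v ta p f w tab by simp
    have "?F = ?ta \<cdot>\<^sub>Y (?p \<cdot>\<^sub>Y (ainv Y ?p \<cdot>\<^sub>Y (ainv Y ?ta \<cdot>\<^sub>Y ?F)))"
      using v ta p f by simp
    then have "?F \<cdot>\<^sub>Y ?tab = (?ta \<cdot>\<^sub>Y (?p \<cdot>\<^sub>Y (?w \<cdot>\<^sub>Y ainv Y ?tab))) \<cdot>\<^sub>Y ?tab"
      unfolding e by simp
    also have "\<dots> = ?ta \<cdot>\<^sub>Y (?p \<cdot>\<^sub>Y ?w)"
      using v ta p w tab by simp
    finally have "gcls Y ?t (gmap \<eta> (ter X a) (tw X a b) \<otimes>\<^bsub>grp Y ?t\<^esub> telt \<eta> (cmp X a b))
      = gcls Y ?t (telt \<eta> a \<otimes>\<^bsub>grp Y ?t\<^esub> psi Y (emap \<eta> a) (telt \<eta> b)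
            \<otimes>\<^bsub>grp Y ?t\<^esub> tw Y (emap \<eta> a) (emap \<eta> b))"
      using v ta p w tab f by (simp add: Y.gcls_mult)
    then show "gmap \<eta> (ter X a) (tw X a b) \<otimes>\<^bsub>grp Y ?t\<^esub> telt \<eta> (cmp X a b)
      = telt \<eta> a \<otimes>\<^bsub>grp Y ?t\<^esub> psi Y (emap \<eta> a) (telt \<eta> b)
            \<otimes>\<^bsub>grp Y ?t\<^esub> tw Y (emap \<eta> a) (emap \<eta> b)"
      by (rule Y.gcls_inj[OF dev, rotated -1]) (use v ta p w tab f in simp_all)
  qed (use tc in simp_all)
qed

text \<open>This identifies an induced functor without computing image paths: a functor with the
  right values on generators is enough.\<close>

lemma (in cog_morphism) functor_eq_ind:
  assumes F_mult: "\<And>c d. c \<in> arrows X \<Longrightarrow> d \<in> arrows X \<Longrightarrow> tgt X c = src d \<Longrightarrow> F (c \<cdot>\<^sub>X d) = F c \<cdot>\<^sub>Y F d"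
    and F_inv: "\<And>c. c \<in> arrows X \<Longrightarrow> F (ainv X c) = ainv Y (F c)"
    and F_gcls: "\<And>\<sigma> g. \<sigma> \<in> verts X \<Longrightarrow> g \<in> carrier (grp X \<sigma>) \<Longrightarrow> F (gcls X \<sigma> g) = ind (gcls X \<sigma> g)"
    and F_ecls: "\<And>a. a \<in> edges X \<Longrightarrow> F (ecls X a) = ind (ecls X a)"
    and "c \<in> arrows X"
  shows "ind c = F c"
  using assms(5)
  by (induct rule: X.arrow_induct) (simp_all add: F_mult F_inv F_gcls F_ecls del: ind_ecls ind_gcls)

text \<open>\<open>k\<close> is a natural transformation between the induced functors with components in the local
  groups; this is what a homotopy amounts to.\<close>

definition intertwines where
  "intertwines X Y \<phi> \<eta> k \<longleftrightarrow> (\<forall>\<sigma>\<in>verts X. k \<sigma> \<in> carrier (grp Y (vmap \<phi> \<sigma>))) \<and>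
     (\<forall>c\<in>arrows X. gcls Y (vmap \<phi> (src c)) (k (src c)) \<cdot>\<^sub>Y induced_hom X Y \<phi> c
       = induced_hom X Y \<eta> c \<cdot>\<^sub>Y gcls Y (vmap \<phi> (tgt X c)) (k (tgt X c)))"

text \<open>Naturality squares can be pasted along products and reversed along inverses, so the
  generators suffice.\<close>

lemma intertwinesI:
  assumes "cog_morphism X Y \<phi>" "cog_morphism X Y \<eta>"
    and vm: "\<And>\<sigma>. \<sigma> \<in> verts X \<Longrightarrow> vmap \<eta> \<sigma> = vmap \<phi> \<sigma>"
    and k: "\<And>\<sigma>. \<sigma> \<in> verts X \<Longrightarrow> k \<sigma> \<in> carrier (grp Y (vmap \<phi> \<sigma>))"
    and g: "\<And>\<sigma> g. \<sigma> \<in> verts X \<Longrightarrow> g \<in> carrier (grp X \<sigma>) \<Longrightarrow>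
      gcls Y (vmap \<phi> \<sigma>) (k \<sigma>) \<cdot>\<^sub>Y induced_hom X Y \<phi> (gcls X \<sigma> g)
       = induced_hom X Y \<eta> (gcls X \<sigma> g) \<cdot>\<^sub>Y gcls Y (vmap \<phi> \<sigma>) (k \<sigma>)"
    and e: "\<And>a. a \<in> edges X \<Longrightarrow>
      gcls Y (vmap \<phi> (ini X a)) (k (ini X a)) \<cdot>\<^sub>Y induced_hom X Y \<phi> (ecls X a)
       = induced_hom X Y \<eta> (ecls X a) \<cdot>\<^sub>Y gcls Y (vmap \<phi> (ter X a)) (k (ter X a))"
  shows "intertwines X Y \<phi> \<eta> k"
proof -
  interpret A: cog_morphism X Y \<phi> by fact
  interpret B: cog_morphism X Y \<eta> by fact
  let ?K = "\<lambda>\<sigma>. gcls Y (vmap \<phi> \<sigma>) (k \<sigma>)"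
  let ?P = "\<lambda>c. ?K (src c) \<cdot>\<^sub>Y A.ind c = B.ind c \<cdot>\<^sub>Y ?K (tgt X c)"
  have mult: "?P (c \<cdot>\<^sub>X d)"
    if "?P c" "?P d" "c \<in> arrows X" "d \<in> arrows X" "tgt X c = src d" for c d
  proof -
    have "?K (src c) \<cdot>\<^sub>Y (A.ind c \<cdot>\<^sub>Y A.ind d) = B.ind c \<cdot>\<^sub>Y (?K (tgt X c) \<cdot>\<^sub>Y A.ind d)"
      by (rule A.Y.amult_ext) (use that k vm in simp_all)
    then show ?thesis using that k vm by simp
  qed
  have inv: "?P (ainv X c)" if "?P c" "c \<in> arrows X" for c
  proof -
    have "?K (tgt X c) \<cdot>\<^sub>Y ainv Y (A.ind c)
        = ainv Y (B.ind c) \<cdot>\<^sub>Y ((B.ind c \<cdot>\<^sub>Y ?K (tgt X c)) \<cdot>\<^sub>Y ainv Y (A.ind c))"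
      using that k vm by (simp del: A.ind_ainv B.ind_ainv)
    also have "\<dots> = ainv Y (B.ind c) \<cdot>\<^sub>Y ((?K (src c) \<cdot>\<^sub>Y A.ind c) \<cdot>\<^sub>Y ainv Y (A.ind c))"
      unfolding that(1) ..
    finally show ?thesis using that(2) k vm by simp
  qed
  have "?P c" if "c \<in> arrows X" for c using that
  proof (induct rule: A.X.arrow_induct)
    case (gcls \<sigma> h)
    then show ?case using g[of \<sigma> h] by simp
  next
    case (fwd h a c)
    have 1: "?P (gcls X (ini X a) h)" using g[of "ini X a" h] fwd by simp
    have 2: "?P (ecls X a)" using e[of a] fwd by simp
    show ?case
      by (rule mult[OF 1 mult[OF 2 fwd(5)]]) (use fwd in simp_all)
  next
    case (bwd h a c)
    have 1: "?P (gcls X (ter X a) h)" using g[of "ter X a" h] bwd by simp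
    have "?P (ecls X a)" using e[of a] bwd by simp
    from inv[OF this] have 2: "?P (ainv X (ecls X a))" using bwd by simp
    show ?case
      by (rule mult[OF 1 mult[OF 2 bwd(5)]]) (use bwd in simp_all)
  qed
  then show ?thesis unfolding intertwines_def using k by blast
qed

text \<open>The two formulas defining a homotopy are the naturality squares at local elements and at
  edges. Developability is what permits the return from arrows to elements.\<close>

lemma homotopic_iff_intertwines:
  assumes dev: "developable Y"
  shows "homotopic X Y \<phi> \<eta> \<longleftrightarrow> cog_morphism X Y \<phi> \<and> cog_morphism X Y \<eta> \<and>
     (\<forall>\<sigma>\<in>verts X. vmap \<eta> \<sigma> = vmap \<phi> \<sigma>) \<and> (\<forall>a\<in>edges X. emap \<eta> a = emap \<phi> a) \<and>
     (\<exists>k. intertwines X Y \<phi> \<eta> k)" (is "?L \<longleftrightarrow> ?R")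
proof -
  have "?L \<longleftrightarrow> ?R" if "cog_morphism X Y \<phi>" "cog_morphism X Y \<eta>"
    and vm: "\<And>\<sigma>. \<sigma> \<in> verts X \<Longrightarrow> vmap \<eta> \<sigma> = vmap \<phi> \<sigma>" and em: "\<And>a. a \<in> edges X \<Longrightarrow> emap \<eta> a = emap \<phi> a"
  proof -
    interpret A: cog_morphism X Y \<phi> by fact
    interpret B: cog_morphism X Y \<eta> by fact
    have gB: "gmap \<eta> \<sigma> g \<in> carrier (grp Y (vmap \<phi> \<sigma>))" if "\<sigma> \<in> verts X" "g \<in> carrier (grp X \<sigma>)" for \<sigma> g
      using B.gmap_closed[OF that] vm that by simp
    have tB: "telt \<eta> a \<in> carrier (grp Y (vmap \<phi> (ter X a)))" if "a \<in> edges X" for a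
      using B.telt_closed[OF that] vm that by simp
    have gm: "gmap \<eta> \<sigma> g = conj_by (grp Y (vmap \<phi> \<sigma>)) (k \<sigma>) (gmap \<phi> \<sigma> g) \<longleftrightarrow>
       gcls Y (vmap \<phi> \<sigma>) (k \<sigma>) \<cdot>\<^sub>Y A.ind (gcls X \<sigma> g) = B.ind (gcls X \<sigma> g) \<cdot>\<^sub>Y gcls Y (vmap \<phi> \<sigma>) (k \<sigma>)"
      (is "?l \<longleftrightarrow> ?r")
      if k: "\<And>\<sigma>. \<sigma> \<in> verts X \<Longrightarrow> k \<sigma> \<in> carrier (grp Y (vmap \<phi> \<sigma>))" and \<sigma>: "\<sigma> \<in> verts X"
        and g: "g \<in> carrier (grp X \<sigma>)" for k \<sigma> g
    proof -
      let ?G = "grp Y (vmap \<phi> \<sigma>)"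
      interpret G: group ?G using \<sigma> by (simp add: A.Y.grp_group)
      have "?r \<longleftrightarrow> k \<sigma> \<otimes>\<^bsub>?G\<^esub> gmap \<phi> \<sigma> g = gmap \<eta> \<sigma> g \<otimes>\<^bsub>?G\<^esub> k \<sigma>"
        using k[OF \<sigma>] \<sigma> g gB[OF \<sigma> g] vm[OF \<sigma>] A.Y.gcls_inj[OF dev, of "vmap \<phi> \<sigma>" "k \<sigma> \<otimes>\<^bsub>?G\<^esub> gmap \<phi> \<sigma> g" "gmap \<eta> \<sigma> g \<otimes>\<^bsub>?G\<^esub> k \<sigma>"]
        by (auto simp flip: A.Y.gcls_mult)
      also have "\<dots> \<longleftrightarrow> ?l"
        unfolding conj_by_def using k[OF \<sigma>] gB[OF \<sigma> g] \<sigma> g G.inv_solve_right[of "gmap \<eta> \<sigma> g" "k \<sigma> \<otimes>\<^bsub>?G\<^esub> gmap \<phi> \<sigma> g" "k \<sigma>"]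
        by auto
      finally show ?thesis by simp
    qed
    have te: "telt \<eta> a = k (ter X a) \<otimes>\<^bsub>grp Y (vmap \<phi> (ter X a))\<^esub> telt \<phi> a
               \<otimes>\<^bsub>grp Y (vmap \<phi> (ter X a))\<^esub> psi Y (emap \<phi> a) (inv\<^bsub>grp Y (vmap \<phi> (ini X a))\<^esub> k (ini X a)) \<longleftrightarrow>
       gcls Y (vmap \<phi> (ini X a)) (k (ini X a)) \<cdot>\<^sub>Y A.ind (ecls X a)
       = B.ind (ecls X a) \<cdot>\<^sub>Y gcls Y (vmap \<phi> (ter X a)) (k (ter X a))"
      (is "?l \<longleftrightarrow> ?r")
      if k: "\<And>\<sigma>. \<sigma> \<in> verts X \<Longrightarrow> k \<sigma> \<in> carrier (grp Y (vmap \<phi> \<sigma>))" and a: "a \<in> edges X" for k a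
    proof -
      let ?G = "grp Y (vmap \<phi> (ter X a))" and ?i = "vmap \<phi> (ini X a)" and ?t = "vmap \<phi> (ter X a)"
      let ?p = "psi Y (emap \<phi> a) (k (ini X a))" and ?s = "inv\<^bsub>?G\<^esub> telt \<phi> a" and ?s' = "inv\<^bsub>?G\<^esub> telt \<eta> a"
      interpret G: group ?G using a by (simp add: A.Y.grp_group)
      have ki: "k (ini X a) \<in> carrier (grp Y ?i)" and kt: "k (ter X a) \<in> carrier ?G" using k a by simp_all
      have p: "?p \<in> carrier ?G" using A.Y.psi_closed[of "emap \<phi> a"] a ki by simp
      have pi: "psi Y (emap \<phi> a) (inv\<^bsub>grp Y ?i\<^esub> k (ini X a)) = inv\<^bsub>?G\<^esub> ?p"
        using A.Y.psi_inv[of "emap \<phi> a"] a ki by simp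
      have s: "?s \<in> carrier ?G" "telt \<phi> a \<in> carrier ?G" "?s' \<in> carrier ?G" "telt \<eta> a \<in> carrier ?G"
        using a tB[OF a] by simp_all
      have "gcls Y ?i (k (ini X a)) \<cdot>\<^sub>Y ecls Y (emap \<phi> a) = ecls Y (emap \<phi> a) \<cdot>\<^sub>Y gcls Y ?t ?p"
        using A.Y.gcls_ecls[of "emap \<phi> a" "k (ini X a)"] a ki by simp
      then have "gcls Y ?i (k (ini X a)) \<cdot>\<^sub>Y (ecls Y (emap \<phi> a) \<cdot>\<^sub>Y gcls Y ?t ?s)
          = ecls Y (emap \<phi> a) \<cdot>\<^sub>Y (gcls Y ?t ?p \<cdot>\<^sub>Y gcls Y ?t ?s)"
        by (rule A.Y.amult_ext) (use a ki p s in simp_all)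
      then have l: "gcls Y ?i (k (ini X a)) \<cdot>\<^sub>Y A.ind (ecls X a) = ecls Y (emap \<phi> a) \<cdot>\<^sub>Y gcls Y ?t (?p \<otimes>\<^bsub>?G\<^esub> ?s)"
        using a p s by (simp add: A.Y.gcls_mult)
      have r: "B.ind (ecls X a) \<cdot>\<^sub>Y gcls Y ?t (k (ter X a)) = ecls Y (emap \<phi> a) \<cdot>\<^sub>Y gcls Y ?t (?s' \<otimes>\<^bsub>?G\<^esub> k (ter X a))"
        using a s kt em[OF a] vm[of "ter X a"] by (simp add: A.Y.gcls_mult)
      have "?r \<longleftrightarrow> ?p \<otimes>\<^bsub>?G\<^esub> ?s = ?s' \<otimes>\<^bsub>?G\<^esub> k (ter X a)"
        unfolding l r using a p s kt A.Y.gcls_inj[OF dev, of ?t "?p \<otimes>\<^bsub>?G\<^esub> ?s" "?s' \<otimes>\<^bsub>?G\<^esub> k (ter X a)"] by auto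
      \<comment> \<open>Edge arrows contain the elements of the morphisms inverted, so the
        comparison of local factors is inverted to reach the formula of the definition.\<close>
      also have "\<dots> \<longleftrightarrow> inv\<^bsub>?G\<^esub> (?p \<otimes>\<^bsub>?G\<^esub> ?s) = inv\<^bsub>?G\<^esub> (?s' \<otimes>\<^bsub>?G\<^esub> k (ter X a))"
        using p s kt by (metis G.inv_inv G.m_closed)
      also have "\<dots> \<longleftrightarrow> telt \<phi> a \<otimes>\<^bsub>?G\<^esub> inv\<^bsub>?G\<^esub> ?p = inv\<^bsub>?G\<^esub> k (ter X a) \<otimes>\<^bsub>?G\<^esub> telt \<eta> a"
        using p s kt by (simp add: G.inv_mult_group)
      also have "\<dots> \<longleftrightarrow> telt \<eta> a = k (ter X a) \<otimes>\<^bsub>?G\<^esub> (telt \<phi> a \<otimes>\<^bsub>?G\<^esub> inv\<^bsub>?G\<^esub> ?p)"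
        using p s kt G.inv_solve_left[of "telt \<phi> a \<otimes>\<^bsub>?G\<^esub> inv\<^bsub>?G\<^esub> ?p" "k (ter X a)" "telt \<eta> a"] by auto
      finally show ?thesis unfolding pi using p s kt by (simp add: G.m_assoc)
    qed
    show ?thesis
    proof
      assume ?L
      then obtain k where k: "\<And>\<sigma>. \<sigma> \<in> verts X \<Longrightarrow> k \<sigma> \<in> carrier (grp Y (vmap \<phi> \<sigma>))"
        and g: "\<And>\<sigma> g. \<sigma> \<in> verts X \<Longrightarrow> g \<in> carrier (grp X \<sigma>) \<Longrightarrow>
          gmap \<eta> \<sigma> g = conj_by (grp Y (vmap \<phi> \<sigma>)) (k \<sigma>) (gmap \<phi> \<sigma> g)"
        and e: "\<And>a. a \<in> edges X \<Longrightarrow> telt \<eta> a = k (ter X a) \<otimes>\<^bsub>grp Y (vmap \<phi> (ter X a))\<^esub> telt \<phi> a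
               \<otimes>\<^bsub>grp Y (vmap \<phi> (ter X a))\<^esub> psi Y (emap \<phi> a) (inv\<^bsub>grp Y (vmap \<phi> (ini X a))\<^esub> k (ini X a))"
        unfolding homotopic_def by blast
      have "intertwines X Y \<phi> \<eta> k"
      proof (rule intertwinesI[OF \<open>cog_morphism X Y \<phi>\<close> \<open>cog_morphism X Y \<eta>\<close> vm k], goal_cases)
        case (3 \<sigma> h)
        then show ?case using gm[OF k 3] g[OF 3] by blast
      next
        case (4 a)
        then show ?case using te[OF k 4] e[OF 4] by blast
      qed
      then show ?R using that by blast
    next
      assume ?R
      then obtain k where "intertwines X Y \<phi> \<eta> k" by blast
      then have k: "\<And>\<sigma>. \<sigma> \<in> verts X \<Longrightarrow> k \<sigma> \<in> carrier (grp Y (vmap \<phi> \<sigma>))"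
        and K: "\<And>c. c \<in> arrows X \<Longrightarrow> gcls Y (vmap \<phi> (src c)) (k (src c)) \<cdot>\<^sub>Y A.ind c
          = B.ind c \<cdot>\<^sub>Y gcls Y (vmap \<phi> (tgt X c)) (k (tgt X c))"
        unfolding intertwines_def by blast+
      have "gmap \<eta> \<sigma> g = conj_by (grp Y (vmap \<phi> \<sigma>)) (k \<sigma>) (gmap \<phi> \<sigma> g)"
        if "\<sigma> \<in> verts X" "g \<in> carrier (grp X \<sigma>)" for \<sigma> g
        by (rule gm[OF k that, THEN iffD2]) (use K[of "gcls X \<sigma> g"] that in simp_all)
      moreover have "telt \<eta> a = k (ter X a) \<otimes>\<^bsub>grp Y (vmap \<phi> (ter X a))\<^esub> telt \<phi> a
               \<otimes>\<^bsub>grp Y (vmap \<phi> (ter X a))\<^esub> psi Y (emap \<phi> a) (inv\<^bsub>grp Y (vmap \<phi> (ini X a))\<^esub> k (ini X a))"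
        if "a \<in> edges X" for a
        by (rule te[OF k that, THEN iffD2]) (use K[of "ecls X a"] that in simp_all)
      ultimately show ?L unfolding homotopic_def using that k by blast
    qed
  qed
  then show ?thesis unfolding homotopic_def by blast
qed

section \<open>Composition of morphisms\<close>

lemma cog_compose_simps [simp]:
  "vmap (cog_compose U Z \<eta> \<phi>) \<sigma> = vmap \<eta> (vmap \<phi> \<sigma>)"
  "emap (cog_compose U Z \<eta> \<phi>) a = emap \<eta> (emap \<phi> a)"
  "gmap (cog_compose U Z \<eta> \<phi>) \<sigma> g = gmap \<eta> (vmap \<phi> \<sigma>) (gmap \<phi> \<sigma> g)"
  "telt (cog_compose U Z \<eta> \<phi>) a = gmap \<eta> (vmap \<phi> (ter U a)) (telt \<phi> a)
     \<otimes>\<^bsub>grp Z (vmap \<eta> (vmap \<phi> (ter U a)))\<^esub> telt \<eta> (emap \<phi> a)"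
  by (simp_all add: cog_compose_def)

lemma scwol_morphism_compose:
  assumes "scwol_morphism U X \<phi>" "scwol_morphism X Y \<eta>"
    and vm: "\<And>\<sigma>. vmap \<psi> \<sigma> = vmap \<eta> (vmap \<phi> \<sigma>)" and em: "\<And>a. emap \<psi> a = emap \<eta> (emap \<phi> a)"
  shows "scwol_morphism U Y \<psi>"
proof -
  interpret A: scwol_morphism U X \<phi> by fact
  interpret B: scwol_morphism X Y \<eta> by fact
  show ?thesis
  proof
    fix \<sigma> assume "\<sigma> \<in> verts U"
    then have "bij_betw (emap \<eta> \<circ> emap \<phi>) {a \<in> edges U. ini U a = \<sigma>}
        {a' \<in> edges Y. ini Y a' = vmap \<eta> (vmap \<phi> \<sigma>)}"
      using A.emap_bij B.emap_bij A.vmap_closed by (blast intro: bij_betw_trans)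
    moreover have "emap \<psi> = emap \<eta> \<circ> emap \<phi>" using em by auto
    ultimately show "bij_betw (emap \<psi>) {a \<in> edges U. ini U a = \<sigma>} {a' \<in> edges Y. ini Y a' = vmap \<psi> \<sigma>}"
      by (simp add: vm)
  next
    fix a b assume ab: "(a, b) \<in> E2 U"
    then have "(emap \<phi> a, emap \<phi> b) \<in> E2 X"
      by (auto simp: E2_def A.emap_closed A.ini_emap A.ter_emap)
    then show "emap \<psi> (cmp U a b) = cmp Y (emap \<psi> a) (emap \<psi> b)"
      using ab by (simp add: em A.emap_cmp B.emap_cmp)
  qed (simp_all add: vm em A.vmap_closed B.vmap_closed A.emap_closed B.emap_closed
      A.ini_emap B.ini_emap A.ter_emap B.ter_emap)
qed

text \<open>The composite of the two functors has the values on generators prescribed by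
  \<open>cog_compose\<close>. This gives the axioms through \<open>cog_morphismI\<close> and then
  identifies the induced functor.\<close>

lemma cog_morphism_compose:
  assumes "cog_morphism U X \<phi>" "cog_morphism X Y \<eta>" "developable Y"
  shows "cog_morphism U Y (cog_compose U Y \<eta> \<phi>)" (is ?m)
    and "c \<in> arrows U \<Longrightarrow>
      induced_hom U Y (cog_compose U Y \<eta> \<phi>) c = induced_hom X Y \<eta> (induced_hom U X \<phi> c)"
proof -
  interpret A: cog_morphism U X \<phi> by fact
  interpret B: cog_morphism X Y \<eta> by fact
  let ?F = "\<lambda>c. B.ind (A.ind c)"
  have gc: "?F (gcls U \<sigma> g) = gcls Y (vmap \<eta> (vmap \<phi> \<sigma>)) (gmap \<eta> (vmap \<phi> \<sigma>) (gmap \<phi> \<sigma> g))"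
    if "\<sigma> \<in> verts U" "g \<in> carrier (grp U \<sigma>)" for \<sigma> g
    using that by simp
  have ec: "?F (ecls U a) = ecls Y (emap \<eta> (emap \<phi> a)) \<cdot>\<^sub>Y
      gcls Y (vmap \<eta> (vmap \<phi> (ter U a))) (inv\<^bsub>grp Y (vmap \<eta> (vmap \<phi> (ter U a)))\<^esub>
        telt (cog_compose U Y \<eta> \<phi>) a)" if a: "a \<in> edges U" for a
  proof -
    let ?T = "grp Y (vmap \<eta> (vmap \<phi> (ter U a)))"
    interpret T: group ?T using a by (simp add: B.Y.grp_group)
    have t: "telt \<eta> (emap \<phi> a) \<in> carrier ?T" using B.telt_closed[of "emap \<phi> a"] a by simp
    then show ?thesis using a
      by (simp add: B.Y.gcls_mult T.inv_mult_group)
  qed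
  show m: ?m
  proof (rule cog_morphismI[where F = ?F])
    show "scwol_morphism U Y (cog_compose U Y \<eta> \<phi>)"
      by (rule scwol_morphism_compose[OF A.scwol_morphism_axioms B.scwol_morphism_axioms]) simp_all
    fix a assume a: "a \<in> edges U"
    have "telt \<eta> (emap \<phi> a) \<in> carrier (grp Y (vmap \<eta> (vmap \<phi> (ter U a))))"
      using B.telt_closed[of "emap \<phi> a"] a by simp
    then show "telt (cog_compose U Y \<eta> \<phi>) a \<in> carrier (grp Y (vmap (cog_compose U Y \<eta> \<phi>) (ter U a)))"
      using a by simp
    show "?F (ecls U a) = ecls Y (emap (cog_compose U Y \<eta> \<phi>) a) \<cdot>\<^sub>Y
      gcls Y (vmap (cog_compose U Y \<eta> \<phi>) (ter U a)) (inv\<^bsub>grp Y (vmap (cog_compose U Y \<eta> \<phi>) (ter U a))\<^esub>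
        telt (cog_compose U Y \<eta> \<phi>) a)"
      using ec[OF a] by simp
  qed (use assms A.X.complex_of_groups_axioms B.Y.complex_of_groups_axioms in simp_all)
  show "induced_hom U Y (cog_compose U Y \<eta> \<phi>) c = ?F c" if "c \<in> arrows U"
  proof -
    interpret M: cog_morphism U Y "cog_compose U Y \<eta> \<phi>" by (rule m)
    show ?thesis
    proof (rule M.functor_eq_ind[OF _ _ _ _ that])
      fix a assume a: "a \<in> edges U"
      show "?F (ecls U a) = M.ind (ecls U a)"
        unfolding ec[OF a] M.ind_ecls[OF a] by simp
    qed simp_all
  qed
qed

section \<open>Homotopy as an equivalence relation compatible with composition\<close>

lemma homotopic_refl:
  assumes "cog_morphism X Y \<phi>" "developable Y" shows "homotopic X Y \<phi> \<phi>"
proof -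
  interpret cog_morphism X Y \<phi> by fact
  have "intertwines X Y \<phi> \<phi> (\<lambda>\<sigma>. \<one>\<^bsub>grp Y (vmap \<phi> \<sigma>)\<^esub>)"
    unfolding intertwines_def by simp
  then show ?thesis using assms by (auto simp: homotopic_iff_intertwines)
qed

lemma homotopic_sym:
  assumes "homotopic X Y \<phi> \<eta>" "developable Y" shows "homotopic X Y \<eta> \<phi>"
proof -
  have "cog_morphism X Y \<phi>" "cog_morphism X Y \<eta>" using assms by (auto simp: homotopic_def)
  interpret A: cog_morphism X Y \<phi> by fact
  interpret B: cog_morphism X Y \<eta> by fact
  have vm: "vmap \<eta> \<sigma> = vmap \<phi> \<sigma>" if "\<sigma> \<in> verts X" for \<sigma> using assms that by (simp add: homotopic_def)
  obtain k where "intertwines X Y \<phi> \<eta> k" using assms by (auto simp: homotopic_iff_intertwines)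
  then have k: "\<And>\<sigma>. \<sigma> \<in> verts X \<Longrightarrow> k \<sigma> \<in> carrier (grp Y (vmap \<phi> \<sigma>))"
    and K: "\<And>c. c \<in> arrows X \<Longrightarrow> gcls Y (vmap \<phi> (src c)) (k (src c)) \<cdot>\<^sub>Y A.ind c
      = B.ind c \<cdot>\<^sub>Y gcls Y (vmap \<phi> (tgt X c)) (k (tgt X c))"
    unfolding intertwines_def by blast+
  have "intertwines X Y \<eta> \<phi> (\<lambda>\<sigma>. inv\<^bsub>grp Y (vmap \<phi> \<sigma>)\<^esub> k \<sigma>)"
    unfolding intertwines_def
  proof (intro conjI ballI)
    fix c assume c: "c \<in> arrows X"
    let ?s = "gcls Y (vmap \<phi> (src c)) (k (src c))" and ?t = "gcls Y (vmap \<phi> (tgt X c)) (k (tgt X c))"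
    have "ainv Y ?s \<cdot>\<^sub>Y ((B.ind c \<cdot>\<^sub>Y ?t) \<cdot>\<^sub>Y ainv Y ?t) = A.ind c \<cdot>\<^sub>Y ainv Y ?t"
      unfolding K[OF c, symmetric] using c k by simp
    then show "gcls Y (vmap \<eta> (src c)) (inv\<^bsub>grp Y (vmap \<phi> (src c))\<^esub> k (src c)) \<cdot>\<^sub>Y B.ind c
        = A.ind c \<cdot>\<^sub>Y gcls Y (vmap \<eta> (tgt X c)) (inv\<^bsub>grp Y (vmap \<phi> (tgt X c))\<^esub> k (tgt X c))"
      using c k vm by (simp add: A.Y.gcls_inv)
  qed (use k vm in simp)
  then show ?thesis using assms by (auto simp: homotopic_iff_intertwines)
qed

lemma homotopic_trans:
  assumes "homotopic X Y \<phi> \<eta>" "homotopic X Y \<eta> \<theta>" "developable Y" shows "homotopic X Y \<phi> \<theta>"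
proof -
  have m: "cog_morphism X Y \<phi>" "cog_morphism X Y \<eta>" "cog_morphism X Y \<theta>"
    using assms by (auto simp: homotopic_def)
  interpret A: cog_morphism X Y \<phi> by fact
  interpret B: cog_morphism X Y \<eta> by fact
  interpret C: cog_morphism X Y \<theta> by fact
  have vm: "vmap \<eta> \<sigma> = vmap \<phi> \<sigma>" "vmap \<theta> \<sigma> = vmap \<phi> \<sigma>" if "\<sigma> \<in> verts X" for \<sigma>
    using assms that by (simp_all add: homotopic_def)
  obtain k l where "intertwines X Y \<phi> \<eta> k" "intertwines X Y \<eta> \<theta> l"
    using assms by (auto simp: homotopic_iff_intertwines)
  then have k: "\<And>\<sigma>. \<sigma> \<in> verts X \<Longrightarrow> k \<sigma> \<in> carrier (grp Y (vmap \<phi> \<sigma>))"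
    and K: "\<And>c. c \<in> arrows X \<Longrightarrow> gcls Y (vmap \<phi> (src c)) (k (src c)) \<cdot>\<^sub>Y A.ind c
      = B.ind c \<cdot>\<^sub>Y gcls Y (vmap \<phi> (tgt X c)) (k (tgt X c))"
    and l: "\<And>\<sigma>. \<sigma> \<in> verts X \<Longrightarrow> l \<sigma> \<in> carrier (grp Y (vmap \<phi> \<sigma>))"
    and L: "\<And>c. c \<in> arrows X \<Longrightarrow> gcls Y (vmap \<phi> (src c)) (l (src c)) \<cdot>\<^sub>Y B.ind c
      = C.ind c \<cdot>\<^sub>Y gcls Y (vmap \<phi> (tgt X c)) (l (tgt X c))"
    unfolding intertwines_def by (simp_all add: vm)
  have "intertwines X Y \<phi> \<theta> (\<lambda>\<sigma>. l \<sigma> \<otimes>\<^bsub>grp Y (vmap \<phi> \<sigma>)\<^esub> k \<sigma>)"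
    unfolding intertwines_def
  proof (intro conjI ballI)
    fix c assume c: "c \<in> arrows X"
    let ?ks = "gcls Y (vmap \<phi> (src c)) (k (src c))" and ?kt = "gcls Y (vmap \<phi> (tgt X c)) (k (tgt X c))"
    let ?ls = "gcls Y (vmap \<phi> (src c)) (l (src c))" and ?lt = "gcls Y (vmap \<phi> (tgt X c)) (l (tgt X c))"
    have "?ls \<cdot>\<^sub>Y (?ks \<cdot>\<^sub>Y A.ind c) = (?ls \<cdot>\<^sub>Y B.ind c) \<cdot>\<^sub>Y ?kt"
      unfolding K[OF c] using c k l vm by simp
    also have "\<dots> = C.ind c \<cdot>\<^sub>Y (?lt \<cdot>\<^sub>Y ?kt)"
      unfolding L[OF c] using c k l vm by simp
    finally show "gcls Y (vmap \<phi> (src c)) (l (src c) \<otimes>\<^bsub>grp Y (vmap \<phi> (src c))\<^esub> k (src c)) \<cdot>\<^sub>Y A.ind c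
        = C.ind c \<cdot>\<^sub>Y gcls Y (vmap \<phi> (tgt X c)) (l (tgt X c) \<otimes>\<^bsub>grp Y (vmap \<phi> (tgt X c))\<^esub> k (tgt X c))"
      using c k l vm by (simp add: A.Y.gcls_mult)
  qed (use k l in simp)
  then show ?thesis using assms m vm by (auto simp: homotopic_iff_intertwines)
qed

lemma mor_class_eq_iff:
  assumes "cog_morphism X Y \<phi>" "cog_morphism X Y \<eta>" "developable Y"
  shows "mor_class X Y \<phi> = mor_class X Y \<eta> \<longleftrightarrow> homotopic X Y \<phi> \<eta>"
  unfolding mor_class_def using assms homotopic_refl homotopic_sym homotopic_trans by blast

text \<open>Horizontal composition of natural transformations: the component at \<sigma> is the
  component of the outer homotopy at the image vertex times the image of the component of the inner
  one.\<close>

lemma homotopic_compose: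
  assumes "homotopic U X \<phi> \<phi>'" "homotopic X Y \<eta> \<eta>'" "developable X" "developable Y"
  shows "homotopic U Y (cog_compose U Y \<eta> \<phi>) (cog_compose U Y \<eta>' \<phi>')"
proof -
  have m: "cog_morphism U X \<phi>" "cog_morphism U X \<phi>'" "cog_morphism X Y \<eta>" "cog_morphism X Y \<eta>'"
    using assms by (auto simp: homotopic_def)
  interpret A: cog_morphism U X \<phi> by fact
  interpret A': cog_morphism U X \<phi>' by fact
  interpret B: cog_morphism X Y \<eta> by fact
  interpret B': cog_morphism X Y \<eta>' by fact
  have vm: "vmap \<phi>' \<sigma> = vmap \<phi> \<sigma>" if "\<sigma> \<in> verts U" for \<sigma> using assms that by (simp add: homotopic_def)
  have vm': "vmap \<eta>' \<sigma> = vmap \<eta> \<sigma>" if "\<sigma> \<in> verts X" for \<sigma> using assms that by (simp add: homotopic_def)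
  obtain k l where "intertwines U X \<phi> \<phi>' l" "intertwines X Y \<eta> \<eta>' k"
    using assms by (auto simp: homotopic_iff_intertwines)
  then have k: "\<And>\<sigma>. \<sigma> \<in> verts X \<Longrightarrow> k \<sigma> \<in> carrier (grp Y (vmap \<eta> \<sigma>))"
    and K: "\<And>c. c \<in> arrows X \<Longrightarrow> gcls Y (vmap \<eta> (src c)) (k (src c)) \<cdot>\<^sub>Y B.ind c
      = B'.ind c \<cdot>\<^sub>Y gcls Y (vmap \<eta> (tgt X c)) (k (tgt X c))"
    and l: "\<And>\<sigma>. \<sigma> \<in> verts U \<Longrightarrow> l \<sigma> \<in> carrier (grp X (vmap \<phi> \<sigma>))"
    and L: "\<And>c. c \<in> arrows U \<Longrightarrow> gcls X (vmap \<phi> (src c)) (l (src c)) \<cdot>\<^sub>X A.ind c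
      = A'.ind c \<cdot>\<^sub>X gcls X (vmap \<phi> (tgt U c)) (l (tgt U c))"
    unfolding intertwines_def by blast+
  have "intertwines U Y (cog_compose U Y \<eta> \<phi>) (cog_compose U Y \<eta>' \<phi>')
    (\<lambda>\<sigma>. k (vmap \<phi> \<sigma>) \<otimes>\<^bsub>grp Y (vmap \<eta> (vmap \<phi> \<sigma>))\<^esub> gmap \<eta> (vmap \<phi> \<sigma>) (l \<sigma>))"
    unfolding intertwines_def
  proof (intro conjI ballI)
    fix c assume c: "c \<in> arrows U"
    let ?ls = "gcls X (vmap \<phi> (src c)) (l (src c))" and ?lt = "gcls X (vmap \<phi> (tgt U c)) (l (tgt U c))"
    let ?ks = "gcls Y (vmap \<eta> (vmap \<phi> (src c))) (k (vmap \<phi> (src c)))"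
      and ?kt = "gcls Y (vmap \<eta> (vmap \<phi> (tgt U c))) (k (vmap \<phi> (tgt U c)))"
    have "?ks \<cdot>\<^sub>Y (B.ind ?ls \<cdot>\<^sub>Y B.ind (A.ind c)) = ?ks \<cdot>\<^sub>Y B.ind (?ls \<cdot>\<^sub>X A.ind c)"
      using c l by simp
    also have "\<dots> = (?ks \<cdot>\<^sub>Y B.ind (A'.ind c)) \<cdot>\<^sub>Y B.ind ?lt"
      unfolding L[OF c] using c l k vm by simp
    also have "?ks \<cdot>\<^sub>Y B.ind (A'.ind c) = B'.ind (A'.ind c) \<cdot>\<^sub>Y ?kt"
      using K[of "A'.ind c"] c vm by simp
    finally have "?ks \<cdot>\<^sub>Y (B.ind ?ls \<cdot>\<^sub>Y B.ind (A.ind c)) = B'.ind (A'.ind c) \<cdot>\<^sub>Y (?kt \<cdot>\<^sub>Y B.ind ?lt)"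
      using c l k vm vm' by simp
    then show "gcls Y (vmap (cog_compose U Y \<eta> \<phi>) (src c))
          (k (vmap \<phi> (src c)) \<otimes>\<^bsub>grp Y (vmap \<eta> (vmap \<phi> (src c)))\<^esub> gmap \<eta> (vmap \<phi> (src c)) (l (src c)))
          \<cdot>\<^sub>Y induced_hom U Y (cog_compose U Y \<eta> \<phi>) c
        = induced_hom U Y (cog_compose U Y \<eta>' \<phi>') c \<cdot>\<^sub>Y gcls Y (vmap (cog_compose U Y \<eta> \<phi>) (tgt U c))
          (k (vmap \<phi> (tgt U c)) \<otimes>\<^bsub>grp Y (vmap \<eta> (vmap \<phi> (tgt U c)))\<^esub> gmap \<eta> (vmap \<phi> (tgt U c)) (l (tgt U c)))"
      using c l k assms(4) m by (simp add: cog_morphism_compose(2) B.Y.gcls_mult)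
  qed (use k l in simp)
  moreover have "emap \<phi>' a = emap \<phi> a" if "a \<in> edges U" for a using assms that by (simp add: homotopic_def)
  moreover have "emap \<eta>' a = emap \<eta> a" if "a \<in> edges X" for a using assms that by (simp add: homotopic_def)
  ultimately show ?thesis
    using m assms(4) vm vm' by (auto simp: homotopic_iff_intertwines cog_morphism_compose(1))
qed

section \<open>The identity and automorphisms\<close>

lemma cog_id_simps [simp]:
  "vmap (cog_id X) \<sigma> = \<sigma>" "emap (cog_id X) a = a" "gmap (cog_id X) \<sigma> g = g"
  "telt (cog_id X) a = \<one>\<^bsub>grp X (ter X a)\<^esub>"
  by (simp_all add: cog_id_def)

lemma cog_morphism_id:
  assumes "complex_of_groups X" "developable X"
  shows "cog_morphism X X (cog_id X)" (is ?m)
    and "c \<in> arrows X \<Longrightarrow> induced_hom X X (cog_id X) c = c"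
proof -
  interpret complex_of_groups X by fact
  show m: ?m
  proof (rule cog_morphismI[where F = "\<lambda>c. c"])
    show "scwol_morphism X X (cog_id X)"
      by unfold_locales (auto simp: bij_betw_def inj_on_def)
  qed (use assms in simp_all)
  show "induced_hom X X (cog_id X) c = c" if "c \<in> arrows X"
  proof -
    interpret M: cog_morphism X X "cog_id X" by (rule m)
    show ?thesis by (rule M.functor_eq_ind[OF _ _ _ _ that]) simp_all
  qed
qed

lemma cog_id_Aut: "complex_of_groups X \<Longrightarrow> developable X \<Longrightarrow> cog_id X \<in> Aut X"
  using cog_morphism_id(1)[of X] cog_morphism.axioms(3)[of X X "cog_id X"]
  by (auto simp: Aut_def scwol_iso_def iso_def hom_def bij_betw_def inj_on_def image_def)

lemma Aut_compose:
  assumes "\<eta> \<in> Aut X" "\<theta> \<in> Aut X" "developable X"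
  shows "cog_compose X X \<eta> \<theta> \<in> Aut X"
proof -
  have m: "cog_morphism X X \<eta>" "cog_morphism X X \<theta>" using assms by (auto simp: Aut_def)
  interpret A: cog_morphism X X \<eta> by fact
  interpret B: cog_morphism X X \<theta> by fact
  note mm = cog_morphism_compose(1)[OF m(2,1) assms(3)]
  interpret M: cog_morphism X X "cog_compose X X \<eta> \<theta>" by (rule mm)
  have "bij_betw (vmap \<eta> \<circ> vmap \<theta>) (verts X) (verts X)" "bij_betw (emap \<eta> \<circ> emap \<theta>) (edges X) (edges X)"
    using assms by (auto simp: Aut_def scwol_iso_def intro: bij_betw_trans)
  moreover have "gmap \<eta> (vmap \<theta> \<sigma>) \<circ> gmap \<theta> \<sigma> \<in> iso (grp X \<sigma>) (grp X (vmap \<eta> (vmap \<theta> \<sigma>)))"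
    if "\<sigma> \<in> verts X" for \<sigma>
  proof -
    have "gmap \<theta> \<sigma> \<in> iso (grp X \<sigma>) (grp X (vmap \<theta> \<sigma>))"
      "gmap \<eta> (vmap \<theta> \<sigma>) \<in> iso (grp X (vmap \<theta> \<sigma>)) (grp X (vmap \<eta> (vmap \<theta> \<sigma>)))"
      using that assms by (simp_all add: Aut_def)
    then show ?thesis by (rule iso_set_trans)
  qed
  moreover have "vmap (cog_compose X X \<eta> \<theta>) = vmap \<eta> \<circ> vmap \<theta>"
    "emap (cog_compose X X \<eta> \<theta>) = emap \<eta> \<circ> emap \<theta>"
    "gmap (cog_compose X X \<eta> \<theta>) \<sigma> = gmap \<eta> (vmap \<theta> \<sigma>) \<circ> gmap \<theta> \<sigma>" for \<sigma>
    by auto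
  ultimately show ?thesis
    using mm M.scwol_morphism_axioms by (simp add: Aut_def scwol_iso_def)
qed

text \<open>The induction resembles that for coverings, but the local maps of an automorphism are
  onto, so each error is absorbed by an element of the source and no remainder is left. The factor
  \<open>k\<close> is there for forward edges, which hand their element on to the rest of the
  arrow.\<close>

lemma Aut_lift_translate:
  assumes "\<eta> \<in> Aut X" and "d \<in> arrows X" "\<sigma> \<in> verts X" "src d = vmap \<eta> \<sigma>" "k \<in> carrier (grp X (vmap \<eta> \<sigma>))"
  shows "\<exists>c. c \<in> arrows X \<and> src c = \<sigma> \<and> induced_hom X X \<eta> c = gcls X (vmap \<eta> \<sigma>) k \<cdot>\<^sub>X d"
proof -
  interpret cog_morphism X X \<eta> using assms by (simp add: Aut_def)
  have bij: "bij_betw (vmap \<eta>) (verts X) (verts X)" "bij_betw (emap \<eta>) (edges X) (edges X)"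
    using assms(1) by (auto simp: Aut_def scwol_iso_def)
  have im: "gmap \<eta> \<sigma> ` carrier (grp X \<sigma>) = carrier (grp X (vmap \<eta> \<sigma>))" if "\<sigma> \<in> verts X" for \<sigma>
    using assms(1) that by (simp add: Aut_def iso_def bij_betw_def)
  have gs: "\<exists>h\<in>carrier (grp X \<sigma>). gmap \<eta> \<sigma> h = g"
    if "\<sigma> \<in> verts X" "g \<in> carrier (grp X (vmap \<eta> \<sigma>))" for \<sigma> g
    using that(2) unfolding im[OF that(1), symmetric] by blast
  show ?thesis using assms(2-)
  proof (induct arbitrary: \<sigma> k rule: X.arrow_induct)
    case (gcls \<tau> g)
    obtain h where "h \<in> carrier (grp X \<sigma>)" "gmap \<eta> \<sigma> h = k \<otimes>\<^bsub>grp X (vmap \<eta> \<sigma>)\<^esub> g"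
      using gs[OF gcls(3), of "k \<otimes>\<^bsub>grp X (vmap \<eta> \<sigma>)\<^esub> g"] gcls by auto
    then show ?case using gcls by (intro exI[of _ "gcls X \<sigma> h"]) (simp add: X.gcls_mult)
  next
    case (fwd g a' c)
    have ini: "ini X a' = vmap \<eta> \<sigma>" using fwd by simp
    obtain a where a: "a \<in> edges X" "ini X a = \<sigma>" "emap \<eta> a = a'"
      using ex_edge_lift[OF fwd(6,1) ini] by auto
    have t: "ter X a' = vmap \<eta> (ter X a)" using a ter_emap[of a] by simp
    obtain h where h: "h \<in> carrier (grp X \<sigma>)" "gmap \<eta> \<sigma> h = k \<otimes>\<^bsub>grp X (vmap \<eta> \<sigma>)\<^esub> g"
      using gs[OF fwd(6), of "k \<otimes>\<^bsub>grp X (vmap \<eta> \<sigma>)\<^esub> g"] fwd ini by auto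
    obtain x where x: "x \<in> arrows X" "src x = ter X a"
      "ind x = gcls X (vmap \<eta> (ter X a)) (telt \<eta> a) \<cdot>\<^sub>X c"
      using fwd(5)[of "ter X a" "telt \<eta> a"] fwd(4) a t by auto
    have "ind (gcls X \<sigma> h \<cdot>\<^sub>X (ecls X a \<cdot>\<^sub>X x))
      = gcls X (vmap \<eta> \<sigma>) k \<cdot>\<^sub>X (gcls X (ini X a') g \<cdot>\<^sub>X (ecls X a' \<cdot>\<^sub>X c))"
      using a h x fwd ini t by (simp add: X.gcls_mult)
    then show ?case using a h x fwd by (intro exI[of _ "gcls X \<sigma> h \<cdot>\<^sub>X (ecls X a \<cdot>\<^sub>X x)"]) simp
  next
    case (bwd g a' c)
    have ter: "ter X a' = vmap \<eta> \<sigma>" using bwd by simp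
    have "a' \<in> emap \<eta> ` edges X" using bij_betw_imp_surj_on[OF bij(2)] bwd(1) by simp
    then obtain a where a: "a \<in> edges X" "emap \<eta> a = a'" by (auto elim!: imageE)
    then have "vmap \<eta> (ter X a) = vmap \<eta> \<sigma>" using ter ter_emap[of a] by simp
    then have ta: "ter X a = \<sigma>"
      by (rule inj_onD[OF bij_betw_imp_inj_on[OF bij(1)]]) (use a bwd(6) in simp_all)
    have i: "ini X a' = vmap \<eta> (ini X a)" using a ini_emap[of a] by simp
    have te: "telt \<eta> a \<in> carrier (grp X (vmap \<eta> \<sigma>))" using telt_closed[OF a(1)] ta by simp
    \<comment> \<open>The image of the inverse edge starts with \<open>telt \<eta> a\<close>; the
      last factor of \<open>?g\<close> cancels it.\<close>
    let ?g = "k \<otimes>\<^bsub>grp X (vmap \<eta> \<sigma>)\<^esub> g \<otimes>\<^bsub>grp X (vmap \<eta> \<sigma>)\<^esub> inv\<^bsub>grp X (vmap \<eta> \<sigma>)\<^esub> telt \<eta> a"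
    obtain h where h: "h \<in> carrier (grp X \<sigma>)" "gmap \<eta> \<sigma> h = ?g"
      using gs[OF bwd(6), of ?g] bwd ter te by auto
    obtain x where x: "x \<in> arrows X" "src x = ini X a" "ind x = c"
      using bwd(5)[of "ini X a" "\<one>\<^bsub>grp X (vmap \<eta> (ini X a))\<^esub>"] bwd(3,4) a i by auto
    have tx: "src c = vmap \<eta> (ini X a)" using bwd i by simp
    have "ind (gcls X \<sigma> h \<cdot>\<^sub>X (ainv X (ecls X a) \<cdot>\<^sub>X x))
      = gcls X (vmap \<eta> \<sigma>) k \<cdot>\<^sub>X (gcls X (ter X a') g \<cdot>\<^sub>X (ainv X (ecls X a') \<cdot>\<^sub>X c))"
      using a h x bwd ter te ta tx i by (simp add: X.gcls_mult X.gcls_inv)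
    then show ?case using a h x bwd ta by (intro exI[of _ "gcls X \<sigma> h \<cdot>\<^sub>X (ainv X (ecls X a) \<cdot>\<^sub>X x)"]) simp
  qed
qed

lemma Aut_induced_full:
  assumes "\<eta> \<in> Aut X" "d \<in> arrows X" "\<sigma> \<in> verts X" "\<sigma>' \<in> verts X" "src d = vmap \<eta> \<sigma>" "tgt X d = vmap \<eta> \<sigma>'"
  obtains c where "c \<in> arrows X" "src c = \<sigma>" "tgt X c = \<sigma>'" "induced_hom X X \<eta> c = d"
proof -
  interpret cog_morphism X X \<eta> using assms by (simp add: Aut_def)
  obtain c where c: "c \<in> arrows X" "src c = \<sigma>" "ind c = d"
    using Aut_lift_translate[OF assms(1,2,3,5), of "\<one>\<^bsub>grp X (vmap \<eta> \<sigma>)\<^esub>"] assms by auto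
  then have "vmap \<eta> (tgt X c) = vmap \<eta> \<sigma>'" using assms ind_typing(3)[of c] by simp
  moreover have "inj_on (vmap \<eta>) (verts X)"
    using assms(1) by (simp add: Aut_def scwol_iso_def bij_betw_def)
  ultimately have "tgt X c = \<sigma>'" using assms(4) c by (simp add: inj_on_eq_iff)
  then show ?thesis using that c by blast
qed

section \<open>The kernel of the action on the universal complex\<close>

context complex_of_groups
begin

lemma xpaths_fromD: "p \<in> xpaths_from X \<sigma> \<Longrightarrow> is_xpath X p \<and> xini p = \<sigma>"
  by (simp add: xpaths_from_def)

text \<open>The relation on the right is an equivalence on paths starting at \<sigma>. Related paths
  end at the same vertex, which is what lets the local elements be inverted and multiplied.\<close>

lemma univ_class_eq_iff:
  assumes "p \<in> xpaths_from X \<sigma>" "q \<in> xpaths_from X \<sigma>"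
  shows "univ_class X \<sigma> p = univ_class X \<sigma> q \<longleftrightarrow>
    (\<exists>g\<in>carrier (grp X (xter X p)). path_class X q = path_class X p \<cdot>\<^sub>X gcls X (xter X p) g)"
    (is "_ \<longleftrightarrow> ?R p q")
proof -
  have e: "univ_equiv X p q \<longleftrightarrow> ?R p q" if "is_xpath X p" for p q
    unfolding univ_equiv_def gcls_def using that by simp
  have mem: "q \<in> univ_class X \<sigma> p \<longleftrightarrow> ?R p q" if "p \<in> xpaths_from X \<sigma>" "q \<in> xpaths_from X \<sigma>" for p q
    using that e[of p q] xpaths_fromD[OF that(1)] by (simp add: univ_class_def)
  have refl: "?R p p" if "p \<in> xpaths_from X \<sigma>" for p
    using xpaths_fromD[OF that] by (intro bexI[of _ "\<one>\<^bsub>grp X (xter X p)\<^esub>"]) simp_all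
  have tq: "xter X q = xter X p" if p: "p \<in> xpaths_from X \<sigma>" and q: "q \<in> xpaths_from X \<sigma>" and r: "?R p q" for p q
  proof -
    obtain g where g: "g \<in> carrier (grp X (xter X p))" "path_class X q = path_class X p \<cdot>\<^sub>X gcls X (xter X p) g"
      using r by blast
    show ?thesis
      using arg_cong[OF g(2), of "tgt X"] xpaths_fromD[OF p] xpaths_fromD[OF q] g(1) by simp
  qed
  have sym: "?R q p" if p: "p \<in> xpaths_from X \<sigma>" and q: "q \<in> xpaths_from X \<sigma>" and r: "?R p q" for p q
  proof -
    obtain g where g: "g \<in> carrier (grp X (xter X p))" "path_class X q = path_class X p \<cdot>\<^sub>X gcls X (xter X p) g"
      using r by blast
    have "path_class X p = path_class X q \<cdot>\<^sub>X gcls X (xter X p) (inv\<^bsub>grp X (xter X p)\<^esub> g)"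
      unfolding g(2) using xpaths_fromD[OF p] g(1) by (simp add: gcls_inv_gcls)
    then show ?thesis using g(1) tq[OF p q r] xpaths_fromD[OF p]
      by (intro bexI[of _ "inv\<^bsub>grp X (xter X p)\<^esub> g"]) simp_all
  qed
  have trans: "?R p r" if p: "p \<in> xpaths_from X \<sigma>" and q: "q \<in> xpaths_from X \<sigma>" and 1: "?R p q" and 2: "?R q r" for p q r
  proof -
    obtain g where g: "g \<in> carrier (grp X (xter X p))" "path_class X q = path_class X p \<cdot>\<^sub>X gcls X (xter X p) g"
      using 1 by blast
    obtain h where h: "h \<in> carrier (grp X (xter X p))" "path_class X r = path_class X q \<cdot>\<^sub>X gcls X (xter X p) h"
      using 2 unfolding tq[OF p q 1] by blast
    have "path_class X r = path_class X p \<cdot>\<^sub>X gcls X (xter X p) (g \<otimes>\<^bsub>grp X (xter X p)\<^esub> h)"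
      unfolding h(2) g(2) using xpaths_fromD[OF p] g(1) h(1) by (simp add: gcls_mult)
    then show ?thesis using g(1) h(1) xpaths_fromD[OF p] by (intro bexI[of _ "g \<otimes>\<^bsub>grp X (xter X p)\<^esub> h"]) simp_all
  qed
  show ?thesis
  proof
    assume "univ_class X \<sigma> p = univ_class X \<sigma> q"
    then have "q \<in> univ_class X \<sigma> p" using mem[of q q] refl assms by simp
    then show "?R p q" using mem assms by simp
  next
    assume r: "?R p q"
    have "r \<in> univ_class X \<sigma> p \<longleftrightarrow> r \<in> univ_class X \<sigma> q" for r
    proof (cases "r \<in> xpaths_from X \<sigma>")
      case True
      then show ?thesis unfolding mem[OF assms(1) True] mem[OF assms(2) True]
        using trans[OF assms r] trans[OF assms(2,1) sym[OF assms r]]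
        by (metis assms r sym trans)
    qed (simp add: univ_class_def)
    then show "univ_class X \<sigma> p = univ_class X \<sigma> q" by blast
  qed
qed

text \<open>Changing \<open>w\<close> within its class or \<open>p\<close> by a local element
  changes the concatenation by at most a local element at its end, so all members of the union
  agree.\<close>

lemma univ_act_vert_class:
  assumes "is_xpath X w" "xini w = \<sigma>" "xter X w = \<sigma>" "p \<in> xpaths_from X \<sigma>"
  shows "univ_act_vert X \<sigma> (path_class X w) (univ_class X \<sigma> p) = univ_class X \<sigma> (xconcat X w p)"
proof -
  note p = xpaths_fromD[OF assms(4)]
  have wp: "xconcat X w p \<in> xpaths_from X \<sigma>" using assms p by (simp add: xpaths_from_def)
  have "univ_class X \<sigma> (xconcat X w' p') = univ_class X \<sigma> (xconcat X w p)"
    if w': "w' \<in> path_class X w" and p': "p' \<in> univ_class X \<sigma> p" for w' p'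
  proof -
    have h: "path_homotopic X w w'" using w' by (simp add: path_class_def)
    have w'v: "is_xpath X w'" "xini w' = \<sigma>" "xter X w' = \<sigma>" and wc: "path_class X w' = path_class X w"
      using path_homotopic_valid[OF h] assms h path_homotopic_sym[OF h] by (simp_all add: path_class_eq_iff)
    have p'v: "p' \<in> xpaths_from X \<sigma>" using p' by (simp add: univ_class_def)
    obtain g where g: "g \<in> carrier (grp X (xter X p))" "path_class X p' = path_class X p \<cdot>\<^sub>X gcls X (xter X p) g"
      using p' p by (auto simp: univ_class_def univ_equiv_def gcls_def)
    have v: "xconcat X w' p' \<in> xpaths_from X \<sigma>" using w'v xpaths_fromD[OF p'v] by (simp add: xpaths_from_def)
    have "path_class X (xconcat X w' p') = path_class X w \<cdot>\<^sub>X path_class X p'"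
      unfolding wc[symmetric] using w'v xpaths_fromD[OF p'v] by simp
    also have "\<dots> = path_class X (xconcat X w p) \<cdot>\<^sub>X gcls X (xter X p) g"
      unfolding g(2) using assms p g(1) by (simp flip: amult_path_class)
    finally have "univ_class X \<sigma> (xconcat X w p) = univ_class X \<sigma> (xconcat X w' p')"
      unfolding univ_class_eq_iff[OF wp v] using assms p g(1) by auto
    then show ?thesis by simp
  qed
  then have "univ_act_vert X \<sigma> (path_class X w) (univ_class X \<sigma> p)
      = (\<Union>w'\<in>path_class X w. \<Union>p'\<in>univ_class X \<sigma> p. univ_class X \<sigma> (xconcat X w p))"
    unfolding univ_act_vert_def by (intro SUP_cong refl)
  moreover have "w \<in> path_class X w" by (simp add: path_class_def)
  moreover have "p \<in> univ_class X \<sigma> p"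
    using assms(4) p by (auto simp: univ_class_def univ_equiv_def intro!: bexI[of _ "\<one>\<^bsub>grp X (xter X p)\<^esub>"])
  ultimately show ?thesis by auto
qed

text \<open>An edge of the universal complex is given by its end classes and a label that the action
  preserves, so an element fixing all vertices fixes all edges. The vertex of a path is fixed if
  prepending \<open>c\<close> only changes the path by a local element at its end.\<close>

lemma action_kernel_iff:
  "c \<in> action_kernel X \<sigma> \<longleftrightarrow> c \<in> carrier (pi1 X \<sigma>) \<and>
    (\<forall>x\<in>arrows X. src x = \<sigma> \<longrightarrow> (\<exists>g\<in>carrier (grp X (tgt X x)). c \<cdot>\<^sub>X x = x \<cdot>\<^sub>X gcls X (tgt X x) g))"
proof -
  have "c \<in> action_kernel X \<sigma> \<longleftrightarrow> (\<forall>x\<in>arrows X. src x = \<sigma> \<longrightarrow>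
      (\<exists>g\<in>carrier (grp X (tgt X x)). c \<cdot>\<^sub>X x = x \<cdot>\<^sub>X gcls X (tgt X x) g))" (is "_ \<longleftrightarrow> ?R")
    if c: "c \<in> carrier (pi1 X \<sigma>)"
  proof -
    obtain w where w: "c = path_class X w" "is_xpath X w"
      using c by (metis (no_types, lifting) arrowE mem_Collect_eq pi1_carrier)
    have ww: "xini w = \<sigma>" "xter X w = \<sigma>" using c w by (simp_all add: pi1_carrier)
    have fix_iff: "univ_act_vert X \<sigma> c (univ_class X \<sigma> p) = univ_class X \<sigma> p \<longleftrightarrow>
       (\<exists>g\<in>carrier (grp X (xter X p)). c \<cdot>\<^sub>X path_class X p = path_class X p \<cdot>\<^sub>X gcls X (xter X p) g)"
      if p: "p \<in> xpaths_from X \<sigma>" for p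
    proof -
      have "xconcat X w p \<in> xpaths_from X \<sigma>" using w ww xpaths_fromD[OF p] by (simp add: xpaths_from_def)
      moreover have "univ_act_vert X \<sigma> c (univ_class X \<sigma> p) = univ_class X \<sigma> (xconcat X w p)"
        unfolding w(1) by (rule univ_act_vert_class[OF w(2) ww p])
      ultimately show ?thesis
        using univ_class_eq_iff[OF p, of "xconcat X w p"] w ww xpaths_fromD[OF p] by auto
    qed
    have "(\<forall>v\<in>verts (universal_complex X \<sigma>). univ_act_vert X \<sigma> c v = v) \<longleftrightarrow>
        (\<forall>p\<in>xpaths_from X \<sigma>. univ_act_vert X \<sigma> c (univ_class X \<sigma> p) = univ_class X \<sigma> p)"
      by (simp add: universal_complex_def)
    moreover have "\<forall>e\<in>edges (universal_complex X \<sigma>). univ_act_edge X \<sigma> c e = e"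
      if "\<forall>p\<in>xpaths_from X \<sigma>. univ_act_vert X \<sigma> c (univ_class X \<sigma> p) = univ_class X \<sigma> p"
    proof
      fix e assume "e \<in> edges (universal_complex X \<sigma>)"
      then obtain p a where e: "e = (univ_class X \<sigma> p, a, univ_class X \<sigma> (xconcat X p (epath X a)))"
        and p: "p \<in> xpaths_from X \<sigma>" and a: "a \<in> edges X" "ini X a = xter X p"
        unfolding universal_complex_def scwol.simps by blast
      have "xconcat X p (epath X a) \<in> xpaths_from X \<sigma>"
        using xpaths_fromD[OF p] a by (simp add: xpaths_from_def)
      then show "univ_act_edge X \<sigma> c e = e"
        using that p unfolding e univ_act_edge_def by simp
    qed
    ultimately have "c \<in> action_kernel X \<sigma> \<longleftrightarrow>
        (\<forall>p\<in>xpaths_from X \<sigma>. univ_act_vert X \<sigma> c (univ_class X \<sigma> p) = univ_class X \<sigma> p)"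
      using c unfolding action_kernel_def by blast
    also have "\<dots> \<longleftrightarrow> (\<forall>p\<in>xpaths_from X \<sigma>.
        \<exists>g\<in>carrier (grp X (xter X p)). c \<cdot>\<^sub>X path_class X p = path_class X p \<cdot>\<^sub>X gcls X (xter X p) g)"
      using fix_iff by (rule ball_cong[OF refl])
    also have "\<dots> \<longleftrightarrow> ?R"
    proof
      assume l: "\<forall>p\<in>xpaths_from X \<sigma>.
        \<exists>g\<in>carrier (grp X (xter X p)). c \<cdot>\<^sub>X path_class X p = path_class X p \<cdot>\<^sub>X gcls X (xter X p) g"
      show ?R
      proof (intro ballI impI)
        fix x assume x: "x \<in> arrows X" "src x = \<sigma>"
        obtain p where p: "is_xpath X p" "x = path_class X p" using x(1) by (rule arrowE)
        then have "p \<in> xpaths_from X \<sigma>" using x(2) by (simp add: xpaths_from_def)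
        then show "\<exists>g\<in>carrier (grp X (tgt X x)). c \<cdot>\<^sub>X x = x \<cdot>\<^sub>X gcls X (tgt X x) g"
          using l p by simp
      qed
    next
      assume r: ?R
      show "\<forall>p\<in>xpaths_from X \<sigma>.
        \<exists>g\<in>carrier (grp X (xter X p)). c \<cdot>\<^sub>X path_class X p = path_class X p \<cdot>\<^sub>X gcls X (xter X p) g"
      proof
        fix p assume "p \<in> xpaths_from X \<sigma>"
        from xpaths_fromD[OF this]
        show "\<exists>g\<in>carrier (grp X (xter X p)). c \<cdot>\<^sub>X path_class X p = path_class X p \<cdot>\<^sub>X gcls X (xter X p) g"
          using r[THEN bspec, of "path_class X p"] by simp
      qed
    qed
    finally show ?thesis .
  qed
  moreover have "c \<in> action_kernel X \<sigma> \<Longrightarrow> c \<in> carrier (pi1 X \<sigma>)" by (simp add: action_kernel_def)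
  ultimately show ?thesis by blast
qed

end

section \<open>Deck transformations and the normalizer\<close>

lemma (in complex_of_groups) amult_solve_right:
  assumes "c \<cdot>\<^sub>X d = e" "c \<in> arrows X" "d \<in> arrows X" "tgt X c = src d"
  shows "c = e \<cdot>\<^sub>X ainv X d"
  unfolding assms(1)[symmetric] using assms(2-) by simp

lemma (in complex_of_groups) amult_solve_left:
  assumes "c \<cdot>\<^sub>X d = e" "c \<in> arrows X" "d \<in> arrows X" "tgt X c = src d"
  shows "d = ainv X c \<cdot>\<^sub>X e"
  unfolding assms(1)[symmetric] using assms(2-) by simp

locale developable_covering = covering X Y \<phi>
  for X :: "('v, 'e, 'g, 'm) complex_of_groups_scheme"
    and Y :: "('w, 'd, 'h, 'n) complex_of_groups_scheme"
    and \<phi> :: "('v, 'e, 'w, 'd, 'g, 'h) cog_morphism" +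
  fixes \<sigma>\<^sub>0 :: 'v
  assumes base [simp]: "\<sigma>\<^sub>0 \<in> verts X" and dev_X: "developable X" and dev_Y: "developable Y"
begin

abbreviation G where "G \<equiv> pi1 Y (vmap \<phi> \<sigma>\<^sub>0)"

abbreviation U where "U \<equiv> ind ` carrier (pi1 X \<sigma>\<^sub>0)"

abbreviation loc where "loc k \<sigma> \<equiv> gcls Y (vmap \<phi> \<sigma>) (k \<sigma>)"

section \<open>The subgroup \<open>U\<close> and its normalizer in groupoid terms\<close>

lemma G_group: "group G"
  by (simp add: Y.pi1_group)

lemma U_iff: "u \<in> U \<longleftrightarrow> (\<exists>x\<in>arrows X. src x = \<sigma>\<^sub>0 \<and> tgt X x = \<sigma>\<^sub>0 \<and> u = ind x)"
  by (auto simp: X.pi1_carrier)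

lemma U_carrier: "u \<in> U \<Longrightarrow> u \<in> arrows Y \<and> src u = vmap \<phi> \<sigma>\<^sub>0 \<and> tgt Y u = vmap \<phi> \<sigma>\<^sub>0"
  by (auto simp: U_iff)

lemma U_subset: "U \<subseteq> carrier G"
  unfolding Y.pi1_carrier using U_carrier by blast

lemma U_subgroup: "subgroup U G"
proof
  fix u v assume "u \<in> U" "v \<in> U"
  then obtain x y where x: "x \<in> arrows X" "src x = \<sigma>\<^sub>0" "tgt X x = \<sigma>\<^sub>0" "u = ind x"
    and y: "y \<in> arrows X" "src y = \<sigma>\<^sub>0" "tgt X y = \<sigma>\<^sub>0" "v = ind y" unfolding U_iff by blast
  show "u \<otimes>\<^bsub>G\<^esub> v \<in> U" unfolding U_iff Y.pi1_mult
    by (rule bexI[of _ "x \<cdot>\<^sub>X y"]) (use x y in simp_all)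
next
  show "\<one>\<^bsub>G\<^esub> \<in> U" unfolding U_iff Y.pi1_one
    by (rule bexI[of _ "idcls X \<sigma>\<^sub>0"]) simp_all
next
  fix u assume "u \<in> U"
  then obtain x where x: "x \<in> arrows X" "src x = \<sigma>\<^sub>0" "tgt X x = \<sigma>\<^sub>0" "u = ind x" unfolding U_iff by blast
  have "u \<in> carrier G" using U_subset \<open>u \<in> U\<close> by blast
  then have "inv\<^bsub>G\<^esub> u = ainv Y u" by (simp add: Y.pi1_inv)
  then show "inv\<^bsub>G\<^esub> u \<in> U" unfolding U_iff
    by (intro bexI[of _ "ainv X x"]) (use x in simp_all)
qed (use U_subset in blast)

text \<open>Stability of \<open>U\<close> under conjugation is split into two inclusions, since one
  need not imply the other when \<open>U\<close> is infinite and the two are used at different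
  places.\<close>

lemma normalizer_iff:
  "n \<in> normalizer G U \<longleftrightarrow> n \<in> arrows Y \<and> src n = vmap \<phi> \<sigma>\<^sub>0 \<and> tgt Y n = vmap \<phi> \<sigma>\<^sub>0 \<and>
    (\<forall>u\<in>U. n \<cdot>\<^sub>Y (u \<cdot>\<^sub>Y ainv Y n) \<in> U) \<and> (\<forall>u\<in>U. ainv Y n \<cdot>\<^sub>Y (u \<cdot>\<^sub>Y n) \<in> U)"
proof -
  have "n <#\<^bsub>G\<^esub> U #>\<^bsub>G\<^esub> inv\<^bsub>G\<^esub> n = U \<longleftrightarrow>
    (\<forall>u\<in>U. n \<cdot>\<^sub>Y (u \<cdot>\<^sub>Y ainv Y n) \<in> U) \<and> (\<forall>u\<in>U. ainv Y n \<cdot>\<^sub>Y (u \<cdot>\<^sub>Y n) \<in> U)"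
    if n: "n \<in> carrier G"
  proof -
    have n': "n \<in> arrows Y" "src n = vmap \<phi> \<sigma>\<^sub>0" "tgt Y n = vmap \<phi> \<sigma>\<^sub>0" using n by (auto simp: Y.pi1_carrier)
    have "n <#\<^bsub>G\<^esub> U #>\<^bsub>G\<^esub> inv\<^bsub>G\<^esub> n = (\<lambda>u. n \<cdot>\<^sub>Y (u \<cdot>\<^sub>Y ainv Y n)) ` U"
    proof -
      have "(n \<cdot>\<^sub>Y u) \<cdot>\<^sub>Y ainv Y n = n \<cdot>\<^sub>Y (u \<cdot>\<^sub>Y ainv Y n)" if "u \<in> U" for u
        using U_carrier[OF that] n' by simp
      moreover have "n <#\<^bsub>G\<^esub> U #>\<^bsub>G\<^esub> inv\<^bsub>G\<^esub> n = (\<lambda>u. (n \<cdot>\<^sub>Y u) \<cdot>\<^sub>Y ainv Y n) ` U"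
        unfolding l_coset_def r_coset_def Y.pi1_mult Y.pi1_inv[OF vmap_closed[OF base] n] by blast
      ultimately show ?thesis by (simp cong: image_cong_simp)
    qed
    then have *: "n <#\<^bsub>G\<^esub> U #>\<^bsub>G\<^esub> inv\<^bsub>G\<^esub> n = U \<longleftrightarrow> (\<lambda>u. n \<cdot>\<^sub>Y (u \<cdot>\<^sub>Y ainv Y n)) ` U = U" by simp
    have conj: "ainv Y n \<cdot>\<^sub>Y ((n \<cdot>\<^sub>Y (u \<cdot>\<^sub>Y ainv Y n)) \<cdot>\<^sub>Y n) = u"
      "n \<cdot>\<^sub>Y ((ainv Y n \<cdot>\<^sub>Y (u \<cdot>\<^sub>Y n)) \<cdot>\<^sub>Y ainv Y n) = u"
      if "u \<in> U" for u
      using U_carrier[OF that] n' by simp_all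
    show ?thesis unfolding *
    proof (intro iffI conjI ballI)
      fix u assume eq: "(\<lambda>u. n \<cdot>\<^sub>Y (u \<cdot>\<^sub>Y ainv Y n)) ` U = U" and u: "u \<in> U"
      show "n \<cdot>\<^sub>Y (u \<cdot>\<^sub>Y ainv Y n) \<in> U" by (subst eq[symmetric]) (rule imageI[OF u])
      have "u \<in> (\<lambda>u. n \<cdot>\<^sub>Y (u \<cdot>\<^sub>Y ainv Y n)) ` U" by (subst eq) (rule u)
      then obtain v where v: "v \<in> U" "u = n \<cdot>\<^sub>Y (v \<cdot>\<^sub>Y ainv Y n)" by (rule imageE)
      show "ainv Y n \<cdot>\<^sub>Y (u \<cdot>\<^sub>Y n) \<in> U" unfolding v(2) conj(1)[OF v(1)] by (rule v(1))
    next
      assume r: "(\<forall>u\<in>U. n \<cdot>\<^sub>Y (u \<cdot>\<^sub>Y ainv Y n) \<in> U) \<and> (\<forall>u\<in>U. ainv Y n \<cdot>\<^sub>Y (u \<cdot>\<^sub>Y n) \<in> U)"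
      show "(\<lambda>u. n \<cdot>\<^sub>Y (u \<cdot>\<^sub>Y ainv Y n)) ` U = U"
      proof (intro subset_antisym subsetI)
        fix v assume "v \<in> (\<lambda>u. n \<cdot>\<^sub>Y (u \<cdot>\<^sub>Y ainv Y n)) ` U"
        then show "v \<in> U" using r by blast
      next
        fix u assume u: "u \<in> U"
        have "ainv Y n \<cdot>\<^sub>Y (u \<cdot>\<^sub>Y n) \<in> U" using r u by blast
        then show "u \<in> (\<lambda>u. n \<cdot>\<^sub>Y (u \<cdot>\<^sub>Y ainv Y n)) ` U"
          by (rule image_eqI[rotated]) (rule conj(2)[OF u, symmetric])
      qed
    qed
  qed
  then show ?thesis
    unfolding normalizer_def stabilizer_def using U_subset by (auto simp: Y.pi1_carrier)
qed

text \<open>The homotopy from \<phi> to its composite with \<eta>, with the functor of the composite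
  already replaced by the composite of the functors.\<close>

definition witness where
  "witness \<eta> k \<longleftrightarrow> (\<forall>\<sigma>\<in>verts X. vmap \<phi> (vmap \<eta> \<sigma>) = vmap \<phi> \<sigma>) \<and>
     (\<forall>a\<in>edges X. emap \<phi> (emap \<eta> a) = emap \<phi> a) \<and>
     (\<forall>\<sigma>\<in>verts X. k \<sigma> \<in> carrier (grp Y (vmap \<phi> \<sigma>))) \<and>
     (\<forall>c\<in>arrows X. loc k (src c) \<cdot>\<^sub>Y ind c = ind (induced_hom X X \<eta> c) \<cdot>\<^sub>Y loc k (tgt X c))"

lemma witnessD:
  assumes "witness \<eta> k"
  shows "\<sigma> \<in> verts X \<Longrightarrow> vmap \<phi> (vmap \<eta> \<sigma>) = vmap \<phi> \<sigma>"
    "a \<in> edges X \<Longrightarrow> emap \<phi> (emap \<eta> a) = emap \<phi> a"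
    "\<sigma> \<in> verts X \<Longrightarrow> k \<sigma> \<in> carrier (grp Y (vmap \<phi> \<sigma>))"
    "c \<in> arrows X \<Longrightarrow> loc k (src c) \<cdot>\<^sub>Y ind c = ind (induced_hom X X \<eta> c) \<cdot>\<^sub>Y loc k (tgt X c)"
  using assms unfolding witness_def by blast+

lemma AutD: "\<eta> \<in> Aut X \<Longrightarrow> cog_morphism X X \<eta>"
  by (simp add: Aut_def)

lemma deck_iff_witness:
  assumes "\<eta> \<in> Aut X"
  shows "homotopic X Y \<phi> (cog_compose X Y \<phi> \<eta>) \<longleftrightarrow> (\<exists>k. witness \<eta> k)"
proof -
  note m = cog_morphism_compose[OF AutD[OF assms] cog_morphism_axioms dev_Y]
  show ?thesis
    unfolding homotopic_iff_intertwines[OF dev_Y] intertwines_def witness_def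
    using m cog_morphism_axioms by auto
qed

text \<open>A relation is used because neither side determines the other: \<open>n\<close> depends
  on the choice of \<open>p\<close> and \<open>k\<close>, and \<eta> is fixed by \<open>n\<close>
  only up to homotopy.\<close>

definition deck_rel where
  "deck_rel n \<eta> \<longleftrightarrow> \<eta> \<in> Aut X \<and> (\<exists>k p. witness \<eta> k \<and> p \<in> arrows X \<and> src p = \<sigma>\<^sub>0 \<and>
     tgt X p = vmap \<eta> \<sigma>\<^sub>0 \<and> n = ind p \<cdot>\<^sub>Y loc k \<sigma>\<^sub>0)"

lemma deck_relE:
  assumes "deck_rel n \<eta>"
  obtains k p where "\<eta> \<in> Aut X" "cog_morphism X X \<eta>" "witness \<eta> k" "p \<in> arrows X" "src p = \<sigma>\<^sub>0"
    "tgt X p = vmap \<eta> \<sigma>\<^sub>0" "n = ind p \<cdot>\<^sub>Y loc k \<sigma>\<^sub>0"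
  using assms AutD unfolding deck_rel_def by blast

lemma deck_rel_witness: "deck_rel n \<eta> \<Longrightarrow> \<eta> \<in> Aut X \<and> homotopic X Y \<phi> (cog_compose X Y \<phi> \<eta>)"
  using deck_iff_witness unfolding deck_rel_def by blast

lemma ex_deck_rel:
  assumes "\<eta> \<in> Aut X" "homotopic X Y \<phi> (cog_compose X Y \<phi> \<eta>)"
  shows "\<exists>n. deck_rel n \<eta>"
proof -
  interpret E: cog_morphism X X \<eta> by (rule AutD[OF assms(1)])
  obtain p where "p \<in> arrows X" "src p = \<sigma>\<^sub>0" "tgt X p = vmap \<eta> \<sigma>\<^sub>0"
    using X.ex_arrow[of \<sigma>\<^sub>0 "vmap \<eta> \<sigma>\<^sub>0"] by auto
  then show ?thesis using assms deck_iff_witness[OF assms(1)] unfolding deck_rel_def by blast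
qed

text \<open>By naturality \<open>n\<close> passes the image of a loop \<open>x\<close>, replacing
  \<open>x\<close> by the conjugate of its \<eta>-image with \<open>p\<close>. This settles
  conjugation by \<open>n\<close>; the other inclusion needs a loop with a prescribed
  \<eta>-image.\<close>

lemma deck_rel_normalizer:
  assumes "deck_rel n \<eta>" shows "n \<in> normalizer G U"
proof -
  obtain k p where \<eta>: "\<eta> \<in> Aut X" "cog_morphism X X \<eta>" and w: "witness \<eta> k" and p: "p \<in> arrows X" "src p = \<sigma>\<^sub>0"
    "tgt X p = vmap \<eta> \<sigma>\<^sub>0" and n: "n = ind p \<cdot>\<^sub>Y loc k \<sigma>\<^sub>0" using assms by (rule deck_relE)
  interpret E: cog_morphism X X \<eta> by fact
  note [simp] = witnessD(1,3)[OF w] p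
  have n_typing [simp]: "n \<in> arrows Y" "src n = vmap \<phi> \<sigma>\<^sub>0" "tgt Y n = vmap \<phi> \<sigma>\<^sub>0" by (simp_all add: n)
  have move: "n \<cdot>\<^sub>Y ind x = ind (p \<cdot>\<^sub>X (E.ind x \<cdot>\<^sub>X ainv X p)) \<cdot>\<^sub>Y n"
    if x: "x \<in> arrows X" "src x = \<sigma>\<^sub>0" "tgt X x = \<sigma>\<^sub>0" for x
    using witnessD(4)[OF w, of x] x unfolding n by simp
  show ?thesis unfolding normalizer_iff
  proof (intro conjI ballI n_typing)
    fix u assume "u \<in> U"
    then obtain x where x: "x \<in> arrows X" "src x = \<sigma>\<^sub>0" "tgt X x = \<sigma>\<^sub>0" "u = ind x" unfolding U_iff by blast
    let ?z = "p \<cdot>\<^sub>X (E.ind x \<cdot>\<^sub>X ainv X p)"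
    have z: "?z \<in> arrows X" "src ?z = \<sigma>\<^sub>0" "tgt X ?z = \<sigma>\<^sub>0" using x by simp_all
    have "n \<cdot>\<^sub>Y (u \<cdot>\<^sub>Y ainv Y n) = (n \<cdot>\<^sub>Y ind x) \<cdot>\<^sub>Y ainv Y n" using x by simp
    also have "\<dots> = ind ?z" unfolding move[OF x(1-3)] using z by (simp del: ind_amult)
    finally show "n \<cdot>\<^sub>Y (u \<cdot>\<^sub>Y ainv Y n) \<in> U" unfolding U_iff using z by blast
    let ?y = "ainv X p \<cdot>\<^sub>X (x \<cdot>\<^sub>X p)"
    \<comment> \<open>\<open>?y\<close> is a loop at the image of the base vertex, so fullness of
      the functor of an automorphism makes it the image of a loop at the base vertex.\<close>
    obtain y where y: "y \<in> arrows X" "src y = \<sigma>\<^sub>0" "tgt X y = \<sigma>\<^sub>0" "E.ind y = ?y"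
      by (rule Aut_induced_full[OF \<eta>(1), of ?y \<sigma>\<^sub>0 \<sigma>\<^sub>0]) (use x in simp_all)
    have "ind x \<cdot>\<^sub>Y n = n \<cdot>\<^sub>Y ind y"
      unfolding move[OF y(1-3)] y(4) using x by simp
    then have "ainv Y n \<cdot>\<^sub>Y (u \<cdot>\<^sub>Y n) = ind y" using x y by simp
    then show "ainv Y n \<cdot>\<^sub>Y (u \<cdot>\<^sub>Y n) \<in> U" unfolding U_iff using y by blast
  qed
qed

text \<open>In the product of the two elements, the component of \<open>k\<close> at the base passes
  the image of \<open>q\<close>. This turns \<open>q\<close> into its \<eta>-image, giving the
  connecting arrow of the composite, and moves \<open>k\<close> to the end of \<open>q\<close>,
  where it meets \<open>l\<close>.\<close>

lemma deck_rel_compose: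
  assumes "deck_rel n \<eta>" "deck_rel m \<theta>"
  shows "deck_rel (n \<cdot>\<^sub>Y m) (cog_compose X X \<eta> \<theta>)"
proof -
  obtain k p where \<eta>: "\<eta> \<in> Aut X" "cog_morphism X X \<eta>" and w: "witness \<eta> k" and p: "p \<in> arrows X" "src p = \<sigma>\<^sub>0"
    "tgt X p = vmap \<eta> \<sigma>\<^sub>0" and n: "n = ind p \<cdot>\<^sub>Y loc k \<sigma>\<^sub>0" using assms(1) by (rule deck_relE)
  obtain l q where \<theta>: "\<theta> \<in> Aut X" "cog_morphism X X \<theta>" and v: "witness \<theta> l" and q: "q \<in> arrows X" "src q = \<sigma>\<^sub>0"
    "tgt X q = vmap \<theta> \<sigma>\<^sub>0" and m: "m = ind q \<cdot>\<^sub>Y loc l \<sigma>\<^sub>0" using assms(2) by (rule deck_relE)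
  interpret E: cog_morphism X X \<eta> by fact
  interpret F: cog_morphism X X \<theta> by fact
  note [simp] = witnessD(1,3)[OF w] witnessD(1,3)[OF v]
  have kc: "k (vmap \<theta> \<sigma>) \<in> carrier (grp Y (vmap \<phi> \<sigma>))" if "\<sigma> \<in> verts X" for \<sigma>
    using witnessD(3)[OF w, of "vmap \<theta> \<sigma>"] that by simp
  \<comment> \<open>The component of \<open>k\<close> is taken at
    \<open>vmap \<theta> \<sigma>\<close>, which lies over the same vertex of \<open>Y\<close> as
    \<sigma>, so the product is formed in one local group.\<close>
  let ?j = "\<lambda>\<sigma>. k (vmap \<theta> \<sigma>) \<otimes>\<^bsub>grp Y (vmap \<phi> \<sigma>)\<^esub> l \<sigma>"
  have "witness (cog_compose X X \<eta> \<theta>) ?j"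
    unfolding witness_def
  proof (intro conjI ballI)
    fix c assume c: "c \<in> arrows X"
    let ?k = "\<lambda>\<sigma>. gcls Y (vmap \<phi> \<sigma>) (k (vmap \<theta> \<sigma>))"
    have 1: "?k (src c) \<cdot>\<^sub>Y ind (F.ind c) = ind (E.ind (F.ind c)) \<cdot>\<^sub>Y ?k (tgt X c)"
      using witnessD(4)[OF w, of "F.ind c"] c by simp
    have "?k (src c) \<cdot>\<^sub>Y (loc l (src c) \<cdot>\<^sub>Y ind c) = (?k (src c) \<cdot>\<^sub>Y ind (F.ind c)) \<cdot>\<^sub>Y loc l (tgt X c)"
      unfolding witnessD(4)[OF v c] using c kc by simp
    also have "\<dots> = ind (E.ind (F.ind c)) \<cdot>\<^sub>Y (?k (tgt X c) \<cdot>\<^sub>Y loc l (tgt X c))"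
      unfolding 1 using c kc by simp
    finally show "loc ?j (src c) \<cdot>\<^sub>Y ind c = ind (induced_hom X X (cog_compose X X \<eta> \<theta>) c) \<cdot>\<^sub>Y loc ?j (tgt X c)"
      unfolding cog_morphism_compose(2)[OF \<theta>(2) \<eta>(2) dev_X c] using c kc by (simp add: Y.gcls_mult)
  qed (use kc witnessD(2)[OF w] witnessD(2)[OF v] in simp_all)
  moreover have "n \<cdot>\<^sub>Y m = ind (p \<cdot>\<^sub>X E.ind q) \<cdot>\<^sub>Y loc ?j \<sigma>\<^sub>0"
  proof -
    have "n \<cdot>\<^sub>Y m = ind p \<cdot>\<^sub>Y ((loc k \<sigma>\<^sub>0 \<cdot>\<^sub>Y ind q) \<cdot>\<^sub>Y loc l \<sigma>\<^sub>0)"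
      unfolding n m using p q by simp
    also have "loc k \<sigma>\<^sub>0 \<cdot>\<^sub>Y ind q = ind (E.ind q) \<cdot>\<^sub>Y gcls Y (vmap \<phi> \<sigma>\<^sub>0) (k (vmap \<theta> \<sigma>\<^sub>0))"
      using witnessD(4)[OF w q(1)] q by simp
    finally show ?thesis using p q kc[of \<sigma>\<^sub>0] by (simp add: Y.gcls_mult)
  qed
  ultimately show ?thesis
    unfolding deck_rel_def using p q Aut_compose[OF \<eta>(1) \<theta>(1) dev_X]
    by (intro conjI exI[of _ ?j] exI[of _ "p \<cdot>\<^sub>X E.ind q"]) simp_all
qed

text \<open>For an arrow \<open>r\<close> from the base to \<sigma>, both witnesses express
  \<open>n\<close> followed by the image of \<open>r\<close>. Hence the arrows obtained from the two
  automorphisms have images differing by a local element. Reflection shows that they end at the same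
  vertex and differ by a local element of \<open>X\<close>, the component of the homotopy.\<close>

lemma deck_rel_unique:
  assumes "deck_rel n \<eta>" "deck_rel n \<eta>'"
  shows "homotopic X X \<eta> \<eta>'"
proof -
  obtain k p where \<eta>: "\<eta> \<in> Aut X" "cog_morphism X X \<eta>" and w: "witness \<eta> k" and p: "p \<in> arrows X" "src p = \<sigma>\<^sub>0"
    "tgt X p = vmap \<eta> \<sigma>\<^sub>0" and n: "n = ind p \<cdot>\<^sub>Y loc k \<sigma>\<^sub>0" using assms(1) by (rule deck_relE)
  obtain k' p' where \<eta>': "\<eta>' \<in> Aut X" "cog_morphism X X \<eta>'" and w': "witness \<eta>' k'" and p': "p' \<in> arrows X" "src p' = \<sigma>\<^sub>0"
    "tgt X p' = vmap \<eta>' \<sigma>\<^sub>0" and n': "n = ind p' \<cdot>\<^sub>Y loc k' \<sigma>\<^sub>0" using assms(2) by (rule deck_relE)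
  interpret E: cog_morphism X X \<eta> by fact
  interpret F: cog_morphism X X \<eta>' by fact
  note [simp] = witnessD(1,3)[OF w] witnessD(1,3)[OF w'] p p'
  have "vmap \<eta>' \<sigma> = vmap \<eta> \<sigma> \<and> (\<exists>h\<in>carrier (grp X (vmap \<eta> \<sigma>)).
      gmap \<phi> (vmap \<eta> \<sigma>) h = k \<sigma> \<otimes>\<^bsub>grp Y (vmap \<phi> \<sigma>)\<^esub> inv\<^bsub>grp Y (vmap \<phi> \<sigma>)\<^esub> k' \<sigma>)" if \<sigma>: "\<sigma> \<in> verts X" for \<sigma>
  proof -
    obtain r where r: "r \<in> arrows X" "src r = \<sigma>\<^sub>0" "tgt X r = \<sigma>" using X.ex_arrow[OF base \<sigma>] by blast
    let ?c = "p \<cdot>\<^sub>X E.ind r" and ?d = "p' \<cdot>\<^sub>X F.ind r"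
    have 1: "n \<cdot>\<^sub>Y ind r = ind ?c \<cdot>\<^sub>Y loc k \<sigma>"
      unfolding n using witnessD(4)[OF w r(1)] r \<sigma> by simp
    have 2: "ind ?d \<cdot>\<^sub>Y loc k' \<sigma> = n \<cdot>\<^sub>Y ind r"
      unfolding n' using witnessD(4)[OF w' r(1)] r \<sigma> by simp
    have "ind ?d = (n \<cdot>\<^sub>Y ind r) \<cdot>\<^sub>Y ainv Y (loc k' \<sigma>)"
      by (rule Y.amult_solve_right[OF 2]) (use r \<sigma> in simp_all)
    then have "ind ?d = ind ?c \<cdot>\<^sub>Y gcls Y (vmap \<phi> \<sigma>) (k \<sigma> \<otimes>\<^bsub>grp Y (vmap \<phi> \<sigma>)\<^esub> inv\<^bsub>grp Y (vmap \<phi> \<sigma>)\<^esub> k' \<sigma>)"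
      unfolding 1 using r \<sigma> by (simp add: Y.gcls_mult Y.gcls_inv)
    then obtain h where h: "h \<in> carrier (grp X (vmap \<eta> \<sigma>))" "?d = ?c \<cdot>\<^sub>X gcls X (vmap \<eta> \<sigma>) h"
      "gmap \<phi> (vmap \<eta> \<sigma>) h = k \<sigma> \<otimes>\<^bsub>grp Y (vmap \<phi> \<sigma>)\<^esub> inv\<^bsub>grp Y (vmap \<phi> \<sigma>)\<^esub> k' \<sigma>"
      using ind_eq_mult_gclsD[of ?c ?d "k \<sigma> \<otimes>\<^bsub>grp Y (vmap \<phi> \<sigma>)\<^esub> inv\<^bsub>grp Y (vmap \<phi> \<sigma>)\<^esub> k' \<sigma>"] r \<sigma> by auto
    have "vmap \<eta>' \<sigma> = vmap \<eta> \<sigma>" using arg_cong[OF h(2), of "tgt X"] h(1) r \<sigma> by simp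
    then show ?thesis using h by blast
  qed
  then obtain l where vm [simp]: "\<And>\<sigma>. \<sigma> \<in> verts X \<Longrightarrow> vmap \<eta>' \<sigma> = vmap \<eta> \<sigma>"
    and l [simp]: "\<And>\<sigma>. \<sigma> \<in> verts X \<Longrightarrow> l \<sigma> \<in> carrier (grp X (vmap \<eta> \<sigma>))"
    and gl: "\<And>\<sigma>. \<sigma> \<in> verts X \<Longrightarrow> gmap \<phi> (vmap \<eta> \<sigma>) (l \<sigma>) = k \<sigma> \<otimes>\<^bsub>grp Y (vmap \<phi> \<sigma>)\<^esub> inv\<^bsub>grp Y (vmap \<phi> \<sigma>)\<^esub> k' \<sigma>"
    by metis
  \<comment> \<open>Since the induced functor is faithful, naturality of \<open>l\<close> can be
    checked in \<open>Y\<close>, where its components become quotients of the two witnesses.\<close>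
  have "gcls X (vmap \<eta> (src c)) (l (src c)) \<cdot>\<^sub>X F.ind c = E.ind c \<cdot>\<^sub>X gcls X (vmap \<eta> (tgt X c)) (l (tgt X c))"
    if c: "c \<in> arrows X" for c
  proof (rule ind_inj)
    have "ind (F.ind c) = (loc k' (src c) \<cdot>\<^sub>Y ind c) \<cdot>\<^sub>Y ainv Y (loc k' (tgt X c))"
      by (rule Y.amult_solve_right[OF witnessD(4)[OF w' c, symmetric]]) (use c in simp_all)
    then have "ind (gcls X (vmap \<eta> (src c)) (l (src c)) \<cdot>\<^sub>X F.ind c)
        = (loc k (src c) \<cdot>\<^sub>Y ind c) \<cdot>\<^sub>Y ainv Y (loc k' (tgt X c))"
      using c by (simp add: gl Y.gcls_mult Y.gcls_inv)
    also have "\<dots> = ind (E.ind c \<cdot>\<^sub>X gcls X (vmap \<eta> (tgt X c)) (l (tgt X c)))"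
      unfolding witnessD(4)[OF w c] using c by (simp add: gl Y.gcls_mult Y.gcls_inv)
    finally show "ind (gcls X (vmap \<eta> (src c)) (l (src c)) \<cdot>\<^sub>X F.ind c)
      = ind (E.ind c \<cdot>\<^sub>X gcls X (vmap \<eta> (tgt X c)) (l (tgt X c)))" .
  qed (use c in simp_all)
  then have "intertwines X X \<eta>' \<eta> l" unfolding intertwines_def by simp
  moreover have "emap \<eta> a = emap \<eta>' a" if "a \<in> edges X" for a
    by (rule emap_inj) (use that witnessD(2)[OF w that] witnessD(2)[OF w' that] in simp_all)
  ultimately have "homotopic X X \<eta>' \<eta>"
    using \<eta> \<eta>' by (auto simp: homotopic_iff_intertwines[OF dev_X])
  then show ?thesis using dev_X by (rule homotopic_sym)
qed

text \<open>For an arrow from the base, the kernel condition yields a local element at its end, and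
  commuting with \<open>U\<close> makes this element depend on the end vertex only. Conversely, each
  arrow of \<open>Y\<close> from the base is an image times a local element, and \<open>c\<close>
  can be moved through both.\<close>

lemma centralizer_kernel_iff:
  "c \<in> centralizer G U \<inter> action_kernel Y (vmap \<phi> \<sigma>\<^sub>0) \<longleftrightarrow>
    (\<exists>z. (\<forall>\<sigma>\<in>verts X. z \<sigma> \<in> carrier (grp Y (vmap \<phi> \<sigma>))) \<and> c = loc z \<sigma>\<^sub>0 \<and>
      (\<forall>x\<in>arrows X. loc z (src x) \<cdot>\<^sub>Y ind x = ind x \<cdot>\<^sub>Y loc z (tgt X x)))" (is "_ \<longleftrightarrow> ?R")
proof
  assume "c \<in> centralizer G U \<inter> action_kernel Y (vmap \<phi> \<sigma>\<^sub>0)"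
  then have c [simp]: "c \<in> arrows Y" "src c = vmap \<phi> \<sigma>\<^sub>0" "tgt Y c = vmap \<phi> \<sigma>\<^sub>0"
    and cu: "\<And>u. u \<in> U \<Longrightarrow> c \<cdot>\<^sub>Y u = u \<cdot>\<^sub>Y c"
    and ck: "\<And>y. y \<in> arrows Y \<Longrightarrow> src y = vmap \<phi> \<sigma>\<^sub>0 \<Longrightarrow>
      \<exists>g\<in>carrier (grp Y (tgt Y y)). c \<cdot>\<^sub>Y y = y \<cdot>\<^sub>Y gcls Y (tgt Y y) g"
    by (auto simp: centralizer_def Y.action_kernel_iff Y.pi1_carrier Y.pi1_mult)
  have "\<exists>g\<in>carrier (grp Y (vmap \<phi> \<sigma>)). \<forall>x\<in>arrows X. src x = \<sigma>\<^sub>0 \<longrightarrow> tgt X x = \<sigma> \<longrightarrow>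
      c \<cdot>\<^sub>Y ind x = ind x \<cdot>\<^sub>Y gcls Y (vmap \<phi> \<sigma>) g" if \<sigma>: "\<sigma> \<in> verts X" for \<sigma>
  proof -
    obtain r where r: "r \<in> arrows X" "src r = \<sigma>\<^sub>0" "tgt X r = \<sigma>" using X.ex_arrow[OF base \<sigma>] by blast
    obtain g where g: "g \<in> carrier (grp Y (vmap \<phi> \<sigma>))" "c \<cdot>\<^sub>Y ind r = ind r \<cdot>\<^sub>Y gcls Y (vmap \<phi> \<sigma>) g"
      using ck[of "ind r"] r by auto
    have "c \<cdot>\<^sub>Y ind x = ind x \<cdot>\<^sub>Y gcls Y (vmap \<phi> \<sigma>) g"
      if x: "x \<in> arrows X" "src x = \<sigma>\<^sub>0" "tgt X x = \<sigma>" for x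
    proof -
      have u: "ind (x \<cdot>\<^sub>X ainv X r) \<in> U" unfolding U_iff
        by (rule bexI[of _ "x \<cdot>\<^sub>X ainv X r"]) (use x r in simp_all)
      have "c \<cdot>\<^sub>Y ind x = (c \<cdot>\<^sub>Y ind (x \<cdot>\<^sub>X ainv X r)) \<cdot>\<^sub>Y ind r" using x r by simp
      also have "\<dots> = ind (x \<cdot>\<^sub>X ainv X r) \<cdot>\<^sub>Y (c \<cdot>\<^sub>Y ind r)" unfolding cu[OF u] using x r by simp
      also have "\<dots> = ind x \<cdot>\<^sub>Y gcls Y (vmap \<phi> \<sigma>) g" unfolding g(2) using x r g(1) \<sigma> by simp
      finally show ?thesis .
    qed
    then show ?thesis using g(1) by blast
  qed
  then obtain z where z [simp]: "\<And>\<sigma>. \<sigma> \<in> verts X \<Longrightarrow> z \<sigma> \<in> carrier (grp Y (vmap \<phi> \<sigma>))"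
    and Z: "\<And>x. x \<in> arrows X \<Longrightarrow> src x = \<sigma>\<^sub>0 \<Longrightarrow> c \<cdot>\<^sub>Y ind x = ind x \<cdot>\<^sub>Y loc z (tgt X x)"
    by (metis X.tgt_closed)
  have "c = loc z \<sigma>\<^sub>0" using Z[of "idcls X \<sigma>\<^sub>0"] by simp
  moreover have "loc z (src x) \<cdot>\<^sub>Y ind x = ind x \<cdot>\<^sub>Y loc z (tgt X x)" if x: "x \<in> arrows X" for x
  proof -
    obtain r where r: "r \<in> arrows X" "src r = \<sigma>\<^sub>0" "tgt X r = src x" using X.ex_arrow[OF base, of "src x"] x by auto
    \<comment> \<open>For arrows starting away from the base, naturality follows by comparing the
      rule for \<open>r\<close> with the rule for its extension by \<open>x\<close>.\<close>
    have "ind r \<cdot>\<^sub>Y (ind x \<cdot>\<^sub>Y loc z (tgt X x)) = (c \<cdot>\<^sub>Y ind r) \<cdot>\<^sub>Y ind x"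
      using Z[of "r \<cdot>\<^sub>X x"] r x by simp
    also have "\<dots> = ind r \<cdot>\<^sub>Y (loc z (src x) \<cdot>\<^sub>Y ind x)"
      unfolding Z[OF r(1,2)] using r x by simp
    finally show ?thesis using r x by simp
  qed
  ultimately show ?R using z by blast
next
  assume ?R
  then obtain z where z [simp]: "\<And>\<sigma>. \<sigma> \<in> verts X \<Longrightarrow> z \<sigma> \<in> carrier (grp Y (vmap \<phi> \<sigma>))"
    and c: "c = loc z \<sigma>\<^sub>0"
    and Z: "\<And>x. x \<in> arrows X \<Longrightarrow> loc z (src x) \<cdot>\<^sub>Y ind x = ind x \<cdot>\<^sub>Y loc z (tgt X x)" by blast
  have cc: "c \<in> carrier G" using c by (simp add: Y.pi1_carrier)
  have "c \<cdot>\<^sub>Y u = u \<cdot>\<^sub>Y c" if u: "u \<in> U" for u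
  proof -
    obtain x where x: "x \<in> arrows X" "src x = \<sigma>\<^sub>0" "tgt X x = \<sigma>\<^sub>0" "u = ind x" using u unfolding U_iff by blast
    then show ?thesis using Z[OF x(1)] unfolding c by simp
  qed
  moreover have "\<exists>g\<in>carrier (grp Y (tgt Y y)). c \<cdot>\<^sub>Y y = y \<cdot>\<^sub>Y gcls Y (tgt Y y) g"
    if y: "y \<in> arrows Y" "src y = vmap \<phi> \<sigma>\<^sub>0" for y
  proof -
    obtain x g where x: "x \<in> arrows X" "src x = \<sigma>\<^sub>0" "vmap \<phi> (tgt X x) = tgt Y y"
      and g: "g \<in> carrier (grp Y (tgt Y y))" and ye: "y = ind x \<cdot>\<^sub>Y gcls Y (tgt Y y) g"
      using ex_arrow_lift[OF y(1) base y(2)] by blast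
    let ?H = "grp Y (tgt Y y)"
    have zc: "z (tgt X x) \<in> carrier ?H" using z[of "tgt X x"] x by simp
    \<comment> \<open>Moving \<open>c\<close> through the image of \<open>x\<close> gives the
      component of \<open>z\<close> at its end; moving that past \<open>g\<close> conjugates
      it.\<close>
    let ?g = "inv\<^bsub>?H\<^esub> g \<otimes>\<^bsub>?H\<^esub> (z (tgt X x) \<otimes>\<^bsub>?H\<^esub> g)"
    have "c \<cdot>\<^sub>Y y = c \<cdot>\<^sub>Y (ind x \<cdot>\<^sub>Y gcls Y (tgt Y y) g)" using ye by simp
    also have "\<dots> = (loc z (src x) \<cdot>\<^sub>Y ind x) \<cdot>\<^sub>Y gcls Y (tgt Y y) g" unfolding c using x g y(1) by simp
    also have "\<dots> = (ind x \<cdot>\<^sub>Y gcls Y (tgt Y y) g) \<cdot>\<^sub>Y gcls Y (tgt Y y) ?g"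
      unfolding Z[OF x(1)] using x g y(1) zc by (simp add: Y.gcls_mult)
    finally have "c \<cdot>\<^sub>Y y = y \<cdot>\<^sub>Y gcls Y (tgt Y y) ?g" using ye by simp
    then show ?thesis using g zc y(1) by (intro bexI[of _ ?g]) simp_all
  qed
  ultimately show "c \<in> centralizer G U \<inter> action_kernel Y (vmap \<phi> \<sigma>\<^sub>0)"
    using cc by (simp add: centralizer_def Y.action_kernel_iff Y.pi1_mult)
qed

text \<open>The factors commute, so they can be arranged as in \<open>deck_rel\<close>, with the
  image of an arrow before the local component.\<close>

lemma CU_iff:
  "n \<in> (centralizer G U \<inter> action_kernel Y (vmap \<phi> \<sigma>\<^sub>0)) <#>\<^bsub>G\<^esub> U \<longleftrightarrow>
    (\<exists>c u. c \<in> centralizer G U \<inter> action_kernel Y (vmap \<phi> \<sigma>\<^sub>0) \<and> u \<in> U \<and> n = u \<cdot>\<^sub>Y c)"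
  unfolding set_mult_def Y.pi1_mult by (auto simp: centralizer_def Y.pi1_mult)

text \<open>A homotopy \<open>l\<close> from \<eta> to the identity, combined with the witness, is a
  natural automorphism of the functor of \<phi>, which gives the factor in \<open>C\<close>.
  Conversely, a product of the two factors is itself related to the identity, and uniqueness up to
  homotopy applies.\<close>

lemma deck_rel_id_iff:
  assumes "deck_rel n \<eta>"
  shows "homotopic X X \<eta> (cog_id X) \<longleftrightarrow> n \<in> (centralizer G U \<inter> action_kernel Y (vmap \<phi> \<sigma>\<^sub>0)) <#>\<^bsub>G\<^esub> U"
proof
  note idm = cog_morphism_id[OF X.complex_of_groups_axioms dev_X]
  assume h: "homotopic X X \<eta> (cog_id X)"
  obtain k p where \<eta>: "\<eta> \<in> Aut X" "cog_morphism X X \<eta>" and w: "witness \<eta> k" and p: "p \<in> arrows X" "src p = \<sigma>\<^sub>0"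
    "tgt X p = vmap \<eta> \<sigma>\<^sub>0" and n: "n = ind p \<cdot>\<^sub>Y loc k \<sigma>\<^sub>0" using assms by (rule deck_relE)
  interpret E: cog_morphism X X \<eta> by fact
  have vm: "vmap \<eta> \<sigma> = \<sigma>" if "\<sigma> \<in> verts X" for \<sigma> using h that by (simp add: homotopic_def)
  note [simp] = witnessD(3)[OF w] vm
  obtain l where "intertwines X X \<eta> (cog_id X) l" using h by (auto simp: homotopic_iff_intertwines[OF dev_X])
  then have l [simp]: "\<And>\<sigma>. \<sigma> \<in> verts X \<Longrightarrow> l \<sigma> \<in> carrier (grp X \<sigma>)"
    and L: "\<And>c. c \<in> arrows X \<Longrightarrow> gcls X (src c) (l (src c)) \<cdot>\<^sub>X E.ind c = c \<cdot>\<^sub>X gcls X (tgt X c) (l (tgt X c))"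
    unfolding intertwines_def by (simp_all add: idm)
  let ?z = "\<lambda>\<sigma>. gmap \<phi> \<sigma> (l \<sigma>) \<otimes>\<^bsub>grp Y (vmap \<phi> \<sigma>)\<^esub> k \<sigma>"
  have "loc ?z (src x) \<cdot>\<^sub>Y ind x = ind x \<cdot>\<^sub>Y loc ?z (tgt X x)" if x: "x \<in> arrows X" for x
  proof -
    have "loc ?z (src x) \<cdot>\<^sub>Y ind x = ind (gcls X (src x) (l (src x))) \<cdot>\<^sub>Y (loc k (src x) \<cdot>\<^sub>Y ind x)"
      using x by (simp add: Y.gcls_mult)
    also have "\<dots> = ind (gcls X (src x) (l (src x)) \<cdot>\<^sub>X E.ind x) \<cdot>\<^sub>Y loc k (tgt X x)"
      unfolding witnessD(4)[OF w x] using x by simp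
    also have "\<dots> = ind x \<cdot>\<^sub>Y loc ?z (tgt X x)"
      unfolding L[OF x] using x by (simp add: Y.gcls_mult)
    finally show ?thesis .
  qed
  then have c: "loc ?z \<sigma>\<^sub>0 \<in> centralizer G U \<inter> action_kernel Y (vmap \<phi> \<sigma>\<^sub>0)"
    unfolding centralizer_kernel_iff by (intro exI[of _ ?z]) simp
  \<comment> \<open>The inverse of \<open>l\<close> closes \<open>p\<close> to a loop and cancels
    the image of \<open>l\<close> that was inserted in \<open>?z\<close>.\<close>
  let ?u = "p \<cdot>\<^sub>X ainv X (gcls X \<sigma>\<^sub>0 (l \<sigma>\<^sub>0))"
  have u: "ind ?u \<in> U" unfolding U_iff by (rule bexI[of _ ?u]) (use p in simp_all)
  have "n = ind ?u \<cdot>\<^sub>Y loc ?z \<sigma>\<^sub>0" unfolding n using p by (simp add: Y.gcls_mult)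
  then show "n \<in> (centralizer G U \<inter> action_kernel Y (vmap \<phi> \<sigma>\<^sub>0)) <#>\<^bsub>G\<^esub> U"
    unfolding CU_iff using c u by blast
next
  note idm = cog_morphism_id[OF X.complex_of_groups_axioms dev_X]
  assume "n \<in> (centralizer G U \<inter> action_kernel Y (vmap \<phi> \<sigma>\<^sub>0)) <#>\<^bsub>G\<^esub> U"
  then obtain z u where z: "\<And>\<sigma>. \<sigma> \<in> verts X \<Longrightarrow> z \<sigma> \<in> carrier (grp Y (vmap \<phi> \<sigma>))"
    and Z: "\<And>x. x \<in> arrows X \<Longrightarrow> loc z (src x) \<cdot>\<^sub>Y ind x = ind x \<cdot>\<^sub>Y loc z (tgt X x)"
    and u: "u \<in> U" and n: "n = u \<cdot>\<^sub>Y loc z \<sigma>\<^sub>0"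
    unfolding CU_iff centralizer_kernel_iff by blast
  obtain x where x: "x \<in> arrows X" "src x = \<sigma>\<^sub>0" "tgt X x = \<sigma>\<^sub>0" "u = ind x" using u unfolding U_iff by blast
  have "witness (cog_id X) z" unfolding witness_def using z Z by (simp add: idm)
  then have "deck_rel n (cog_id X)"
    unfolding deck_rel_def using cog_id_Aut[OF X.complex_of_groups_axioms dev_X] x n
    by (intro conjI exI[of _ z] exI[of _ x]) simp_all
  then show "homotopic X X \<eta> (cog_id X)" by (rule deck_rel_unique[OF assms])
qed

end

text \<open>Every element \<open>n\<close> of the normalizer arises from an automorphism \<open>\<eta>\<close>: lifting
  \<open>n \<cdot> \<phi>(r)\<close>, for an arrow \<open>r\<close> from the base vertex to \<open>\<sigma>\<close>, gives an arrow \<open>p \<sigma>\<close> of \<open>X\<close> whose target is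
  \<open>\<eta>(\<sigma>)\<close>, up to a correction \<open>k \<sigma>\<close> in the local group.\<close>

locale deck_construction = developable_covering X Y \<phi> \<sigma>\<^sub>0
  for X :: "('v, 'e, 'g, 'm) complex_of_groups_scheme"
    and Y :: "('w, 'd, 'h, 'n) complex_of_groups_scheme"
    and \<phi> :: "('v, 'e, 'w, 'd, 'g, 'h) cog_morphism" and \<sigma>\<^sub>0 :: 'v +
  fixes n and r p :: "'v \<Rightarrow> ('v, 'e, 'g) xpath set" and k :: "'v \<Rightarrow> 'h"
  assumes n: "n \<in> normalizer G U"
    and r [simp]: "\<sigma> \<in> verts X \<Longrightarrow> r \<sigma> \<in> arrows X" "\<sigma> \<in> verts X \<Longrightarrow> src (r \<sigma>) = \<sigma>\<^sub>0"
      "\<sigma> \<in> verts X \<Longrightarrow> tgt X (r \<sigma>) = \<sigma>"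
    and p [simp]: "\<sigma> \<in> verts X \<Longrightarrow> p \<sigma> \<in> arrows X" "\<sigma> \<in> verts X \<Longrightarrow> src (p \<sigma>) = \<sigma>\<^sub>0"
      "\<sigma> \<in> verts X \<Longrightarrow> vmap \<phi> (tgt X (p \<sigma>)) = vmap \<phi> \<sigma>"
    and k [simp]: "\<sigma> \<in> verts X \<Longrightarrow> k \<sigma> \<in> carrier (grp Y (vmap \<phi> \<sigma>))"
    and lift_eq: "\<sigma> \<in> verts X \<Longrightarrow> n \<cdot>\<^sub>Y ind (r \<sigma>) = ind (p \<sigma>) \<cdot>\<^sub>Y loc k \<sigma>"
begin

lemma n_typing [simp]: "n \<in> arrows Y" "src n = vmap \<phi> \<sigma>\<^sub>0" "tgt Y n = vmap \<phi> \<sigma>\<^sub>0"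
  using n unfolding normalizer_iff by blast+

lemma conj_loop:
  assumes "x \<in> arrows X" "src x = \<sigma>\<^sub>0" "tgt X x = \<sigma>\<^sub>0"
  obtains y where "y \<in> arrows X" "src y = \<sigma>\<^sub>0" "tgt X y = \<sigma>\<^sub>0" "ind y = n \<cdot>\<^sub>Y (ind x \<cdot>\<^sub>Y ainv Y n)"
proof -
  have "ind x \<in> U" unfolding U_iff using assms by blast
  then have "n \<cdot>\<^sub>Y (ind x \<cdot>\<^sub>Y ainv Y n) \<in> U" using n unfolding normalizer_iff by blast
  then obtain y where "y \<in> arrows X" "src y = \<sigma>\<^sub>0" "tgt X y = \<sigma>\<^sub>0" "n \<cdot>\<^sub>Y (ind x \<cdot>\<^sub>Y ainv Y n) = ind y"
    unfolding U_iff by blast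
  then show ?thesis using that by simp
qed

lemma conj_loop':
  assumes "x \<in> arrows X" "src x = \<sigma>\<^sub>0" "tgt X x = \<sigma>\<^sub>0"
  obtains y where "y \<in> arrows X" "src y = \<sigma>\<^sub>0" "tgt X y = \<sigma>\<^sub>0" "ind y = ainv Y n \<cdot>\<^sub>Y (ind x \<cdot>\<^sub>Y n)"
proof -
  have "ind x \<in> U" unfolding U_iff using assms by blast
  then have "ainv Y n \<cdot>\<^sub>Y (ind x \<cdot>\<^sub>Y n) \<in> U" using n unfolding normalizer_iff by blast
  then obtain y where "y \<in> arrows X" "src y = \<sigma>\<^sub>0" "tgt X y = \<sigma>\<^sub>0" "ainv Y n \<cdot>\<^sub>Y (ind x \<cdot>\<^sub>Y n) = ind y"
    unfolding U_iff by blast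
  then show ?thesis using that by simp
qed

section \<open>The functor on \<open>X\<close> obtained from conjugation by \<open>n\<close>\<close>

definition v where "v \<sigma> = tgt X (p \<sigma>)"

lemma v_typing [simp]:
  "\<sigma> \<in> verts X \<Longrightarrow> v \<sigma> \<in> verts X" "\<sigma> \<in> verts X \<Longrightarrow> vmap \<phi> (v \<sigma>) = vmap \<phi> \<sigma>"
  "\<sigma> \<in> verts X \<Longrightarrow> tgt X (p \<sigma>) = v \<sigma>"
  by (simp_all add: v_def)

declare p(3) [simp del]

lemma ind_p: "\<sigma> \<in> verts X \<Longrightarrow> ind (p \<sigma>) = n \<cdot>\<^sub>Y (ind (r \<sigma>) \<cdot>\<^sub>Y ainv Y (loc k \<sigma>))"
  using Y.amult_solve_right[OF lift_eq[symmetric]] by simp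

lemma ind_r: "\<sigma> \<in> verts X \<Longrightarrow> ind (r \<sigma>) = ainv Y n \<cdot>\<^sub>Y (ind (p \<sigma>) \<cdot>\<^sub>Y loc k \<sigma>)"
  using Y.amult_solve_left[OF lift_eq] by simp

text \<open>If \<open>k\<close> is to be a witness, naturality dictates the image in
  \<open>Y\<close> of the value at \<open>c\<close>; by faithfulness at most one arrow with the
  given ends has that image. The functor is constructed before the morphism inducing it.\<close>

definition H where
  "H c = (SOME d. d \<in> arrows X \<and> src d = v (src c) \<and> tgt X d = v (tgt X c) \<and>
     ind d = loc k (src c) \<cdot>\<^sub>Y (ind c \<cdot>\<^sub>Y ainv Y (loc k (tgt X c))))"

text \<open>The arrow \<open>c\<close> is closed to a loop by means of \<open>r\<close>, the loop is
  conjugated by \<open>n\<close> inside \<open>U\<close>, and the result is opened again by means of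
  \<open>p\<close>. The lift equations turn \<open>n\<close> and \<open>r\<close> into the
  components of \<open>k\<close>.\<close>

lemma H [simp]:
  assumes c: "c \<in> arrows X"
  shows "H c \<in> arrows X" "src (H c) = v (src c)" "tgt X (H c) = v (tgt X c)"
    and ind_H: "ind (H c) = loc k (src c) \<cdot>\<^sub>Y (ind c \<cdot>\<^sub>Y ainv Y (loc k (tgt X c)))"
proof -
  let ?x = "r (src c) \<cdot>\<^sub>X (c \<cdot>\<^sub>X ainv X (r (tgt X c)))"
  obtain y where y: "y \<in> arrows X" "src y = \<sigma>\<^sub>0" "tgt X y = \<sigma>\<^sub>0" "ind y = n \<cdot>\<^sub>Y (ind ?x \<cdot>\<^sub>Y ainv Y n)"
    by (rule conj_loop[of ?x]) (use c in simp_all)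
  let ?d = "ainv X (p (src c)) \<cdot>\<^sub>X (y \<cdot>\<^sub>X p (tgt X c))"
  have d: "?d \<in> arrows X" "src ?d = v (src c)" "tgt X ?d = v (tgt X c)" using c y by simp_all
  have "ind ?d = loc k (src c) \<cdot>\<^sub>Y (ind c \<cdot>\<^sub>Y ainv Y (loc k (tgt X c)))"
    using c y by (simp add: ind_p)
  then have "\<exists>d. d \<in> arrows X \<and> src d = v (src c) \<and> tgt X d = v (tgt X c) \<and>
     ind d = loc k (src c) \<cdot>\<^sub>Y (ind c \<cdot>\<^sub>Y ainv Y (loc k (tgt X c)))"
    using d by blast
  from someI_ex[OF this] show "H c \<in> arrows X" "src (H c) = v (src c)" "tgt X (H c) = v (tgt X c)"
    "ind (H c) = loc k (src c) \<cdot>\<^sub>Y (ind c \<cdot>\<^sub>Y ainv Y (loc k (tgt X c)))"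
    unfolding H_def by blast+
qed

lemma H_mult: "\<lbrakk>c \<in> arrows X; d \<in> arrows X; tgt X c = src d\<rbrakk> \<Longrightarrow> H (c \<cdot>\<^sub>X d) = H c \<cdot>\<^sub>X H d"
  by (rule ind_inj) simp_all

lemma H_inv: "c \<in> arrows X \<Longrightarrow> H (ainv X c) = ainv X (H c)"
  by (rule ind_inj) simp_all

lemma H_inj: "\<lbrakk>c \<in> arrows X; d \<in> arrows X; src c = src d; tgt X c = tgt X d; H c = H d\<rbrakk> \<Longrightarrow> c = d"
proof (rule ind_inj)
  assume a: "c \<in> arrows X" "d \<in> arrows X" "src c = src d" "tgt X c = tgt X d" "H c = H d"
  have "ind (H c) = ind (H d)" unfolding a(5) ..
  from this[unfolded ind_H[OF a(1)] ind_H[OF a(2)]] show "ind c = ind d"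
    using a(1-4) by (simp add: Y.amult_right_cancel)
qed

text \<open>The image of the value of \<open>H\<close> is a conjugate of a local element by
  \<open>k\<close>, hence local, and the functor of a covering reflects this.\<close>

lemma ex_local:
  assumes "\<sigma> \<in> verts X" "g \<in> carrier (grp X \<sigma>)"
  shows "\<exists>h. h \<in> carrier (grp X (v \<sigma>)) \<and> H (gcls X \<sigma> g) = gcls X (v \<sigma>) h"
proof -
  let ?g = "k \<sigma> \<otimes>\<^bsub>grp Y (vmap \<phi> \<sigma>)\<^esub> (gmap \<phi> \<sigma> g \<otimes>\<^bsub>grp Y (vmap \<phi> \<sigma>)\<^esub> inv\<^bsub>grp Y (vmap \<phi> \<sigma>)\<^esub> k \<sigma>)"
  have "ind (H (gcls X \<sigma> g)) = gcls Y (vmap \<phi> (src (H (gcls X \<sigma> g)))) ?g"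
    using assms by (simp add: Y.gcls_mult Y.gcls_inv)
  then obtain h where "h \<in> carrier (grp X (src (H (gcls X \<sigma> g))))" "H (gcls X \<sigma> g) = gcls X (src (H (gcls X \<sigma> g))) h"
    by (rule ind_eq_gclsD[rotated 2]) (use assms in simp_all)
  then show ?thesis using assms by auto
qed

definition gm where "gm \<sigma> g = (SOME h. h \<in> carrier (grp X (v \<sigma>)) \<and> H (gcls X \<sigma> g) = gcls X (v \<sigma>) h)"

lemma gm [simp]:
  assumes "\<sigma> \<in> verts X" "g \<in> carrier (grp X \<sigma>)"
  shows "gm \<sigma> g \<in> carrier (grp X (v \<sigma>))" and H_gcls: "H (gcls X \<sigma> g) = gcls X (v \<sigma>) (gm \<sigma> g)"
  unfolding gm_def using someI_ex[OF ex_local[OF assms]] by blast+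

definition el where "el a = edge_lift (v (ini X a)) (emap \<phi> a)"

lemma el [simp]:
  assumes "a \<in> edges X"
  shows "el a \<in> edges X" "ini X (el a) = v (ini X a)" "emap \<phi> (el a) = emap \<phi> a"
    and "vmap \<phi> (ter X (el a)) = vmap \<phi> (ter X a)"
  unfolding el_def using assms by (simp_all add: vmap_ter_edge_lift)

text \<open>It is not clear beforehand that \<open>el a\<close> ends at \<open>v (ter X a)\<close>.
  The image of \<open>H (ecls X a)\<close> differs from that of the edge \<open>el a\<close> by a
  local element, so reflection gives both the equality of the ends and the element of the
  morphism.\<close>

lemma ex_edge_elt:
  assumes a: "a \<in> edges X"
  shows "\<exists>t. t \<in> carrier (grp X (v (ter X a))) \<and> ter X (el a) = v (ter X a) \<and>
    H (ecls X a) = ecls X (el a) \<cdot>\<^sub>X gcls X (v (ter X a)) (inv\<^bsub>grp X (v (ter X a))\<^esub> t)"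
proof -
  let ?i = "vmap \<phi> (ini X a)" and ?t = "vmap \<phi> (ter X a)"
  let ?p = "psi Y (emap \<phi> a) (k (ini X a))"
  have ki: "k (ini X a) \<in> carrier (grp Y ?i)" and kt: "k (ter X a) \<in> carrier (grp Y ?t)" using a by simp_all
  have pc: "?p \<in> carrier (grp Y ?t)" using Y.psi_closed[of "emap \<phi> a" "k (ini X a)"] a ki by simp
  have te: "telt \<phi> (el a) \<in> carrier (grp Y ?t)" using telt_closed[of "el a"] a by simp
  \<comment> \<open>The local difference of the two images: \<open>?p\<close> is the component at
    the start after sliding across the edge, and the first factor compensates the inverse in the
    image of \<open>el a\<close>.\<close>
  let ?s = "telt \<phi> (el a) \<otimes>\<^bsub>grp Y ?t\<^esub> (?p \<otimes>\<^bsub>grp Y ?t\<^esub> (inv\<^bsub>grp Y ?t\<^esub> telt \<phi> a \<otimes>\<^bsub>grp Y ?t\<^esub> inv\<^bsub>grp Y ?t\<^esub> k (ter X a)))"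
  have sl: "loc k (ini X a) \<cdot>\<^sub>Y ecls Y (emap \<phi> a) = ecls Y (emap \<phi> a) \<cdot>\<^sub>Y gcls Y ?t ?p"
    using Y.gcls_ecls[of "emap \<phi> a" "k (ini X a)"] a ki by simp
  have "ind (H (ecls X a)) = (loc k (ini X a) \<cdot>\<^sub>Y ecls Y (emap \<phi> a)) \<cdot>\<^sub>Y
      (gcls Y ?t (inv\<^bsub>grp Y ?t\<^esub> telt \<phi> a) \<cdot>\<^sub>Y ainv Y (loc k (ter X a)))"
    using a by simp
  also have "\<dots> = ind (ecls X (el a)) \<cdot>\<^sub>Y gcls Y (vmap \<phi> (tgt X (ecls X (el a)))) ?s"
    unfolding sl using a pc te by (simp add: Y.gcls_mult Y.gcls_inv)
  finally obtain h where h: "h \<in> carrier (grp X (tgt X (ecls X (el a))))"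
    "H (ecls X a) = ecls X (el a) \<cdot>\<^sub>X gcls X (tgt X (ecls X (el a))) h"
    by (rule ind_eq_mult_gclsD[rotated 4]) (use a pc te in simp_all)
  have t: "ter X (el a) = v (ter X a)" using arg_cong[OF h(2), of "tgt X"] h(1) a by simp
  show ?thesis
    using h a t by (intro exI[of _ "inv\<^bsub>grp X (v (ter X a))\<^esub> h"]) simp
qed

definition te where
  "te a = (SOME t. t \<in> carrier (grp X (v (ter X a))) \<and> ter X (el a) = v (ter X a) \<and>
    H (ecls X a) = ecls X (el a) \<cdot>\<^sub>X gcls X (v (ter X a)) (inv\<^bsub>grp X (v (ter X a))\<^esub> t))"

lemma te [simp]:
  assumes "a \<in> edges X"
  shows "te a \<in> carrier (grp X (v (ter X a)))" "ter X (el a) = v (ter X a)"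
    and H_ecls: "H (ecls X a) = ecls X (el a) \<cdot>\<^sub>X gcls X (v (ter X a)) (inv\<^bsub>grp X (v (ter X a))\<^esub> te a)"
  unfolding te_def using someI_ex[OF ex_edge_elt[OF assms]] by blast+

section \<open>The automorphism assembled from the functor\<close>

definition \<eta> :: "('v, 'e, 'v, 'e, 'g, 'g) cog_morphism" where
  "\<eta> = \<lparr>vmap = v, emap = el, gmap = gm, telt = te\<rparr>"

lemma \<eta>_simps [simp]: "vmap \<eta> = v" "emap \<eta> = el" "gmap \<eta> = gm" "telt \<eta> = te"
  by (simp_all add: \<eta>_def)

lemma el_eqI: "\<lbrakk>a \<in> edges X; b \<in> edges X; ini X b = v (ini X a); emap \<phi> b = emap \<phi> a\<rbrakk> \<Longrightarrow> el a = b"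
  by (rule emap_inj) simp_all

lemma el_bij:
  assumes "\<sigma> \<in> verts X"
  shows "bij_betw el {a \<in> edges X. ini X a = \<sigma>} {a \<in> edges X. ini X a = v \<sigma>}"
  unfolding bij_betw_def
proof (intro conjI inj_onI subset_antisym subsetI)
  fix a b assume "a \<in> {a \<in> edges X. ini X a = \<sigma>}" "b \<in> {a \<in> edges X. ini X a = \<sigma>}" "el a = el b"
  then show "a = b" using el(3)[of a] el(3)[of b] by (intro emap_inj) auto
next
  fix b assume b: "b \<in> {a \<in> edges X. ini X a = v \<sigma>}"
  then obtain a where a: "a \<in> edges X" "ini X a = \<sigma>" "emap \<phi> a = emap \<phi> b"
    using ex_edge_lift[OF assms, of "emap \<phi> b"] assms by auto
  then have "el a = b" using b by (intro el_eqI) auto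
  then show "b \<in> el ` {a \<in> edges X. ini X a = \<sigma>}" using a by blast
qed (use assms in auto)

lemma \<eta>_morphism: "cog_morphism X X \<eta>"
proof (rule cog_morphismI[where F = H])
  show "scwol_morphism X X \<eta>"
  proof
    fix a b assume ab: "(a, b) \<in> E2 X"
    note v = X.E2D[OF ab]
    have ab': "(el a, el b) \<in> E2 X" using v by (simp add: E2_def)
    note w = X.E2D[OF ab']
    show "emap \<eta> (cmp X a b) = cmp X (emap \<eta> a) (emap \<eta> b)"
      unfolding \<eta>_simps
      by (rule el_eqI) (use v w emap_cmp[OF ab] emap_cmp[OF ab'] in simp_all)
  qed (use el_bij in simp_all)
qed (use X.complex_of_groups_axioms dev_X H_mult in simp_all)

lemma \<eta>_induced:
  assumes "c \<in> arrows X" shows "induced_hom X X \<eta> c = H c"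
proof -
  interpret E: cog_morphism X X \<eta> by (rule \<eta>_morphism)
  show ?thesis by (rule E.functor_eq_ind[OF _ _ _ _ assms]) (simp_all add: H_mult H_inv)
qed

text \<open>If the images coincide, \<open>p\<close> at one vertex followed by the inverse of
  \<open>p\<close> at the other is a loop. Conjugated by the inverse of \<open>n\<close> it comes
  from a loop \<open>y\<close>, and the two arrows \<open>r\<close> have images that agree, up to a
  local element, once one is preceded by \<open>y\<close>. Reflection identifies their ends.\<close>

lemma v_inj: "inj_on v (verts X)"
proof (rule inj_onI)
  fix \<sigma> \<sigma>' assume \<sigma>: "\<sigma> \<in> verts X" "\<sigma>' \<in> verts X" and eq: "v \<sigma> = v \<sigma>'"
  have vv: "vmap \<phi> \<sigma>' = vmap \<phi> \<sigma>" using arg_cong[OF eq, of "vmap \<phi>"] \<sigma> by simp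
  have k': "k \<sigma>' \<in> carrier (grp Y (vmap \<phi> \<sigma>))" using k[OF \<sigma>(2)] vv by simp
  let ?w = "p \<sigma>' \<cdot>\<^sub>X ainv X (p \<sigma>)"
  obtain y where y: "y \<in> arrows X" "src y = \<sigma>\<^sub>0" "tgt X y = \<sigma>\<^sub>0" "ind y = ainv Y n \<cdot>\<^sub>Y (ind ?w \<cdot>\<^sub>Y n)"
    by (rule conj_loop'[of ?w]) (use \<sigma> eq in simp_all)
  let ?g = "inv\<^bsub>grp Y (vmap \<phi> \<sigma>)\<^esub> k \<sigma> \<otimes>\<^bsub>grp Y (vmap \<phi> \<sigma>)\<^esub> k \<sigma>'"
  let ?c = "y \<cdot>\<^sub>X r \<sigma>"
  have pp: "ind (p \<sigma>') = ind ?w \<cdot>\<^sub>Y ind (p \<sigma>)" using \<sigma> eq vv by simp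
  have "ind (r \<sigma>') = ainv Y n \<cdot>\<^sub>Y ((ind ?w \<cdot>\<^sub>Y (n \<cdot>\<^sub>Y (ind (r \<sigma>) \<cdot>\<^sub>Y ainv Y (loc k \<sigma>)))) \<cdot>\<^sub>Y gcls Y (vmap \<phi> \<sigma>) (k \<sigma>'))"
    unfolding ind_r[OF \<sigma>(2)] pp ind_p[OF \<sigma>(1)] vv ..
  also have "\<dots> = (ainv Y n \<cdot>\<^sub>Y (ind ?w \<cdot>\<^sub>Y n)) \<cdot>\<^sub>Y (ind (r \<sigma>) \<cdot>\<^sub>Y gcls Y (vmap \<phi> \<sigma>) ?g)"
  proof -
    have w: "ind ?w \<in> arrows Y" "src (ind ?w) = vmap \<phi> \<sigma>\<^sub>0" "tgt Y (ind ?w) = vmap \<phi> \<sigma>\<^sub>0"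
      using \<sigma> eq by (simp_all del: ind_amult)
    then show ?thesis using \<sigma> k' by (simp add: Y.gcls_mult Y.gcls_inv del: ind_amult)
  qed
  also have "\<dots> = ind ?c \<cdot>\<^sub>Y gcls Y (vmap \<phi> \<sigma>) ?g"
    unfolding y(4)[symmetric] using \<sigma> y(1-3) k' by simp
  finally have e: "ind (r \<sigma>') = ind ?c \<cdot>\<^sub>Y gcls Y (vmap \<phi> (tgt X ?c)) ?g" using \<sigma> y(1-3) by simp
  obtain h where h: "h \<in> carrier (grp X (tgt X ?c))" "r \<sigma>' = ?c \<cdot>\<^sub>X gcls X (tgt X ?c) h"
    by (rule ind_eq_mult_gclsD[OF _ _ _ _ e]) (use \<sigma> y(1-3) k' in simp_all)
  show "\<sigma> = \<sigma>'" using arg_cong[OF h(2), of "tgt X"] h(1) \<sigma> y(1-3) by simp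
qed

text \<open>The preimage is found by lifting the inverse of \<open>n\<close> followed by the image
  of \<open>r \<rho>\<close>. Its end \<open>?\<sigma>\<close> is the right vertex because, up to a
  loop \<open>y\<close>, the arrow \<open>p ?\<sigma>\<close> has the image of
  \<open>r \<rho>\<close> modulo local elements.\<close>

lemma v_surj: "verts X \<subseteq> v ` verts X"
proof
  fix \<rho> assume \<rho>: "\<rho> \<in> verts X"
  have "ainv Y n \<cdot>\<^sub>Y ind (r \<rho>) \<in> arrows Y" "src (ainv Y n \<cdot>\<^sub>Y ind (r \<rho>)) = vmap \<phi> \<sigma>\<^sub>0"
    "tgt Y (ainv Y n \<cdot>\<^sub>Y ind (r \<rho>)) = vmap \<phi> \<rho>" using \<rho> by simp_all
  then obtain s g where s: "s \<in> arrows X" "src s = \<sigma>\<^sub>0" "vmap \<phi> (tgt X s) = vmap \<phi> \<rho>"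
    and g: "g \<in> carrier (grp Y (vmap \<phi> \<rho>))"
    and se: "ainv Y n \<cdot>\<^sub>Y ind (r \<rho>) = ind s \<cdot>\<^sub>Y gcls Y (vmap \<phi> \<rho>) g"
    using ex_arrow_lift[of "ainv Y n \<cdot>\<^sub>Y ind (r \<rho>)" \<sigma>\<^sub>0] by auto
  let ?\<sigma> = "tgt X s"
  have k': "k ?\<sigma> \<in> carrier (grp Y (vmap \<phi> \<rho>))" using k[of ?\<sigma>] s by simp
  obtain y where y: "y \<in> arrows X" "src y = \<sigma>\<^sub>0" "tgt X y = \<sigma>\<^sub>0"
    "ind y = n \<cdot>\<^sub>Y (ind (s \<cdot>\<^sub>X ainv X (r ?\<sigma>)) \<cdot>\<^sub>Y ainv Y n)"
    by (rule conj_loop[of "s \<cdot>\<^sub>X ainv X (r ?\<sigma>)"]) (use s in simp_all)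
  have rs: "ind (r \<rho>) = n \<cdot>\<^sub>Y (ind s \<cdot>\<^sub>Y gcls Y (vmap \<phi> \<rho>) g)"
    unfolding se[symmetric] using \<rho> by simp
  let ?g = "k ?\<sigma> \<otimes>\<^bsub>grp Y (vmap \<phi> \<rho>)\<^esub> g"
  have "ind (r \<rho>) = ind (y \<cdot>\<^sub>X p ?\<sigma>) \<cdot>\<^sub>Y gcls Y (vmap \<phi> (tgt X (y \<cdot>\<^sub>X p ?\<sigma>))) ?g"
    unfolding rs using s y g k' \<rho> by (simp add: ind_p Y.gcls_mult)
  then obtain h where h: "h \<in> carrier (grp X (tgt X (y \<cdot>\<^sub>X p ?\<sigma>)))"
    "r \<rho> = (y \<cdot>\<^sub>X p ?\<sigma>) \<cdot>\<^sub>X gcls X (tgt X (y \<cdot>\<^sub>X p ?\<sigma>)) h"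
    by (rule ind_eq_mult_gclsD[rotated 4]) (use s y g k' \<rho> in simp_all)
  have "\<rho> = v ?\<sigma>" using arg_cong[OF h(2), of "tgt X"] h(1) s y \<rho> by simp
  then show "\<rho> \<in> v ` verts X" using s by auto
qed

lemma v_bij: "bij_betw v (verts X) (verts X)"
  using v_inj v_surj by (auto simp: bij_betw_def)

lemma el_bij_edges: "bij_betw el (edges X) (edges X)"
  unfolding bij_betw_def
proof (intro conjI inj_onI subset_antisym subsetI)
  fix a b assume ab: "a \<in> edges X" "b \<in> edges X" "el a = el b"
  have "v (ini X a) = v (ini X b)" using ab el(2)[of a] el(2)[of b] by simp
  then have i: "ini X a = ini X b" using v_inj ab by (simp add: inj_on_eq_iff)
  show "a = b" by (rule emap_inj[OF ab(1,2) i]) (use ab el(3)[of a] el(3)[of b] in simp)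
next
  fix b assume b: "b \<in> edges X"
  then obtain \<sigma> where \<sigma>: "\<sigma> \<in> verts X" "ini X b = v \<sigma>" using v_surj X.ini_closed by blast
  then show "b \<in> el ` edges X" using bij_betw_imp_surj_on[OF el_bij[OF \<sigma>(1)]] b by blast
qed auto

text \<open>The local element \<open>h\<close> is carried to a loop at the base by \<open>p\<close>,
  conjugated by the inverse of \<open>n\<close>, and brought to \<sigma> by \<open>r\<close>. The
  image of the result is local, so it comes from an element \<open>g\<close>.\<close>

lemma gm_surj:
  assumes \<sigma>: "\<sigma> \<in> verts X" and h: "h \<in> carrier (grp X (v \<sigma>))"
  shows "h \<in> gm \<sigma> ` carrier (grp X \<sigma>)"
proof -
  let ?G = "grp Y (vmap \<phi> \<sigma>)"
  have gh: "gmap \<phi> (v \<sigma>) h \<in> carrier ?G" using gmap_closed[of "v \<sigma>" h] \<sigma> h by simp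
  let ?x = "p \<sigma> \<cdot>\<^sub>X (gcls X (v \<sigma>) h \<cdot>\<^sub>X ainv X (p \<sigma>))"
  obtain y where y: "y \<in> arrows X" "src y = \<sigma>\<^sub>0" "tgt X y = \<sigma>\<^sub>0" "ind y = ainv Y n \<cdot>\<^sub>Y (ind ?x \<cdot>\<^sub>Y n)"
    by (rule conj_loop'[of ?x]) (use \<sigma> h in simp_all)
  let ?c = "ainv X (r \<sigma>) \<cdot>\<^sub>X (y \<cdot>\<^sub>X r \<sigma>)"
  let ?g = "inv\<^bsub>?G\<^esub> k \<sigma> \<otimes>\<^bsub>?G\<^esub> (gmap \<phi> (v \<sigma>) h \<otimes>\<^bsub>?G\<^esub> k \<sigma>)"
  have c: "?c \<in> arrows X" "src ?c = \<sigma>" "tgt X ?c = \<sigma>" using y(1-3) \<sigma> by simp_all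
  have "ind ?c = gcls Y (vmap \<phi> (src ?c)) ?g"
    using y \<sigma> h gh by (simp add: ind_p Y.gcls_mult Y.gcls_inv)
  then obtain g where "g \<in> carrier (grp X (src ?c))" "?c = gcls X (src ?c) g"
    by (rule ind_eq_gclsD[rotated 2]) (use c \<sigma> gh in simp_all)
  then have g: "g \<in> carrier (grp X \<sigma>)" and cg: "?c = gcls X \<sigma> g" unfolding c by blast+
  have "H (gcls X \<sigma> g) = gcls X (v \<sigma>) h"
  proof (rule ind_inj)
    show "ind (H (gcls X \<sigma> g)) = ind (gcls X (v \<sigma>) h)"
      unfolding cg[symmetric] ind_H[OF c(1)] \<open>ind ?c = _\<close> c using \<sigma> h gh by (simp add: Y.gcls_mult Y.gcls_inv)
  qed (use \<sigma> g h in \<open>simp_all del: H_gcls\<close>)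
  then have "gm \<sigma> g = h" using X.gcls_inj[OF dev_X, of "v \<sigma>" "gm \<sigma> g" h] \<sigma> g h by simp
  then show ?thesis using g by blast
qed

lemma \<eta>_Aut: "\<eta> \<in> Aut X"
proof -
  interpret E: cog_morphism X X \<eta> by (rule \<eta>_morphism)
  have "gm \<sigma> \<in> iso (grp X \<sigma>) (grp X (v \<sigma>))" if \<sigma>: "\<sigma> \<in> verts X" for \<sigma>
  proof (rule isoI)
    show "gm \<sigma> \<in> hom (grp X \<sigma>) (grp X (v \<sigma>))" using E.gmap_hom[OF \<sigma>] by simp
    show "bij_betw (gm \<sigma>) (carrier (grp X \<sigma>)) (carrier (grp X (v \<sigma>)))"
      unfolding bij_betw_def
    proof (intro conjI inj_onI subset_antisym subsetI)
      fix g h assume gh: "g \<in> carrier (grp X \<sigma>)" "h \<in> carrier (grp X \<sigma>)" "gm \<sigma> g = gm \<sigma> h"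
      have "gcls X \<sigma> g = gcls X \<sigma> h" by (rule H_inj) (use gh \<sigma> in simp_all)
      then show "g = h" using X.gcls_inj[OF dev_X \<sigma> gh(1,2)] by blast
    qed (use \<sigma> gm_surj in auto)
  qed
  then show ?thesis
    using \<eta>_morphism E.scwol_morphism_axioms v_bij el_bij_edges by (simp add: Aut_def scwol_iso_def)
qed

lemma deck_rel_\<eta>: "deck_rel n \<eta>"
proof -
  have w: "witness \<eta> k" unfolding witness_def by (simp add: \<eta>_induced)
  \<comment> \<open>The chosen arrow \<open>r \<sigma>\<^sub>0\<close> is a loop that may be
    nontrivial; \<open>H\<close> of its inverse removes its contribution to the lift
    equation.\<close>
  let ?p = "p \<sigma>\<^sub>0 \<cdot>\<^sub>X H (ainv X (r \<sigma>\<^sub>0))"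
  have "n = ind ?p \<cdot>\<^sub>Y loc k \<sigma>\<^sub>0" by (simp add: ind_p)
  then show ?thesis unfolding deck_rel_def using w \<eta>_Aut
    by (intro conjI exI[of _ k] exI[of _ ?p]) simp_all
qed

end

section \<open>The isomorphism\<close>

context developable_covering
begin

text \<open>The data for the construction are chosen vertex by vertex; no compatibility between the
  choices at different vertices is imposed.\<close>

lemma ex_deck_rel_normalizer:
  assumes n: "n \<in> normalizer G U"
  shows "\<exists>\<eta>. deck_rel n \<eta>"
proof -
  have nt: "n \<in> arrows Y" "src n = vmap \<phi> \<sigma>\<^sub>0" "tgt Y n = vmap \<phi> \<sigma>\<^sub>0"
    using n unfolding normalizer_iff by blast+
  let ?P = "\<lambda>\<sigma> r p k. r \<in> arrows X \<and> src r = \<sigma>\<^sub>0 \<and> tgt X r = \<sigma> \<and> p \<in> arrows X \<and> src p = \<sigma>\<^sub>0 \<and>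
      vmap \<phi> (tgt X p) = vmap \<phi> \<sigma> \<and> k \<in> carrier (grp Y (vmap \<phi> \<sigma>)) \<and>
      n \<cdot>\<^sub>Y ind r = ind p \<cdot>\<^sub>Y gcls Y (vmap \<phi> \<sigma>) k"
  have "\<exists>r p k. ?P \<sigma> r p k" if \<sigma>: "\<sigma> \<in> verts X" for \<sigma>
  proof -
    obtain r where r: "r \<in> arrows X" "src r = \<sigma>\<^sub>0" "tgt X r = \<sigma>" using X.ex_arrow[OF base \<sigma>] by blast
    have "n \<cdot>\<^sub>Y ind r \<in> arrows Y" "src (n \<cdot>\<^sub>Y ind r) = vmap \<phi> \<sigma>\<^sub>0" "tgt Y (n \<cdot>\<^sub>Y ind r) = vmap \<phi> \<sigma>"
      using nt r by simp_all
    then obtain p k where "p \<in> arrows X" "src p = \<sigma>\<^sub>0" "vmap \<phi> (tgt X p) = vmap \<phi> \<sigma>"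
      "k \<in> carrier (grp Y (vmap \<phi> \<sigma>))" "n \<cdot>\<^sub>Y ind r = ind p \<cdot>\<^sub>Y gcls Y (vmap \<phi> \<sigma>) k"
      using ex_arrow_lift[of "n \<cdot>\<^sub>Y ind r" \<sigma>\<^sub>0] by auto
    then show ?thesis using r by blast
  qed
  then have "\<forall>\<sigma>\<in>verts X. \<exists>r p k. ?P \<sigma> r p k" by blast
  from bchoice[OF this] obtain r where "\<forall>\<sigma>\<in>verts X. \<exists>p k. ?P \<sigma> (r \<sigma>) p k" by blast
  from bchoice[OF this] obtain p where "\<forall>\<sigma>\<in>verts X. \<exists>k. ?P \<sigma> (r \<sigma>) (p \<sigma>) k" by blast
  from bchoice[OF this] obtain k where rpk: "\<forall>\<sigma>\<in>verts X. ?P \<sigma> (r \<sigma>) (p \<sigma>) (k \<sigma>)" by blast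
  have "deck_construction X Y \<phi> \<sigma>\<^sub>0 n r p k"
    by unfold_locales (use n rpk in blast)+
  from deck_construction.deck_rel_\<eta>[OF this] show ?thesis by (rule exI)
qed

abbreviation C where "C \<equiv> centralizer G U \<inter> action_kernel Y (vmap \<phi> \<sigma>\<^sub>0)"

abbreviation N where "N \<equiv> G\<lparr>carrier := normalizer G U\<rparr>"

definition deck_class where
  "deck_class n = mor_class X X (SOME \<eta>. deck_rel n \<eta>)"

lemma deck_rel_morphism: "deck_rel n \<eta> \<Longrightarrow> cog_morphism X X \<eta>"
  using AutD unfolding deck_rel_def by blast

lemma deck_class_eq:
  assumes "deck_rel n \<eta>"
  shows "deck_class n = mor_class X X \<eta>"
proof -
  have s: "deck_rel n (SOME \<eta>. deck_rel n \<eta>)" using assms by (rule someI)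
  then show ?thesis unfolding deck_class_def
    using mor_class_eq_iff[OF deck_rel_morphism[OF s] deck_rel_morphism[OF assms] dev_X]
      deck_rel_unique[OF s assms] by blast
qed

text \<open>By \<open>homotopic_compose\<close> all members of the union defining the product are
  the same class.\<close>

lemma Deck_mult:
  assumes "cog_morphism X X \<eta>" "cog_morphism X X \<theta>"
  shows "mor_class X X \<eta> \<otimes>\<^bsub>Deck X Y \<phi>\<^esub> mor_class X X \<theta> = mor_class X X (cog_compose X X \<eta> \<theta>)"
proof -
  have "mor_class X X (cog_compose X X \<eta>' \<theta>') = mor_class X X (cog_compose X X \<eta> \<theta>)"
    if "\<eta>' \<in> mor_class X X \<eta>" "\<theta>' \<in> mor_class X X \<theta>" for \<eta>' \<theta>'
  proof -
    have h: "homotopic X X \<eta> \<eta>'" "homotopic X X \<theta> \<theta>'" using that by (simp_all add: mor_class_def)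
    have "homotopic X X (cog_compose X X \<eta> \<theta>) (cog_compose X X \<eta>' \<theta>')"
      by (rule homotopic_compose[OF h(2,1) dev_X dev_X])
    then show ?thesis
      using mor_class_eq_iff[OF _ _ dev_X] by (metis homotopic_def)
  qed
  then have "mor_class X X \<eta> \<otimes>\<^bsub>Deck X Y \<phi>\<^esub> mor_class X X \<theta>
      = (\<Union>\<eta>'\<in>mor_class X X \<eta>. \<Union>\<theta>'\<in>mor_class X X \<theta>. mor_class X X (cog_compose X X \<eta> \<theta>))"
    unfolding Deck_def monoid.simps by (intro SUP_cong refl)
  moreover have "\<eta> \<in> mor_class X X \<eta>" "\<theta> \<in> mor_class X X \<theta>"
    using homotopic_refl[OF _ dev_X] assms by (simp_all add: mor_class_def)
  ultimately show ?thesis by auto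
qed

lemma deck_class_image: "deck_class ` carrier N = carrier (Deck X Y \<phi>)"
proof (intro subset_antisym subsetI)
  fix D assume "D \<in> deck_class ` carrier N"
  then obtain n where n: "n \<in> normalizer G U" "D = deck_class n" by auto
  then obtain \<eta> where \<eta>: "deck_rel n \<eta>" using ex_deck_rel_normalizer by blast
  then show "D \<in> carrier (Deck X Y \<phi>)"
    using deck_rel_witness[OF \<eta>] deck_class_eq[OF \<eta>] n by (auto simp: Deck_def)
next
  fix D assume "D \<in> carrier (Deck X Y \<phi>)"
  then obtain \<eta> where \<eta>: "\<eta> \<in> Aut X" "homotopic X Y \<phi> (cog_compose X Y \<phi> \<eta>)" "D = mor_class X X \<eta>"
    by (auto simp: Deck_def)
  then obtain n where n: "deck_rel n \<eta>" using ex_deck_rel by blast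
  have "D = deck_class n" using deck_class_eq[OF n] \<eta>(3) by simp
  moreover have "n \<in> carrier N" using deck_rel_normalizer[OF n] by simp
  ultimately show "D \<in> deck_class ` carrier N" by blast
qed

lemma N_group: "group N"
  using group.subgroup_imp_group[OF G_group group.normalizer_imp_subgroup[OF G_group U_subset]] .

lemma deck_class_hom: "deck_class \<in> hom N (Deck X Y \<phi>)"
proof (rule homI)
  show "deck_class n \<in> carrier (Deck X Y \<phi>)" if "n \<in> carrier N" for n
    using deck_class_image that by blast
  fix n m assume "n \<in> carrier N" "m \<in> carrier N"
  then have "\<exists>\<eta>. deck_rel n \<eta>" "\<exists>\<theta>. deck_rel m \<theta>" by (simp_all add: ex_deck_rel_normalizer)
  then obtain \<eta> \<theta> where \<eta>: "deck_rel n \<eta>" "deck_rel m \<theta>" by blast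
  show "deck_class (n \<otimes>\<^bsub>N\<^esub> m) = deck_class n \<otimes>\<^bsub>Deck X Y \<phi>\<^esub> deck_class m"
    using Deck_mult[of \<eta> \<theta>] \<eta> deck_rel_morphism deck_class_eq[OF deck_rel_compose[OF \<eta>]]
    by (simp add: deck_class_eq Y.pi1_mult)
qed

lemma deck_class_eq_one_iff:
  assumes "n \<in> carrier N"
  shows "deck_class n = \<one>\<^bsub>Deck X Y \<phi>\<^esub> \<longleftrightarrow> n \<in> C <#>\<^bsub>G\<^esub> U"
proof -
  obtain \<eta> where \<eta>: "deck_rel n \<eta>" using ex_deck_rel_normalizer[of n] assms by auto
  have "deck_class n = \<one>\<^bsub>Deck X Y \<phi>\<^esub> \<longleftrightarrow> homotopic X X \<eta> (cog_id X)"
    unfolding deck_class_eq[OF \<eta>]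
    using mor_class_eq_iff[OF deck_rel_morphism[OF \<eta>] cog_morphism_id(1)[OF X.complex_of_groups_axioms dev_X] dev_X]
    by (simp add: Deck_def)
  then show ?thesis using deck_rel_id_iff[OF \<eta>] by simp
qed

lemma one_in_CU: "\<one>\<^bsub>G\<^esub> \<in> C <#>\<^bsub>G\<^esub> U"
proof -
  have "idcls Y (vmap \<phi> \<sigma>\<^sub>0) \<in> C"
    unfolding centralizer_kernel_iff by (intro exI[of _ "\<lambda>\<sigma>. \<one>\<^bsub>grp Y (vmap \<phi> \<sigma>)\<^esub>"]) simp
  moreover have "\<one>\<^bsub>G\<^esub> \<in> U" using U_subgroup by (rule subgroup.one_closed)
  moreover have "\<one>\<^bsub>G\<^esub> = \<one>\<^bsub>G\<^esub> \<cdot>\<^sub>Y idcls Y (vmap \<phi> \<sigma>\<^sub>0)" by (simp add: Y.pi1_one)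
  ultimately show ?thesis unfolding CU_iff by blast
qed

text \<open>Elements of this product are related to the identity automorphism, and every related
  element normalizes \<open>U\<close>.\<close>

lemma CU_subset: "C <#>\<^bsub>G\<^esub> U \<subseteq> carrier N"
proof
  fix n assume "n \<in> C <#>\<^bsub>G\<^esub> U"
  then obtain z u where z: "\<And>\<sigma>. \<sigma> \<in> verts X \<Longrightarrow> z \<sigma> \<in> carrier (grp Y (vmap \<phi> \<sigma>))"
    and Z: "\<And>x. x \<in> arrows X \<Longrightarrow> loc z (src x) \<cdot>\<^sub>Y ind x = ind x \<cdot>\<^sub>Y loc z (tgt X x)"
    and u: "u \<in> U" and n: "n = u \<cdot>\<^sub>Y loc z \<sigma>\<^sub>0"
    unfolding CU_iff centralizer_kernel_iff by blast
  obtain x where x: "x \<in> arrows X" "src x = \<sigma>\<^sub>0" "tgt X x = \<sigma>\<^sub>0" "u = ind x" using u unfolding U_iff by blast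
  have "deck_rel n (cog_id X)"
    unfolding deck_rel_def witness_def
    using z Z cog_id_Aut[OF X.complex_of_groups_axioms dev_X] x n
    by (intro conjI exI[of _ z] exI[of _ x])
      (simp_all add: cog_morphism_id[OF X.complex_of_groups_axioms dev_X])
  then show "n \<in> carrier N" using deck_rel_normalizer by simp
qed

theorem Deck_iso:
  "group (Deck X Y \<phi>) \<and> C <#>\<^bsub>G\<^esub> U \<lhd> N \<and> Deck X Y \<phi> \<cong> N Mod (C <#>\<^bsub>G\<^esub> U)"
proof -
  interpret N: group N by (rule N_group)
  have one: "deck_class \<one>\<^bsub>N\<^esub> = \<one>\<^bsub>Deck X Y \<phi>\<^esub>"
    using deck_class_eq_one_iff[OF N.one_closed] one_in_CU by simp
  \<comment> \<open>The group laws of \<open>Deck\<close> are inherited as those of a homomorphic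
    image of \<open>N\<close>; the unit of that image is the value at the unit, which
    \<open>one\<close> identifies with the declared one.\<close>
  have D: "group (Deck X Y \<phi>)"
    using N.hom_imp_img_group[OF deck_class_hom] unfolding deck_class_image one by (simp add: Deck_def)
  interpret h: group_hom N "Deck X Y \<phi>" deck_class
    using D N_group deck_class_hom by (simp add: group_hom_def group_hom_axioms_def)
  have ker: "kernel N (Deck X Y \<phi>) deck_class = C <#>\<^bsub>G\<^esub> U"
    unfolding kernel_def using deck_class_eq_one_iff CU_subset by blast
  have nor: "C <#>\<^bsub>G\<^esub> U \<lhd> N" using h.normal_kernel unfolding ker .
  have "N Mod (C <#>\<^bsub>G\<^esub> U) \<cong> Deck X Y \<phi>"
    using h.FactGroup_iso[OF deck_class_image] unfolding ker .
  moreover have "group (N Mod (C <#>\<^bsub>G\<^esub> U))" using nor by (rule normal.factorgroup_is_group)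
  ultimately have "Deck X Y \<phi> \<cong> N Mod (C <#>\<^bsub>G\<^esub> U)" using group.iso_sym by blast
  then show ?thesis using D nor by blast
qed

end

theorem theorem1p1:
  fixes X :: "('v, 'e, 'g) complex_of_groups"
    and Y :: "('w, 'd, 'h) complex_of_groups"
    and \<phi> :: "('v, 'e, 'w, 'd, 'g, 'h) cog_morphism"
    and \<sigma>\<^sub>0 :: 'v and \<tau>\<^sub>0 :: 'w
  assumes "complex_of_groups X" and "complex_of_groups Y"
    and "developable X" and "developable Y"
    and "covering X Y \<phi>"
    and "\<sigma>\<^sub>0 \<in> verts X" and "vmap \<phi> \<sigma>\<^sub>0 = \<tau>\<^sub>0"
  defines "G \<equiv> pi1 Y \<tau>\<^sub>0"
    and "U \<equiv> induced_hom X Y \<phi> ` carrier (pi1 X \<sigma>\<^sub>0)"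
    and "K \<equiv> action_kernel Y \<tau>\<^sub>0"
  defines "C \<equiv> centralizer G U \<inter> K"
  defines "N \<equiv> G\<lparr>carrier := normalizer G U\<rparr>"
  shows "group (Deck X Y \<phi>) \<and> C <#>\<^bsub>G\<^esub> U \<lhd> N \<and> Deck X Y \<phi> \<cong> N Mod (C <#>\<^bsub>G\<^esub> U)"
proof -
  interpret developable_covering X Y \<phi> \<sigma>\<^sub>0
    using assms(3-6) by (simp add: developable_covering_def developable_covering_axioms_def)
  show ?thesis
    using Deck_iso unfolding C_def N_def K_def G_def U_def \<open>vmap \<phi> \<sigma>\<^sub>0 = \<tau>\<^sub>0\<close> .
qed

end
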